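(* Let $k\ge0$ be an integer and let $a,b$ satisfy $-1<b<1$ and $0\le a<\frac{n+1+b}2-k$. Then $$\|U\|_{k;a,b}=\Big(\iint_{\mathbb R^{n+1}}|y|^b|z|^{-2a}|\nabla_b^kU|^2\,dz\Big)^{1/2}$$ is an equivalent Hilbertian norm in $\mathcal D^{k;a,b}_{\mathbf e}(\mathbb R^{n+1})$. Moreover, $$\iint_{\mathbb R^{n+1}}|y|^b|z|^{-2a}|\nabla_b^kU|^2\,dz\ \ge\ \mathcal H_{k,a,b}^2\iint_{\mathbb R^{n+1}}|y|^b|z|^{-2(a+k)}|U|^2\,dz\qquad\text{for any }U\in\mathcal D^{k;a,b}_{\mathbf e}(\mathbb R^{n+1}),$$ where $$\mathcal H_{k,a,b}=2^k\,\frac{\Gamma\big(\frac{n+1+b}4+\frac k2-[\frac k2]-\frac a2\big)}{\Gamma\big(\frac{n+1+b}4+\frac k2-[\frac k2]+\frac a2\big)}\ \frac{\Gamma\big(\frac{n+1+b}4+\frac k2+\frac a2\big)}{\Gamma\big(\frac{n+1+b}4-\frac k2-\frac a2\big)} .$$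
   Context: Points of $\mathbb R^{n+1}=\mathbb R^n\times\mathbb R$ are written $z=(x,y)$; $[\cdot]$ denotes the integer part. For $b\in(-1,1)$ put $\Delta_b=\Delta+b\,y^{-1}\partial_y$, where $\Delta$ is the Laplacian on $\mathbb R^{n+1}$. For an integer $j\ge0$ put $\nabla_b^j=\Delta_b^{j/2}$ if $j$ is even, and $\nabla_b^j=\nabla\Delta_b^{(j-1)/2}$ if $j$ is odd; the $0$-th power of an operator is the identity. $C^\infty_{c;\mathbf e}(\mathbb R^{n+1})$ is the space of functions in $C^\infty_c(\mathbb R^{n+1})$ that are even in $y$; for such $U$, $\nabla_b^jU$ is continuous with compact support. Let $$|||U|||_{k;a,b}^2=\sum_{j=0}^k\iint_{\mathbb R^{n+1}}|y|^b|z|^{-2(a+k-j)}|\nabla_b^jU|^2\,dz .$$ The Hilbert space $\mathcal D^{k;a,b}_{\mathbf e}(\mathbb R^{n+1})$ is the completion of $C^\infty_{c;\mathbf e}(\mathbb R^{n+1})$ in $L^2(\mathbb R^{n+1};|y|^b|z|^{-2(a+k)}dz)$ with respect to the norm $|||\cdot|||_{k;a,b}$; for $U$ in this space $\nabla_b^jU$, $j\le k$, is defined by density. "Equivalent" means equivalent to $|||\cdot|||_{k;a,b}$. *)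

theory Defs
  imports "HOL-Analysis.Analysis"
begin

text \<open>A point of the (n+1)-dimensional space is \<open>z = (x, y)\<close> with \<open>n = CARD('n)\<close>;
  the norm of the product type is the Euclidean one.\<close>

type_synonym 'n point = "(real ^ 'n) \<times> real"


section \<open>Test functions and the operators on them\<close>

definition partial :: "'a::euclidean_space \<Rightarrow> ('a \<Rightarrow> real) \<Rightarrow> 'a \<Rightarrow> real" where
  "partial v f z = frechet_derivative f (at z) v"

primrec C_diff :: "nat \<Rightarrow> ('a::euclidean_space \<Rightarrow> real) \<Rightarrow> bool" where
  "C_diff 0 f \<longleftrightarrow> continuous_on UNIV f"
| "C_diff (Suc m) f \<longleftrightarrow> (\<forall>z. f differentiable (at z)) \<and> (\<forall>e\<in>Basis. C_diff m (partial e f))"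

definition smooth :: "('a::euclidean_space \<Rightarrow> real) \<Rightarrow> bool" where
  "smooth f \<longleftrightarrow> (\<forall>m. C_diff m f)"

definition test_even :: "('n::finite point \<Rightarrow> real) set" where
  "test_even = {U. smooth U \<and> compact (closure {z. U z \<noteq> 0}) \<and> (\<forall>x y. U (x, - y) = U (x, y))}"

definition grad :: "('a::euclidean_space \<Rightarrow> real) \<Rightarrow> 'a \<Rightarrow> 'a" where
  "grad f z = (\<Sum>e\<in>Basis. partial e f z *\<^sub>R e)"

definition laplace :: "('a::euclidean_space \<Rightarrow> real) \<Rightarrow> 'a \<Rightarrow> real" where
  "laplace f z = (\<Sum>e\<in>Basis. partial e (partial e f) z)"

text \<open>For \<open>f\<close> smooth and even in \<open>y\<close>, the quotient \<open>y\<^sup>-\<^sup>1 \<partial>\<^sub>y f\<close> extends smoothly across \<open>y = 0\<close>;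
  the value there is the limit (plain division would give the wrong value 0), so that the
  operator can be iterated.\<close>

definition dy_over_y :: "('n::finite point \<Rightarrow> real) \<Rightarrow> 'n point \<Rightarrow> real" where
  "dy_over_y f = (\<lambda>(x, y).
     if y = 0 then Lim (at 0) (\<lambda>t. partial (0, 1) f (x, t) / t)
     else partial (0, 1) f (x, y) / y)"

definition Delta_b :: "real \<Rightarrow> ('n::finite point \<Rightarrow> real) \<Rightarrow> 'n point \<Rightarrow> real" where
  "Delta_b b f z = laplace f z + b * dy_over_y f z"

text \<open>\<open>\<nabla>\<^sub>b\<^sup>j U\<close> is scalar for even \<open>j\<close> and a vector field for odd \<open>j\<close>. Both are embedded isometrically
  in the pairs (scalar part, vector part), the unused part being 0.\<close>

definition nabla :: "real \<Rightarrow> nat \<Rightarrow> ('n::finite point \<Rightarrow> real) \<Rightarrow> 'n point \<Rightarrow> real \<times> 'n point" where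
  "nabla b j U z =
     (if even j then ((Delta_b b ^^ (j div 2)) U z, 0)
      else (0, grad ((Delta_b b ^^ ((j - 1) div 2)) U) z))"


section \<open>Weighted square integrable functions\<close>

definition weight :: "real \<Rightarrow> real \<Rightarrow> 'n::finite point \<Rightarrow> real" where
  "weight b s z = \<bar>snd z\<bar> powr b * norm z powr (- 2 * s)"

definition sq_int :: "real \<Rightarrow> real \<Rightarrow> ('n::finite point \<Rightarrow> 'b::euclidean_space) \<Rightarrow> real" where
  "sq_int b s F = (LINT z|lborel. weight b s z * (norm (F z))\<^sup>2)"

definition L2w :: "real \<Rightarrow> real \<Rightarrow> ('n::finite point \<Rightarrow> 'b::euclidean_space) set" where
  "L2w b s = {F \<in> borel_measurable borel. integrable lborel (\<lambda>z. weight b s z * (norm (F z))\<^sup>2)}"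

definition L2w_tendsto ::
  "real \<Rightarrow> real \<Rightarrow> (nat \<Rightarrow> 'n::finite point \<Rightarrow> 'b::euclidean_space) \<Rightarrow> ('n point \<Rightarrow> 'b) \<Rightarrow> bool" where
  "L2w_tendsto b s F G \<longleftrightarrow> (\<forall>m. F m \<in> L2w b s) \<and> G \<in> L2w b s \<and>
     (\<lambda>m. sqrt (sq_int b s (\<lambda>z. F m z - G z))) \<longlonglongrightarrow> 0"


section \<open>The completion\<close>

text \<open>The triple norm, as a function of the family \<open>G j = \<nabla>\<^sub>b\<^sup>j U\<close>, \<open>j \<le> k\<close>. It is used with the classical
  \<open>\<nabla>\<^sub>b\<^sup>j\<close> on test functions and with the \<open>\<nabla>\<^sub>b\<^sup>j\<close> defined by density on the completion.\<close>

definition triple ::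
  "nat \<Rightarrow> real \<Rightarrow> real \<Rightarrow> (nat \<Rightarrow> 'n::finite point \<Rightarrow> real \<times> 'n point) \<Rightarrow> real" where
  "triple k a b G = sqrt (\<Sum>j\<le>k. sq_int b (a + real k - real j) (G j))"

definition triple_norm_test :: "nat \<Rightarrow> real \<Rightarrow> real \<Rightarrow> ('n::finite point \<Rightarrow> real) \<Rightarrow> real" where
  "triple_norm_test k a b U = triple k a b (\<lambda>j. nabla b j U)"

definition approximates ::
  "nat \<Rightarrow> real \<Rightarrow> real \<Rightarrow> (nat \<Rightarrow> 'n::finite point \<Rightarrow> real) \<Rightarrow> ('n point \<Rightarrow> real) \<Rightarrow> bool" where
  "approximates k a b \<phi> U \<longleftrightarrow>
     (\<forall>m. \<phi> m \<in> test_even) \<and>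
     (\<forall>\<epsilon>>0. \<exists>M. \<forall>m\<ge>M. \<forall>l\<ge>M. triple_norm_test k a b (\<lambda>z. \<phi> m z - \<phi> l z) < \<epsilon>) \<and>
     L2w_tendsto b (a + real k) \<phi> U"

text \<open>Elements are represented by Borel functions, to be identified when equal almost everywhere.\<close>

definition D_e :: "nat \<Rightarrow> real \<Rightarrow> real \<Rightarrow> ('n::finite point \<Rightarrow> real) set" where
  "D_e k a b = {U. \<exists>\<phi>. approximates k a b \<phi> U}"

text \<open>The choice is among representatives of one class modulo null sets:
  the limit does not depend on the approximating sequence.\<close>

definition nabla_D ::
  "nat \<Rightarrow> real \<Rightarrow> real \<Rightarrow> nat \<Rightarrow> ('n::finite point \<Rightarrow> real) \<Rightarrow> 'n point \<Rightarrow> real \<times> 'n point" where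
  "nabla_D k a b j U = (SOME V. \<exists>\<phi>. approximates k a b \<phi> U \<and>
     L2w_tendsto b (a + real k - real j) (\<lambda>m. nabla b j (\<phi> m)) V)"

definition triple_norm :: "nat \<Rightarrow> real \<Rightarrow> real \<Rightarrow> ('n::finite point \<Rightarrow> real) \<Rightarrow> real" where
  "triple_norm k a b U = triple k a b (\<lambda>j. nabla_D k a b j U)"


section \<open>Hilbertian norms on spaces of functions modulo null sets\<close>

definition hilbertian_norm_on ::
  "('a::euclidean_space \<Rightarrow> real) set \<Rightarrow> (('a \<Rightarrow> real) \<Rightarrow> real) \<Rightarrow> bool" where
  "hilbertian_norm_on D N \<longleftrightarrow>
     (\<lambda>z. 0) \<in> D \<and>
     (\<forall>U\<in>D. \<forall>V\<in>D. (\<lambda>z. U z + V z) \<in> D) \<and>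
     (\<forall>c. \<forall>U\<in>D. (\<lambda>z. c * U z) \<in> D) \<and>
     (\<exists>B :: ('a \<Rightarrow> real) \<Rightarrow> ('a \<Rightarrow> real) \<Rightarrow> real.
        (\<forall>U\<in>D. \<forall>V\<in>D. B U V = B V U) \<and>
        (\<forall>U\<in>D. \<forall>V\<in>D. \<forall>W\<in>D. B (\<lambda>z. U z + V z) W = B U W + B V W) \<and>
        (\<forall>c. \<forall>U\<in>D. \<forall>V\<in>D. B (\<lambda>z. c * U z) V = c * B U V) \<and>
        (\<forall>U\<in>D. 0 \<le> B U U \<and> (B U U = 0 \<longleftrightarrow> (AE z in lborel. U z = 0))) \<and>
        (\<forall>U\<in>D. N U = sqrt (B U U)))"

definition equivalent_norms_on :: "'f set \<Rightarrow> ('f \<Rightarrow> real) \<Rightarrow> ('f \<Rightarrow> real) \<Rightarrow> bool" where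
  "equivalent_norms_on D N N' \<longleftrightarrow>
     (\<exists>c>0. \<exists>C>0. \<forall>U\<in>D. c * N' U \<le> N U \<and> N U \<le> C * N' U)"

definition top_norm :: "nat \<Rightarrow> real \<Rightarrow> real \<Rightarrow> ('n::finite point \<Rightarrow> real) \<Rightarrow> real" where
  "top_norm k a b U = sqrt (sq_int b a (nabla_D k a b k U))"


section \<open>The constant\<close>

definition H_const :: "nat \<Rightarrow> nat \<Rightarrow> real \<Rightarrow> real \<Rightarrow> real" where
  "H_const n k a b =
     (let q = (real n + 1 + b) / 4; r = real k / 2 - real (k div 2) in
      2 ^ k * (Gamma (q + r - a / 2) / Gamma (q + r + a / 2))
            * (Gamma (q + real k / 2 + a / 2) / Gamma (q - real k / 2 - a / 2)))"

end

(* Put d = n + 1 + b and w_s = |y|^b |z|^(-2s). The measure w_s dz is homogeneous of degree d - 2s,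
   which gives div(w_s z) = (d - 2s) w_s in weak form, also across the origin; Cauchy-Schwarz then
   yields the Hardy inequality. Pairing Delta_b V with |z|^(-2s-2) V, integrating by parts and inserting
   Hardy yields the Rellich inequality with its sharp constant, and a weighted bound for grad V. Both
   inequalities are iterated from k to k + 2, and the constants match the Gamma quotients through
   Gamma(x + 1) = x Gamma(x).
   The same integration by parts, tested with the sequence itself, shows that the operators nabla_b^j
   are closable, so that everything extends to the completion. *)

theory Submission
  imports Defs
begin

section \<open>Calculus of the test functions\<close>

text \<open>In general the weights are smooth neither on y = 0 nor at the origin, and test functions
  need not vanish there. So no weight is differentiated at its singularities: |y|^b enters only
  through its invariance under translations in x and its homogeneity under dilations in y, and
  |z|^(-2s) through homogeneity or as the limit of (|z|^2 + eps)^(-s). Evenness makes this work: for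
  even V the derivative in y is y g with g smooth, so the y-component of U grad V is y times a
  smooth function and the dilation in y applies to it. The upper bound on a makes the heaviest
  weight, of exponent a + k, locally integrable. The Rellich constant is C = (d - 4 - 2s)^2 / 4 + (s
  + 1)(d - 4 - 2s): the Hardy constant plus the term left by the integration by parts. Closability
  makes the derivatives on the completion independent of the approximating sequence. It cannot come
  from the Hardy and Rellich bounds, since these control low orders by high ones.\<close>

declare split_paired_All [simp del] split_paired_Ex [simp del]

lemma partial_eqI: "(f has_derivative D) (at z) \<Longrightarrow> partial v f z = D v"
  unfolding partial_def by (metis frechet_derivative_at)

lemma partial_eq_inner_grad:
  fixes f :: "'a::euclidean_space \<Rightarrow> real"
  assumes "f differentiable (at z)"
  shows "partial v f z = v \<bullet> grad f z"
proof -
  let ?D = "frechet_derivative f (at z)"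
  have "linear ?D" using assms by (rule linear_frechet_derivative)
  then have "?D (\<Sum>e\<in>Basis. (v \<bullet> e) *\<^sub>R e) = (\<Sum>e\<in>Basis. (v \<bullet> e) * ?D e)"
    by (simp add: linear_sum linear_scale)
  then show ?thesis
    unfolding partial_def grad_def euclidean_representation
    by (simp add: inner_sum_right mult.commute)
qed

lemma has_derivative_grad:
  fixes f :: "'a::euclidean_space \<Rightarrow> real"
  assumes "f differentiable (at z)"
  shows "(f has_derivative (\<lambda>v. v \<bullet> grad f z)) (at z)"
  using assms partial_eq_inner_grad[OF assms]
  by (metis (no_types, lifting) ext frechet_derivative_works partial_def)

lemma grad_inner_Basis: "e \<in> Basis \<Longrightarrow> grad f z \<bullet> e = partial e f z"
  unfolding grad_def by simp

lemma partial_add: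
  fixes f g :: "'a::euclidean_space \<Rightarrow> real"
  assumes "f differentiable (at z)" "g differentiable (at z)"
  shows "partial v (\<lambda>z. f z + g z) z = partial v f z + partial v g z"
  using partial_eqI[OF has_derivative_add[OF has_derivative_grad[OF assms(1)] has_derivative_grad[OF assms(2)]]]
  by (simp add: partial_eq_inner_grad assms)

lemma partial_mult:
  fixes f g :: "'a::euclidean_space \<Rightarrow> real"
  assumes "f differentiable (at z)" "g differentiable (at z)"
  shows "partial v (\<lambda>z. f z * g z) z = f z * partial v g z + partial v f z * g z"
  using partial_eqI[OF has_derivative_mult[OF has_derivative_grad[OF assms(1)] has_derivative_grad[OF assms(2)]]]
  by (simp add: partial_eq_inner_grad assms)

lemma partial_cmult:
  fixes f :: "'a::euclidean_space \<Rightarrow> real"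
  assumes "f differentiable (at z)"
  shows "partial v (\<lambda>z. c * f z) z = c * partial v f z"
  using partial_eqI[OF has_derivative_mult_right[OF has_derivative_grad[OF assms]]]
  by (simp add: partial_eq_inner_grad assms)

lemma C_diff_imp_continuous: "C_diff m f \<Longrightarrow> continuous_on UNIV f"
  by (cases m) (auto simp: continuous_on_eq_continuous_at differentiable_imp_continuous_within)

lemma C_diff_differentiable: "C_diff (Suc m) f \<Longrightarrow> f differentiable (at z)"
  by simp

lemma C_diff_SucD: "C_diff (Suc m) f \<Longrightarrow> C_diff m f"
proof (induction m arbitrary: f)
  case 0 then show ?case using C_diff_imp_continuous by (metis C_diff.simps(1))
next
  case (Suc m) then show ?case by simp
qed

lemma C_diff_add: "C_diff m f \<Longrightarrow> C_diff m g \<Longrightarrow> C_diff m (\<lambda>z. f z + g z)"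
proof (induction m arbitrary: f g)
  case 0 then show ?case by (auto intro: continuous_intros)
next
  case (Suc m)
  have "partial e (\<lambda>z. f z + g z) = (\<lambda>z. partial e f z + partial e g z)" for e
    using Suc.prems by (auto simp: partial_add)
  then show ?case using Suc by simp
qed

lemma C_diff_cmult: "C_diff m f \<Longrightarrow> C_diff m (\<lambda>z. c * f z)"
proof (induction m arbitrary: f)
  case 0 then show ?case by (auto intro: continuous_intros)
next
  case (Suc m)
  have "partial e (\<lambda>z. c * f z) = (\<lambda>z. c * partial e f z)" for e
    using Suc.prems by (auto simp: partial_cmult)
  then show ?case using Suc by simp
qed

lemma C_diff_mult: "C_diff m f \<Longrightarrow> C_diff m g \<Longrightarrow> C_diff m (\<lambda>z. f z * g z)"
proof (induction m arbitrary: f g)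
  case 0 then show ?case by (auto intro: continuous_intros)
next
  case (Suc m)
  have "partial e (\<lambda>z. f z * g z) = (\<lambda>z. f z * partial e g z + partial e f z * g z)" for e
    using Suc.prems by (auto simp: partial_mult)
  \<comment> \<open>The product rule leaves one factor undifferentiated in each term, so both
    factors have to be lowered from class \<open>Suc m\<close> to class \<open>m\<close>.\<close>
  then show ?case using Suc Suc.prems[THEN C_diff_SucD] by (simp add: C_diff_add)
qed

lemma C_diff_const: "C_diff m (\<lambda>z. c)"
proof (induction m arbitrary: c)
  case (Suc m)
  have "partial e (\<lambda>z::'a. c) = (\<lambda>z. 0)" for e
    by (auto intro!: partial_eqI[where D="\<lambda>_. 0"])
  then show ?case using Suc by simp
qed auto

lemma smoothD:
  assumes "smooth f"
  shows "C_diff m f" "f differentiable (at z)" "e \<in> Basis \<Longrightarrow> smooth (partial e f)"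
proof -
  show "C_diff m f" for m using assms by (simp add: smooth_def)
  have *: "C_diff (Suc m) f" for m using assms by (simp add: smooth_def)
  show "f differentiable (at z)" using *[of 0] by simp
  show "smooth (partial e f)" if "e \<in> Basis"
    unfolding smooth_def using * that by simp
qed

lemma smooth_add: "smooth f \<Longrightarrow> smooth g \<Longrightarrow> smooth (\<lambda>z. f z + g z)"
  and smooth_mult: "smooth f \<Longrightarrow> smooth g \<Longrightarrow> smooth (\<lambda>z. f z * g z)"
  and smooth_cmult: "smooth f \<Longrightarrow> smooth (\<lambda>z. c * f z)"
  and smooth_const: "smooth (\<lambda>z. c)"
  unfolding smooth_def by (auto intro: C_diff_add C_diff_mult C_diff_cmult C_diff_const)

lemma smooth_continuous: "smooth f \<Longrightarrow> continuous_on UNIV f"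
  using C_diff_imp_continuous smoothD(1) by blast

lemma continuous_on_grad:
  assumes "C_diff (Suc 0) f" shows "continuous_on UNIV (grad f)"
  unfolding grad_def using assms by (auto intro!: continuous_intros)

text \<open>An explicit radius replaces the closure in the definition of compact support, because
  the dominating functions below are multiples of indicators of balls. The radius may be negative,
  which forces f = 0.\<close>

definition supp_in :: "real \<Rightarrow> ('a::real_normed_vector \<Rightarrow> 'b::zero) \<Rightarrow> bool" where
  "supp_in R f \<longleftrightarrow> (\<forall>z. R < norm z \<longrightarrow> f z = 0)"

lemma supp_in_partial:
  assumes "supp_in R f" shows "supp_in R (partial v f)"
  unfolding supp_in_def
proof (intro allI impI)
  fix z :: 'a assume z: "R < norm z"
  have "open {z::'a. R < norm z}" by (intro open_Collect_less continuous_intros)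
  then have "(f has_derivative (\<lambda>_. 0)) (at z)"
    by (intro has_derivative_transform_within_open[OF has_derivative_const])
      (use assms z in \<open>auto simp: supp_in_def\<close>)
  then show "partial v f z = 0" by (rule partial_eqI)
qed

lemma supp_in_grad: "supp_in R f \<Longrightarrow> supp_in R (grad f)"
  unfolding supp_in_def grad_def using supp_in_partial[of R f] by (simp add: supp_in_def)

lemma supp_in_bounded: "bounded {z. f z \<noteq> 0} \<longleftrightarrow> (\<exists>R. supp_in R f)"
  unfolding bounded_iff supp_in_def by (auto simp: not_less) (meson not_le)+

section \<open>Reflection, dilation and integral means in the last coordinate\<close>

abbreviation e\<^sub>y :: "'n::finite point" where "e\<^sub>y \<equiv> (0, 1)"

definition y_reflect :: "'n::finite point \<Rightarrow> 'n point" where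
  "y_reflect z = (fst z, - snd z)"

definition y_scale :: "real \<Rightarrow> 'n::finite point \<Rightarrow> 'n point" where
  "y_scale t z = (fst z, t * snd z)"

lemma e_y_Basis: "e\<^sub>y \<in> Basis"
  by (simp add: Basis_prod_def)

lemma inner_e_y: "z \<bullet> e\<^sub>y = snd z"
  by (simp add: inner_prod_def)

lemma Basis_point_cases:
  assumes "e \<in> (Basis :: 'n::finite point set)"
  obtains "e = e\<^sub>y" | i where "i \<in> Basis" "e = (i, 0)"
  using assms by (auto simp: Basis_prod_def)

lemma has_derivative_y_scale: "(y_scale t has_derivative y_scale t) (at z within S)"
  unfolding y_scale_def by (auto intro!: derivative_eq_intros)

lemma partial_y_scale:
  assumes "f differentiable (at (y_scale t z))"
  shows "partial v (\<lambda>z. f (y_scale t z)) z = partial (y_scale t v) f (y_scale t z)"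
  using partial_eqI[OF has_derivative_compose[OF has_derivative_y_scale has_derivative_grad[OF assms]]]
  by (simp add: partial_eq_inner_grad assms)

text \<open>The exponent \<open>p\<close> makes the family closed under differentiation: \<open>\<partial>\<^sub>y\<close> raises it by one.\<close>

definition y_mean :: "nat \<Rightarrow> ('n::finite point \<Rightarrow> real) \<Rightarrow> 'n point \<Rightarrow> real" where
  "y_mean p \<phi> z = integral (cbox 0 1) (\<lambda>t. t ^ p * \<phi> (y_scale t z))"

lemma continuous_on_y_scale:
  assumes "continuous_on UNIV \<phi>"
  shows "continuous_on S (\<lambda>(z, t). \<phi> (y_scale t z))"
  unfolding case_prod_unfold y_scale_def
  by (rule continuous_on_compose2[OF assms]) (auto intro!: continuous_intros)

lemma y_mean_integrable:
  assumes "continuous_on UNIV \<phi>"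
  shows "(\<lambda>t. t ^ p * \<phi> (y_scale t z)) integrable_on cbox 0 (1::real)"
  by (rule integrable_continuous)
    (intro continuous_intros continuous_on_compose2[OF assms], auto simp: y_scale_def intro!: continuous_intros)

text \<open>Differentiation under the integral sign. The map \<open>y_scale t\<close> multiplies
  only the last coordinate, so the chain rule produces a factor t in the direction
  \<open>e\<^sub>y\<close> alone; this is the shift from \<open>p\<close> to
  \<open>Suc p\<close>.\<close>

lemma y_mean_has_derivative:
  fixes \<phi> :: "'n::finite point \<Rightarrow> real"
  assumes "C_diff (Suc 0) \<phi>"
  shows "(y_mean p \<phi> has_derivative (\<lambda>v. (\<Sum>e\<in>Basis. (v \<bullet> e) *
     (if e = e\<^sub>y then y_mean (Suc p) (partial e \<phi>) z else y_mean p (partial e \<phi>) z)))) (at z)"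
proof -
  define q where "q e = (if e = (e\<^sub>y::'n point) then Suc p else p)" for e
  \<comment> \<open>The derivative is packaged as a bounded linear map because the Leibniz rule asks
    for its joint continuity in (z, t) in operator norm.\<close>
  define fx where "fx z t = (\<Sum>e\<in>Basis. (t ^ q e * partial e \<phi> (y_scale t z)) *\<^sub>R blinfun_inner_left e)"
    for z :: "'n point" and t :: real
  have cp: "continuous_on UNIV (partial e \<phi>)" if "e \<in> Basis" for e
    using assms that by simp
  have der: "((\<lambda>z. t ^ p * \<phi> (y_scale t z)) has_derivative blinfun_apply (fx z t)) (at z within UNIV)" for z t
  proof -
    have diff: "\<phi> differentiable (at (y_scale t z))" using assms by (rule C_diff_differentiable)
    have "((\<lambda>z. t ^ p * \<phi> (y_scale t z)) has_derivative
        (\<lambda>v. t ^ p * (y_scale t v \<bullet> grad \<phi> (y_scale t z)))) (at z)"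
      by (rule has_derivative_mult_right has_derivative_compose[OF has_derivative_y_scale has_derivative_grad[OF diff]])+
    moreover have "t ^ p * (y_scale t v \<bullet> grad \<phi> (y_scale t z)) = blinfun_apply (fx z t) v" for v
    proof -
      have "y_scale t v \<bullet> e = (if e = e\<^sub>y then t else 1) * (v \<bullet> e)" if "e \<in> Basis" for e
        using that by (elim Basis_point_cases) (auto simp: y_scale_def inner_prod_def)
      then show ?thesis
        unfolding fx_def grad_def
        by (simp add: inner_sum_right blinfun.sum_left blinfun.scaleR_left sum_distrib_left q_def)
          (auto intro!: sum.cong simp: inner_commute)
    qed
    ultimately show ?thesis by (simp only:)
  qed
  have cont: "continuous_on (UNIV \<times> cbox 0 1) (\<lambda>(z, t). fx z t)"
    unfolding fx_def case_prod_unfold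
    by (intro continuous_intros continuous_on_y_scale[OF cp, unfolded case_prod_unfold])
  have D: "(y_mean p \<phi> has_derivative integral (cbox 0 1) (fx z)) (at z within UNIV)"
    unfolding y_mean_def
    by (rule leibniz_rule[OF der _ cont]) (use y_mean_integrable C_diff_imp_continuous[OF assms] in auto)
  have "integral (cbox 0 1) (fx z) v = (\<Sum>e\<in>Basis. (v \<bullet> e) * y_mean (q e) (partial e \<phi>) z)" for v
  proof -
    have "((\<lambda>t. t ^ q e * partial e \<phi> (y_scale t z)) has_integral y_mean (q e) (partial e \<phi>) z) (cbox 0 1)"
      if "e \<in> Basis" for e
      unfolding y_mean_def by (rule integrable_integral y_mean_integrable cp that)+
    then have "(fx z has_integral (\<Sum>e\<in>Basis. y_mean (q e) (partial e \<phi>) z *\<^sub>R blinfun_inner_left e)) (cbox 0 1)"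
      unfolding fx_def
      by (intro has_integral_sum finite_Basis has_integral_scaleR_left) auto
    then show ?thesis
      by (simp add: integral_unique blinfun.sum_left blinfun.scaleR_left)
         (auto intro!: sum.cong simp: inner_commute)
  qed
  moreover have "y_mean (q e) (partial e \<phi>) z =
    (if e = e\<^sub>y then y_mean (Suc p) (partial e \<phi>) z else y_mean p (partial e \<phi>) z)" for e
    by (simp add: q_def)
  ultimately have "integral (cbox 0 1) (fx z) v = (\<Sum>e\<in>Basis. (v \<bullet> e) *
     (if e = e\<^sub>y then y_mean (Suc p) (partial e \<phi>) z else y_mean p (partial e \<phi>) z))" for v
    by simp
  then show ?thesis by (intro has_derivative_eq_rhs[OF D] ext)
qed

text \<open>The induction generalises over both the function and the exponent: a partial derivative
  of a mean is a mean of a partial derivative, possibly with a larger power of t.\<close>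

lemma y_mean_C_diff: "C_diff m \<phi> \<Longrightarrow> C_diff m (y_mean p \<phi>)"
proof (induction m arbitrary: \<phi> p)
  case 0
  then show ?case
    unfolding C_diff.simps y_mean_def
    by (intro integral_continuous_on_param)
      (auto simp: case_prod_unfold intro!: continuous_intros
         continuous_on_y_scale[unfolded case_prod_unfold])
next
  case (Suc m)
  have "C_diff (Suc 0) \<phi>" using Suc.prems by (auto intro: C_diff_imp_continuous)
  note D = y_mean_has_derivative[OF this]
  have "y_mean p \<phi> differentiable (at z)" for z using D differentiable_def by blast
  moreover have "partial e (y_mean p \<phi>) =
    (if e = e\<^sub>y then y_mean (Suc p) (partial e \<phi>) else y_mean p (partial e \<phi>))" if "e \<in> Basis" for e
  proof
    fix z
    have "(e \<bullet> e') * c = (if e' = e then c else 0)" if "e' \<in> Basis" for e' and c :: real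
      using \<open>e \<in> Basis\<close> that by (auto simp: inner_Basis)
    then show "partial e (y_mean p \<phi>) z =
      (if e = e\<^sub>y then y_mean (Suc p) (partial e \<phi>) else y_mean p (partial e \<phi>)) z"
      using that by (simp add: partial_eqI[OF D])
  qed
  ultimately show ?case using Suc by auto
qed

lemma y_mean_smooth: "smooth \<phi> \<Longrightarrow> smooth (y_mean p \<phi>)"
  unfolding smooth_def using y_mean_C_diff by blast

text \<open>The fundamental theorem of calculus along the segment from (x, 0) to (x, y),
  parametrised by t in [0, 1].\<close>

lemma snd_mult_y_mean:
  assumes "C_diff (Suc 0) h"
  shows "snd z * y_mean 0 (partial e\<^sub>y h) z = h z - h (fst z, 0)"
proof -
  have "((\<lambda>t. h (y_scale t z)) has_vector_derivative snd z * partial e\<^sub>y h (y_scale t z)) (at t within {0..1})" for t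
  proof -
    have "((\<lambda>t. y_scale t z) has_derivative (\<lambda>s. s *\<^sub>R (0, snd z))) (at t within {0..1})"
      unfolding y_scale_def by (auto intro!: derivative_eq_intros)
    moreover have "h differentiable (at (y_scale t z))" using assms by (rule C_diff_differentiable)
    ultimately have "((\<lambda>t. h (y_scale t z)) has_derivative
       (\<lambda>s. (s *\<^sub>R (0, snd z)) \<bullet> grad h (y_scale t z))) (at t within {0..1})"
      by (intro has_derivative_compose[OF _ has_derivative_grad])
    moreover have "(s *\<^sub>R (0, snd z)) \<bullet> grad h (y_scale t z) = s *\<^sub>R (snd z * partial e\<^sub>y h (y_scale t z))" for s
      using grad_inner_Basis[OF e_y_Basis, of h "y_scale t z"]
      by (simp add: inner_prod_def mult.commute)
    ultimately show ?thesis unfolding has_vector_derivative_def by (simp only:)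
  qed
  then have "((\<lambda>t. snd z * partial e\<^sub>y h (y_scale t z)) has_integral (h (y_scale 1 z) - h (y_scale 0 z))) {0..1}"
    by (intro fundamental_theorem_of_calculus) auto
  from integral_unique[OF this] show ?thesis
    by (simp add: y_mean_def y_scale_def)
qed

text \<open>The chain rule for the reflection; the factor c treats even functions (c = 1) and odd
  ones (c = -1) together.\<close>

lemma partial_y_reflect:
  assumes "\<And>z. f differentiable (at z)" "\<And>z. f (y_reflect z) = c * f z"
  shows "partial (y_reflect v) f (y_reflect z) = c * partial v f z"
proof -
  have y: "y_reflect = y_scale (-1)" by (simp add: y_reflect_def y_scale_def fun_eq_iff)
  have "partial (y_reflect v) f (y_reflect z) = partial v (\<lambda>z. f (y_reflect z)) z"
    unfolding y using assms(1) by (rule partial_y_scale[symmetric])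
  also have "\<dots> = c * partial v f z"
    using partial_cmult[OF assms(1)] by (simp only: assms(2))
  finally show ?thesis .
qed

section \<open>Even test functions and their stability under the operators\<close>

lemma test_even_iff:
  "U \<in> test_even \<longleftrightarrow> smooth U \<and> (\<exists>R. supp_in R U) \<and> (\<forall>z. U (y_reflect z) = U z)"
proof -
  have "(\<forall>x y. U (x, - y) = U (x, y)) \<longleftrightarrow> (\<forall>z. U (y_reflect z) = U z)"
    by (simp add: split_paired_All y_reflect_def)
  then show ?thesis unfolding test_even_def mem_Collect_eq compact_closure supp_in_bounded by simp
qed

lemma test_evenD:
  assumes "U \<in> test_even"
  shows "smooth U" "C_diff m U" "U differentiable (at z)" "U (y_reflect z) = U z" "\<exists>R. supp_in R U"
  using assms smoothD by (auto simp: test_even_iff)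

lemma test_even_add: "U \<in> test_even \<Longrightarrow> V \<in> test_even \<Longrightarrow> (\<lambda>z. U z + V z) \<in> test_even"
  unfolding test_even_iff
proof (safe intro!: smooth_add)
  fix R S assume "supp_in R U" "supp_in S V"
  then show "\<exists>R. supp_in R (\<lambda>z. U z + V z)"
    by (intro exI[of _ "max R S"]) (auto simp: supp_in_def)
qed auto

lemma test_even_mult: "U \<in> test_even \<Longrightarrow> V \<in> test_even \<Longrightarrow> (\<lambda>z. U z * V z) \<in> test_even"
  unfolding test_even_iff by (auto simp: supp_in_def intro: smooth_mult)

lemma test_even_cmult: "U \<in> test_even \<Longrightarrow> (\<lambda>z. c * U z) \<in> test_even"
  unfolding test_even_iff by (auto simp: supp_in_def intro: smooth_cmult)

lemma test_even_sum:
  assumes "\<And>i. i \<in> I \<Longrightarrow> U i \<in> test_even" shows "(\<lambda>z. \<Sum>i\<in>I. U i z) \<in> test_even"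
  using assms
proof (induction I rule: infinite_finite_induct)
  case (insert i I)
  then show ?case using test_even_add[of "U i" "\<lambda>z. \<Sum>i\<in>I. U i z"] by simp
qed (auto simp: test_even_iff supp_in_def smooth_const)

lemma test_even_partial_partial:
  assumes U: "U \<in> test_even" and e: "e \<in> Basis"
  shows "partial e (partial e U) \<in> test_even"
  unfolding test_even_iff
proof (intro conjI allI)
  note s = test_evenD(1)[OF U]
  show "smooth (partial e (partial e U))" using s e smoothD by blast
  show "\<exists>R. supp_in R (partial e (partial e U))" using test_evenD(5)[OF U] supp_in_partial by blast
  fix z
  \<comment> \<open>c is the sign by which the reflection acts on e: -1 for \<open>e\<^sub>y\<close>
    and 1 for the directions in x. A first derivative picks up c, a second one in the same direction
    c * c = 1.\<close>
  obtain c :: real where c: "\<And>f::'a point \<Rightarrow> real. \<And>z. f differentiable (at z) \<Longrightarrow> partial (y_reflect e) f z = c * partial e f z" "c * c = 1"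
  proof (cases "e = e\<^sub>y")
    case True
    have "partial (y_reflect e\<^sub>y) f z = - partial e\<^sub>y f z" if "f differentiable (at z)" for f :: "'a point \<Rightarrow> real" and z
    proof -
      have "y_reflect e\<^sub>y = - (e\<^sub>y :: 'a point)" by (simp add: y_reflect_def uminus_prod_def)
      then show ?thesis using that by (simp only: partial_eq_inner_grad inner_minus_left)
    qed
    then show ?thesis using that[of "-1"] True by auto
  next
    case False
    then have "y_reflect e = e" using e by (auto elim!: Basis_point_cases simp: y_reflect_def)
    then show ?thesis using that[of 1] by auto
  qed
  have "c * partial e U (y_reflect z) = partial e U z" for z
    using partial_y_reflect[of U 1 e z] test_evenD[OF U] c(1)[of U] by auto
  then have *: "partial e U (y_reflect z) = c * partial e U z" for z
    using c(2) by (metis mult.assoc mult.left_neutral)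
  have d: "partial e U differentiable (at z)" for z using smoothD(2,3) s e by blast
  have "c * partial e (partial e U) (y_reflect z) = c * partial e (partial e U) z"
    using partial_y_reflect[of "partial e U" c e z] * d c(1)[of "partial e U"] by auto
  then show "partial e (partial e U) (y_reflect z) = partial e (partial e U) z"
    using c(2) by (metis mult.assoc mult.left_neutral)
qed

lemma partial_y_odd:
  assumes "U \<in> test_even" shows "partial e\<^sub>y U (y_reflect z) = - partial e\<^sub>y U z"
proof -
  have "y_reflect e\<^sub>y = - (e\<^sub>y :: 'a point)" by (simp add: y_reflect_def uminus_prod_def)
  then have "partial (y_reflect e\<^sub>y) U (y_reflect z) = - partial e\<^sub>y U (y_reflect z)"
    by (simp only: partial_eq_inner_grad[OF test_evenD(3)[OF assms]] inner_minus_left)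
  then show ?thesis
    using partial_y_reflect[of U 1 e\<^sub>y z] test_evenD[OF assms] by simp
qed

text \<open>Hadamard's lemma: the singular quotient is an integral mean of \<open>\<partial>\<^sub>y\<^sup>2 U\<close>, hence smooth.\<close>

lemma dy_over_y_eq_y_mean:
  assumes U: "U \<in> test_even"
  shows "dy_over_y U = y_mean 0 (partial e\<^sub>y (partial e\<^sub>y U))"
proof
  fix z :: "'a point"
  let ?h = "partial e\<^sub>y U" and ?g = "y_mean 0 (partial e\<^sub>y (partial e\<^sub>y U))"
  have sh: "smooth ?h" using test_evenD(1)[OF U] smoothD(3) e_y_Basis by blast
  have h0: "?h (x, 0) = 0" for x using partial_y_odd[OF U, of "(x, 0)"] by (simp add: y_reflect_def)
  have yg: "y * ?g (x, y) = ?h (x, y)" for x y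
    using snd_mult_y_mean[OF smoothD(1)[OF sh], of "(x, y)"] h0 by simp
  obtain x y where z: "z = (x, y)" by fastforce
  show "dy_over_y U z = ?g z"
  proof (cases "y = 0")
    case False
    then show ?thesis using yg[of y x] by (simp add: z dy_over_y_def field_simps)
  next
    case True
    have "continuous_on UNIV ?g"
      by (intro smooth_continuous y_mean_smooth smoothD(3) sh e_y_Basis)
    then have "continuous_on UNIV (\<lambda>t. ?g (x, t))"
      by (rule continuous_on_compose2) (auto intro!: continuous_intros)
    then have "((\<lambda>t. ?g (x, t)) \<longlongrightarrow> ?g (x, 0)) (at 0)"
      by (simp add: continuous_on_def)
    \<comment> \<open>At t = 0 itself the division returns 0, so the two functions are compared on a
      punctured neighbourhood, which is all that the limit sees.\<close>
    moreover have "\<forall>\<^sub>F t in at 0. ?g (x, t) = ?h (x, t) / t"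
      using yg by (auto simp: eventually_at_filter field_simps)
    ultimately have "((\<lambda>t. ?h (x, t) / t) \<longlongrightarrow> ?g (x, 0)) (at 0)"
      by (rule Lim_transform_eventually)
    then show ?thesis by (simp add: z True dy_over_y_def tendsto_Lim)
  qed
qed

lemma snd_mult_dy_over_y:
  assumes U: "U \<in> test_even"
  shows "snd z * dy_over_y U z = partial e\<^sub>y U z"
proof -
  have "smooth (partial e\<^sub>y U)" using test_evenD(1)[OF U] smoothD(3) e_y_Basis by blast
  moreover have "partial e\<^sub>y U (fst z, 0) = 0"
    using partial_y_odd[OF U, of "(fst z, 0)"] by (simp add: y_reflect_def)
  ultimately show ?thesis
    using snd_mult_y_mean[OF smoothD(1), of "partial e\<^sub>y U" z] by (simp add: dy_over_y_eq_y_mean[OF U])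
qed

lemma dy_over_y_test_even:
  assumes U: "U \<in> test_even"
  shows "dy_over_y U \<in> test_even"
  unfolding test_even_iff
proof (intro conjI allI)
  show "smooth (dy_over_y U)"
    unfolding dy_over_y_eq_y_mean[OF U]
    using test_evenD(1)[OF U] smoothD(3) e_y_Basis y_mean_smooth by blast
  obtain R where R: "supp_in R U" using test_evenD(5)[OF U] by blast
  have "dy_over_y U z = 0" if "R < norm z" for z
  \<comment> \<open>On y = 0 one cannot divide by y, but there \<open>y_scale t\<close> fixes z, so
    the mean collapses to a multiple of the second derivative at z itself.\<close>
  proof (cases "snd z = 0")
    case True
    have "partial e\<^sub>y (partial e\<^sub>y U) z = 0"
      using supp_in_partial[OF supp_in_partial[OF R]] that unfolding supp_in_def by blast
    moreover have "y_scale t z = z" for t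
      using True by (simp add: y_scale_def prod_eq_iff)
    ultimately show ?thesis by (simp add: dy_over_y_eq_y_mean[OF U] y_mean_def)
  next
    case False
    have "partial e\<^sub>y U z = 0"
      using supp_in_partial[OF R] that unfolding supp_in_def by blast
    then show ?thesis using snd_mult_dy_over_y[OF U, of z] False by simp
  qed
  then show "\<exists>R. supp_in R (dy_over_y U)" unfolding supp_in_def by blast
  show "dy_over_y U (y_reflect z) = dy_over_y U z" for z
  proof (cases "snd z = 0")
    case True
    then have "y_reflect z = z" by (simp add: y_reflect_def prod_eq_iff)
    then show ?thesis by simp
  next
    case False
    then show ?thesis
      using snd_mult_dy_over_y[OF U, of z] snd_mult_dy_over_y[OF U, of "y_reflect z"] partial_y_odd[OF U, of z]
      by (simp add: y_reflect_def) (metis add.inverse_inverse mult_cancel_left mult_minus_left)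
  qed
qed

lemma Delta_b_test_even:
  assumes "U \<in> test_even" shows "Delta_b b U \<in> test_even"
proof -
  have "(\<lambda>z. laplace U z + b * dy_over_y U z) \<in> test_even"
    unfolding laplace_def
    by (intro test_even_add test_even_sum test_even_partial_partial test_even_cmult dy_over_y_test_even assms)
  then show ?thesis unfolding Delta_b_def .
qed

lemma grad_add: "U \<in> test_even \<Longrightarrow> V \<in> test_even \<Longrightarrow> grad (\<lambda>z. U z + V z) z = grad U z + grad V z"
  unfolding grad_def by (simp add: partial_add test_evenD scaleR_left_distrib sum.distrib)

lemma grad_cmult: "U \<in> test_even \<Longrightarrow> grad (\<lambda>z. c * U z) z = c *\<^sub>R grad U z"
  unfolding grad_def by (simp add: partial_cmult test_evenD scaleR_sum_right)

lemma y_mean_add: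
  assumes "continuous_on UNIV f" "continuous_on UNIV g"
  shows "y_mean p (\<lambda>z. f z + g z) z = y_mean p f z + y_mean p g z"
  unfolding y_mean_def using assms by (simp add: distrib_left integral_add y_mean_integrable[unfolded cbox_interval])

lemma y_mean_cmult: "y_mean p (\<lambda>z. c * f z) z = c * y_mean p f z"
  unfolding y_mean_def by (simp add: mult.left_commute[of _ c])

lemma partial_partial_linear:
  assumes U: "U \<in> test_even" and V: "V \<in> test_even" and e: "e \<in> Basis"
  shows "partial e (partial e (\<lambda>z. U z + V z)) = (\<lambda>z. partial e (partial e U) z + partial e (partial e V) z)"
    and "partial e (partial e (\<lambda>z. c * U z)) = (\<lambda>z. c * partial e (partial e U) z)"
proof -
  have d: "partial e U differentiable (at z)" "partial e V differentiable (at z)" for z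
    using test_evenD(1)[OF U] test_evenD(1)[OF V] e smoothD(2,3) by blast+
  have "partial e (\<lambda>z. U z + V z) = (\<lambda>z. partial e U z + partial e V z)"
       "partial e (\<lambda>z. c * U z) = (\<lambda>z. c * partial e U z)"
    by (auto simp: partial_add partial_cmult test_evenD U V)
  then show "partial e (partial e (\<lambda>z. U z + V z)) = (\<lambda>z. partial e (partial e U) z + partial e (partial e V) z)"
    and "partial e (partial e (\<lambda>z. c * U z)) = (\<lambda>z. c * partial e (partial e U) z)"
    by (auto simp: partial_add partial_cmult d)
qed

text \<open>Linearity of the singular term is read off its form as an integral mean, which avoids
  manipulating the limit in its definition.\<close>

lemma Delta_b_add:
  assumes U: "U \<in> test_even" and V: "V \<in> test_even"
  shows "Delta_b b (\<lambda>z. U z + V z) = (\<lambda>z. Delta_b b U z + Delta_b b V z)"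
proof -
  have "continuous_on UNIV (partial e\<^sub>y (partial e\<^sub>y W))" if "W \<in> test_even" for W :: "'a point \<Rightarrow> real"
    using smooth_continuous test_evenD(1) test_even_partial_partial[OF that e_y_Basis] by blast
  then show ?thesis
    unfolding Delta_b_def laplace_def using U V
    by (auto simp: dy_over_y_eq_y_mean test_even_add partial_partial_linear(1) e_y_Basis y_mean_add
      sum.distrib distrib_left intro!: ext)
qed

lemma Delta_b_cmult:
  assumes U: "U \<in> test_even"
  shows "Delta_b b (\<lambda>z. c * U z) = (\<lambda>z. c * Delta_b b U z)"
  unfolding Delta_b_def laplace_def using U
  by (auto simp: dy_over_y_eq_y_mean test_even_cmult partial_partial_linear(2)[OF U U] e_y_Basis y_mean_cmult
      sum_distrib_left distrib_left mult.left_commute intro!: ext)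

text \<open>The recursion behind all inductions in steps of two. The factor is split off next to U,
  so that an induction hypothesis can be applied to the test function
  \<open>Delta_b b U\<close>.\<close>

lemma nabla_Suc_Suc: "nabla b (Suc (Suc j)) U = nabla b j (Delta_b b U)"
proof -
  have "odd j \<Longrightarrow> j div 2 = (j - 1) div 2 \<and> Suc j div 2 = Suc ((j - 1) div 2)" by presburger
  then show ?thesis by (intro ext) (auto simp: nabla_def funpow_Suc_right simp del: funpow.simps(2))
qed

lemma nabla_0: "nabla b 0 U z = (U z, 0)" and nabla_1: "nabla b (Suc 0) U z = (0, grad U z)"
  by (auto simp: nabla_def)

lemma nabla_add:
  assumes "U \<in> test_even" "V \<in> test_even"
  shows "nabla b j (\<lambda>z. U z + V z) z = nabla b j U z + nabla b j V z"
  using assms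
proof (induction j arbitrary: U V rule: induct_nat_012)
  case (ge2 n)
  then show ?case by (simp add: nabla_Suc_Suc Delta_b_add Delta_b_test_even)
qed (auto simp: nabla_0 nabla_1 grad_add)

lemma nabla_cmult:
  assumes "U \<in> test_even"
  shows "nabla b j (\<lambda>z. c * U z) z = c *\<^sub>R nabla b j U z"
  using assms
proof (induction j arbitrary: U rule: induct_nat_012)
  case (ge2 n)
  then show ?case by (simp add: nabla_Suc_Suc Delta_b_cmult Delta_b_test_even)
qed (auto simp: nabla_0 nabla_1 grad_cmult)

lemma nabla_continuous:
  assumes "U \<in> test_even" shows "continuous_on UNIV (nabla b j U)"
  using assms
proof (induction j arbitrary: U rule: induct_nat_012)
  case (ge2 n)
  then show ?case by (simp add: nabla_Suc_Suc Delta_b_test_even)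
qed (auto simp: nabla_0[abs_def] nabla_1[abs_def] intro!: continuous_intros continuous_on_grad test_evenD(2) smooth_continuous test_evenD(1))

lemma nabla_supp_in:
  assumes "U \<in> test_even" shows "\<exists>R. supp_in R (nabla b j U)"
  using assms
proof (induction j arbitrary: U rule: induct_nat_012)
  case 0
  then obtain R where "supp_in R U" using test_evenD(5) by blast
  then show ?case by (auto simp: supp_in_def nabla_0 zero_prod_def)
next
  case 1
  then obtain R where "supp_in R U" using test_evenD(5) by blast
  then show ?case using supp_in_grad[of R U] by (auto simp: supp_in_def nabla_1 zero_prod_def)
next
  case (ge2 n)
  then show ?case by (simp add: nabla_Suc_Suc Delta_b_test_even)
qed

section \<open>Weighted integrals\<close>

text \<open>Says that w dz is finite on bounded sets, which is what makes continuous functions of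
  compact support integrable against w.\<close>

definition loc_weight :: "('a::euclidean_space \<Rightarrow> real) \<Rightarrow> bool" where
  "loc_weight w \<longleftrightarrow> w \<in> borel_measurable borel \<and> (\<forall>z. 0 \<le> w z) \<and>
     (\<forall>r. integrable lborel (\<lambda>z. w z * indicator (cball 0 r) z))"

lemma supp_in_bound:
  fixes F :: "'a::euclidean_space \<Rightarrow> 'b::real_normed_vector"
  assumes "continuous_on UNIV F" "supp_in R F"
  obtains M where "0 \<le> M" "\<And>z. norm (F z) \<le> M"
proof -
  have "compact (F ` cball 0 R)"
    using assms(1) by (intro compact_continuous_image) (auto intro: continuous_on_subset)
  then obtain M where M: "\<And>z. z \<in> cball 0 R \<Longrightarrow> norm (F z) \<le> M"
    using compact_imp_bounded bounded_iff by (metis image_eqI)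
  have "norm (F z) \<le> \<bar>M\<bar>" for z
    using M[of z] assms(2) by (cases "norm z \<le> R") (auto simp: supp_in_def)
  then show ?thesis using that[of "\<bar>M\<bar>"] by simp
qed

lemma loc_weight_integrable:
  fixes F :: "'a::euclidean_space \<Rightarrow> real"
  assumes w: "loc_weight w" and F: "continuous_on UNIV F" "supp_in R F"
  shows "integrable lborel (\<lambda>z. w z * F z)"
proof -
  obtain M where M: "0 \<le> M" "\<And>z. norm (F z) \<le> M" using supp_in_bound[OF F] by blast
  have [measurable]: "w \<in> borel_measurable borel" "F \<in> borel_measurable borel"
    using w F borel_measurable_continuous_onI by (auto simp: loc_weight_def)
  have w0: "0 \<le> w z" for z using w by (simp add: loc_weight_def)
  show ?thesis
  proof (rule Bochner_Integration.integrable_bound)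
    show "integrable lborel (\<lambda>z. w z * indicator (cball 0 R) z * M)"
      using w by (simp add: loc_weight_def)
    show "AE z in lborel. norm (w z * F z) \<le> norm (w z * indicator (cball 0 R) z * M)"
      using F(2) M w0 by (intro AE_I2) (auto simp: supp_in_def indicator_def abs_mult mult_left_mono)
  qed measurable
qed

text \<open>One factor of the product that dominates the weight in \<open>loc_weight_weight\<close>.
  The nonnegative integral is used because the product formula for \<open>lborel\<close> is stated
  for it.\<close>

lemma nn_integral_abs_powr_finite:
  assumes "-1 < \<gamma>" "0 \<le> r"
  shows "(\<integral>\<^sup>+t. ennreal (\<bar>t\<bar> powr \<gamma> * indicator {-r..r} t) \<partial>lborel) < \<infinity>"
proof -
  define I where "I = r powr (\<gamma> + 1) / (\<gamma> + 1)"
  have "((\<lambda>t. t powr \<gamma>) has_integral I) {0..r}"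
    unfolding I_def using assms by (rule has_integral_powr_from_0)
  then have pos: "((\<lambda>t. \<bar>t\<bar> powr \<gamma>) has_integral I) {0..r}"
    by (rule has_integral_eq[rotated]) auto
  then have "((\<lambda>t. \<bar>t\<bar> powr \<gamma>) has_integral I) {-r..0}"
    using has_integral_reflect_real[of "\<lambda>t. \<bar>t\<bar> powr \<gamma>" I r 0] by simp
  then have "((\<lambda>t. \<bar>t\<bar> powr \<gamma>) has_integral (I + I)) {-r..r}"
    using pos assms(2) by (intro has_integral_combine[of "-r" 0 r]) auto
  then have "((\<lambda>t. if t \<in> {-r..r} then \<bar>t\<bar> powr \<gamma> else 0) has_integral (I + I)) UNIV"
    by (simp only: has_integral_restrict_UNIV)
  moreover have "(\<lambda>t. if t \<in> {-r..r} then \<bar>t\<bar> powr \<gamma> else 0) = (\<lambda>t. \<bar>t\<bar> powr \<gamma> * indicator {-r..r} t)"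
    by (auto simp: indicator_def)
  ultimately have "((\<lambda>t. \<bar>t\<bar> powr \<gamma> * indicator {-r..r} t) has_integral (I + I)) UNIV" by metis
  then have "(\<integral>\<^sup>+t. ennreal (\<bar>t\<bar> powr \<gamma> * indicator {-r..r} t) \<partial>lborel) = ennreal (I + I)"
    by (intro nn_integral_has_integral_lborel) (auto intro!: measurable)
  then show ?thesis by simp
qed

lemma AE_lborel_inner_neq_0:
  assumes "e \<in> (Basis :: 'a::euclidean_space set)"
  shows "AE z in (lborel :: 'a measure). z \<bullet> e \<noteq> 0"
proof (rule AE_I')
  have "negligible {z::'a. z \<bullet> e = 0}" using assms by (rule negligible_standard_hyperplane)
  moreover have "{z::'a. z \<bullet> e = 0} \<in> sets lborel" by measurable
  ultimately show "{z::'a. z \<bullet> e = 0} \<in> null_sets lborel"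
    by (simp add: negligible_iff_null_sets null_sets_completion_iff)
qed auto

lemma weight_nonneg: "0 \<le> weight b s z"
  by (simp add: weight_def)

lemma weight_measurable [measurable]: "(weight b s :: 'a::finite point \<Rightarrow> real) \<in> borel_measurable borel"
proof -
  have [measurable]: "(snd :: 'a point \<Rightarrow> real) \<in> borel_measurable borel"
    by (intro borel_measurable_continuous_onI continuous_intros)
  show ?thesis unfolding weight_def by measurable
qed

text \<open>By the convention \<open>0 powr b = 0\<close> the weight vanishes exactly on y = 0, even
  for b < 0, where it ought to blow up; that hyperplane is a null set. Positivity elsewhere turns a
  vanishing weighted norm into a function that vanishes almost everywhere.\<close>

lemma AE_weight_pos: "AE z in lborel. 0 < weight b s z"
  using AE_lborel_inner_neq_0[OF e_y_Basis]
  by eventually_elim (auto simp: weight_def inner_e_y zero_less_mult_iff)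

text \<open>At the origin \<open>norm z powr 0\<close> is 0 rather than 1; the identity survives
  because \<open>0 powr b\<close> is 0 too.\<close>

lemma weight_0: "weight b 0 z = \<bar>snd z\<bar> powr b"
  by (auto simp: weight_def)

lemma weight_eq: "weight b s z = weight b 0 z * norm z powr (-2 * s)"
  by (auto simp: weight_def)

lemma weight_scaleR: "0 < c \<Longrightarrow> weight b s (c *\<^sub>R z) = c powr (b - 2 * s) * weight b s z"
  by (simp add: weight_def powr_mult abs_mult powr_diff powr_minus field_simps)

lemma weight_y_scale: "0 < c \<Longrightarrow> weight b 0 (y_scale c z) = c powr b * weight b 0 z"
  by (simp add: weight_0 y_scale_def abs_mult powr_mult)

text \<open>Polar coordinates are avoided by distributing the power of |z| over the coordinates.
  Since |z| dominates each coordinate, |z|^(-2s') is at most the product of the |z_e|^(-\<alpha> e)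
  whenever the nonnegative \<alpha> e add up to 2s', and the product integrates by Fubini as soon as
  each one-dimensional exponent exceeds -1.\<close>

lemma loc_weight_weight:
  assumes b: "-1 < b" and s: "2 * s < real CARD('n) + 1 + b"
  shows "loc_weight (weight b s :: 'n::finite point \<Rightarrow> real)"
  unfolding loc_weight_def
proof (intro conjI allI weight_nonneg weight_measurable)
  fix r0 :: real
  define r where "r = max r0 1"
  define d where "d = real CARD('n) + 1 + b"
  have d: "0 < d" using b by (simp add: d_def)
  \<comment> \<open>Only a positive s is singular at the origin. For s < 0 the factor |z|^(-2s) is
    bounded on the ball, and this bound is put into C.\<close>
  define s' where "s' = max s 0"
  define C where "C = max 1 (r powr (-2 * s))"
  \<comment> \<open>The shares are proportional to 1 + \<beta>, where \<beta> is the power of the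
    coordinate already present in the weight (b for y, otherwise 0). They add up to 2s', and the
    remaining exponent is \<gamma> = (1 + \<beta>)(1 - 2s'/d) - 1 > -1 in every direction.\<close>
  define \<alpha> where "\<alpha> e = 2 * s' / d * (1 + (if e = (e\<^sub>y :: 'n point) then b else 0))" for e
  define \<gamma> where "\<gamma> e = (if e = (e\<^sub>y :: 'n point) then b else 0) - \<alpha> e" for e
  define f where "f e t = \<bar>t\<bar> powr \<gamma> e * indicator {-r..r} t" for e :: "'n point" and t
  have s': "0 \<le> s'" "2 * s' / d < 1" using s d by (auto simp: s'_def d_def)
  have "-1 < \<gamma> e" for e
  proof -
    have "(1 + b) * (2 * s' / d) < (1 + b) * 1" by (rule mult_strict_left_mono) (use s' b in auto)
    then show ?thesis using s' by (auto simp: \<gamma>_def \<alpha>_def mult.commute)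
  qed
  then have "(\<integral>\<^sup>+t. ennreal (f e t) \<partial>lborel) < \<infinity>" for e
    unfolding f_def by (rule nn_integral_abs_powr_finite) (simp add: r_def)
  then have "(\<Prod>e\<in>(Basis :: 'n point set). (\<integral>\<^sup>+t. f e t \<partial>lborel)) < \<infinity>"
    by (simp add: less_top[symmetric] ennreal_prod_eq_top)
  also have "(\<Prod>e\<in>(Basis :: 'n point set). (\<integral>\<^sup>+t. f e t \<partial>lborel)) =
      (\<integral>\<^sup>+z. ennreal (\<Prod>e\<in>Basis. f e (z \<bullet> e)) \<partial>(lborel :: 'n point measure))"
    by (subst nn_integral_lborel_prod[symmetric]) (auto simp: f_def prod_ennreal intro!: measurable)
  finally have fin: "(\<integral>\<^sup>+z. ennreal (\<Prod>e\<in>Basis. f e (z \<bullet> e)) \<partial>(lborel :: 'n point measure)) < \<infinity>" .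
  have [measurable]: "f e \<in> borel_measurable borel" for e unfolding f_def by measurable
  have int: "integrable lborel (\<lambda>z::'n point. C * (\<Prod>e\<in>Basis. f e (z \<bullet> e)))"
    by (intro integrable_mult_right integrableI_nonneg fin) (auto simp: f_def intro!: prod_nonneg)
  have sum\<alpha>: "(\<Sum>e\<in>(Basis :: 'n point set). \<alpha> e) = 2 * s'"
  proof -
    have "(\<Sum>e\<in>(Basis :: 'n point set). \<alpha> e) = 2 * s' / d * (\<Sum>e\<in>(Basis :: 'n point set). (1 + (if e = e\<^sub>y then b else 0)))"
      unfolding \<alpha>_def by (rule sum_distrib_left[symmetric])
    also have "\<dots> = 2 * s' / d * d" by (simp add: sum.distrib e_y_Basis d_def add_ac)
    finally show ?thesis using d by simp
  qed
  show "integrable lborel (\<lambda>z::'n point. weight b s z * indicator (cball 0 r0) z)"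
  proof (rule Bochner_Integration.integrable_bound[OF int])
    have "AE z::'n point in lborel. \<forall>e\<in>Basis. z \<bullet> e \<noteq> 0"
      by (intro AE_finite_allI AE_lborel_inner_neq_0) auto
    then show "AE z::'n point in lborel. norm (weight b s z * indicator (cball 0 r0) z) \<le> norm (C * (\<Prod>e\<in>Basis. f e (z \<bullet> e)))"
    proof eventually_elim
      case (elim z)
      have z0: "z \<noteq> 0" using elim e_y_Basis by fastforce
      have fnn: "0 \<le> (\<Prod>e\<in>Basis. f e (z \<bullet> e))" by (intro prod_nonneg) (auto simp: f_def)
      have C1: "1 \<le> C" by (simp add: C_def)
      show ?case
      proof (cases "norm z \<le> r0")
        case True
        have "norm z powr (-2 * s) \<le> C * norm z powr (-2 * s')"
        proof (cases "0 \<le> s")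
          case True then show ?thesis using C1 by (simp add: s'_def mult_right_mono[of 1 C, simplified])
        next
          case False
          then have "norm z powr (-2 * s) \<le> r powr (-2 * s)"
            using \<open>norm z \<le> r0\<close> by (intro powr_mono2) (auto simp: r_def)
          then show ?thesis using False z0 by (simp add: s'_def C_def)
        qed
        also have "norm z powr (-2 * s') = (\<Prod>e\<in>Basis. norm z powr (- \<alpha> e))"
          using sum\<alpha> z0 by (simp add: powr_sum[symmetric] sum_negf)
        also have "\<dots> \<le> (\<Prod>e\<in>Basis. \<bar>z \<bullet> e\<bar> powr (- \<alpha> e))"
        proof (intro prod_mono conjI powr_ge_zero)
          fix e :: "'n point" assume e: "e \<in> Basis"
          have "0 \<le> \<alpha> e" using s' d b by (auto simp: \<alpha>_def)
          then show "norm z powr (- \<alpha> e) \<le> \<bar>z \<bullet> e\<bar> powr (- \<alpha> e)"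
            using elim e Basis_le_norm[OF e, of z] by (intro powr_mono2') auto
        qed
        finally have "weight b s z \<le> \<bar>z \<bullet> e\<^sub>y\<bar> powr b * (C * (\<Prod>e\<in>Basis. \<bar>z \<bullet> e\<bar> powr (- \<alpha> e)))"
          using C1 by (simp add: weight_def inner_e_y mult_left_mono)
        also have "\<bar>z \<bullet> e\<^sub>y\<bar> powr b = (\<Prod>e\<in>Basis. \<bar>z \<bullet> e\<bar> powr (if e = e\<^sub>y then b else 0))"
        proof -
          have "(\<Prod>e\<in>Basis. \<bar>z \<bullet> e\<bar> powr (if e = e\<^sub>y then b else 0)) =
            (\<Prod>e\<in>Basis. if e = e\<^sub>y then \<bar>z \<bullet> e\<bar> powr b else 1)"
            using elim by (intro prod.cong) auto
          then show ?thesis by (simp add: prod.delta' e_y_Basis cong: if_cong)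
        qed
        also have "(\<Prod>e\<in>Basis. \<bar>z \<bullet> e\<bar> powr (if e = e\<^sub>y then b else 0)) * (C * (\<Prod>e\<in>Basis. \<bar>z \<bullet> e\<bar> powr (- \<alpha> e)))
           = C * (\<Prod>e\<in>Basis. f e (z \<bullet> e))"
        proof -
          have "f e (z \<bullet> e) = \<bar>z \<bullet> e\<bar> powr (if e = e\<^sub>y then b else 0) * \<bar>z \<bullet> e\<bar> powr (- \<alpha> e)" if "e \<in> Basis" for e
          proof -
            have "\<bar>z \<bullet> e\<bar> \<le> r" using True Basis_le_norm[OF that, of z] by (simp add: r_def)
            then show ?thesis by (simp add: f_def \<gamma>_def powr_diff powr_minus_divide indicator_def abs_le_iff)
          qed
          then show ?thesis by (simp add: prod.distrib)
        qed
        finally show ?thesis using C1 fnn weight_nonneg[of b s z] by (simp add: indicator_def)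
      next
        case False then show ?thesis by (simp add: indicator_def)
      qed
    qed
  qed (auto intro!: borel_measurable_times borel_measurable_indicator)
qed

section \<open>Changes of variables and integration by parts\<close>

lemma integral_affine:
  fixes f :: "'a::euclidean_space \<Rightarrow> real"
  assumes f: "f \<in> borel_measurable borel" and c: "\<And>j. j \<in> Basis \<Longrightarrow> c j \<noteq> 0"
  shows "(LINT z|lborel. f z) = (\<Prod>j\<in>Basis. \<bar>c j\<bar>) * (LINT z|lborel. f (\<Sum>j\<in>Basis. (c j * (z \<bullet> j)) *\<^sub>R j))"
proof -
  have "(LINT z|lborel. f z) = (LINT z|density (distr lborel borel (\<lambda>z. 0 + (\<Sum>j\<in>Basis. (c j * (z \<bullet> j)) *\<^sub>R j))) (\<lambda>_. \<Prod>j\<in>Basis. \<bar>c j\<bar>). f z)"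
    by (rule arg_cong[where f="\<lambda>M. integral\<^sup>L M f"], rule lborel_affine_euclidean[of c 0], rule c)
  also have "\<dots> = (LINT z|distr lborel borel (\<lambda>z. 0 + (\<Sum>j\<in>Basis. (c j * (z \<bullet> j)) *\<^sub>R j)). (\<Prod>j\<in>Basis. \<bar>c j\<bar>) *\<^sub>R f z)"
    using f by (intro integral_density) (auto intro!: AE_I2 prod_nonneg)
  also have "\<dots> = (LINT z|lborel. (\<Prod>j\<in>Basis. \<bar>c j\<bar>) *\<^sub>R f (0 + (\<Sum>j\<in>Basis. (c j * (z \<bullet> j)) *\<^sub>R j)))"
    using f by (intro integral_distr) auto
  finally show ?thesis by simp
qed

lemma integral_scaleR:
  fixes f :: "'n::finite point \<Rightarrow> real"
  assumes f: "f \<in> borel_measurable borel" and c: "0 < c"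
  shows "(LINT z|lborel. f z) = c ^ (CARD('n) + 1) * (LINT z|lborel. f (c *\<^sub>R z))"
proof -
  have "(\<Sum>j\<in>Basis. (c * (z \<bullet> j)) *\<^sub>R j) = c *\<^sub>R z" for z :: "'n point"
    unfolding scaleR_scaleR[symmetric] scaleR_sum_right[symmetric] euclidean_representation ..
  then show ?thesis using integral_affine[OF f, of "\<lambda>_. c"] c by simp
qed

lemma integral_y_scale:
  fixes f :: "'n::finite point \<Rightarrow> real"
  assumes f: "f \<in> borel_measurable borel" and c: "0 < c"
  shows "(LINT z|lborel. f z) = c * (LINT z|lborel. f (y_scale c z))"
proof -
  let ?c = "\<lambda>e::'n point. if e = e\<^sub>y then c else 1"
  have "(\<Sum>j\<in>Basis. (?c j * (z \<bullet> j)) *\<^sub>R j) = y_scale c z" for z :: "'n point"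
  proof (rule euclidean_eqI)
    fix e :: "'n point" assume "e \<in> Basis"
    then show "(\<Sum>j\<in>Basis. (?c j * (z \<bullet> j)) *\<^sub>R j) \<bullet> e = y_scale c z \<bullet> e"
      by (simp only: inner_sum_left_Basis) (auto elim!: Basis_point_cases simp: y_scale_def inner_prod_def)
  qed
  moreover have "(\<Prod>j\<in>Basis. \<bar>?c j\<bar>) = c"
  proof -
    have "(\<Prod>j\<in>Basis. \<bar>?c j\<bar>) = (\<Prod>j\<in>Basis. if j = (e\<^sub>y::'n point) then c else 1)"
      by (rule prod.cong) (use c in auto)
    then show ?thesis by (simp add: prod.delta' e_y_Basis)
  qed
  ultimately show ?thesis using integral_affine[OF f, of ?c] c by simp
qed

lemma supp_in_mono: "supp_in R f \<Longrightarrow> R \<le> R' \<Longrightarrow> supp_in R' f"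
  unfolding supp_in_def by fastforce

text \<open>Differentiation at \<open>t = 0\<close> of a transformation rule for \<open>\<integral> w(z) F(z + t \<xi>(z)) dz\<close>. All integrations
  by parts below come from this: the weights are invariant or homogeneous under translations in \<open>x\<close>,
  dilations in \<open>y\<close> and dilations in \<open>z\<close>.\<close>

lemma integral_flow:
  fixes F :: "'a::euclidean_space \<Rightarrow> real"
  assumes F: "C_diff (Suc 0) F" "supp_in R0 F" and w: "loc_weight w"
    and \<xi>: "continuous_on UNIV \<xi>" "\<And>z. norm (\<xi> z) \<le> 1 + norm z"
    and c: "(c has_real_derivative \<gamma>) (at 0)" "c 0 = 1"
    and eq: "\<And>t. 0 < t \<Longrightarrow> (LINT z|lborel. w z * F (z + t *\<^sub>R \<xi> z)) = c t * (LINT z|lborel. w z * F z)"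
  shows "(LINT z|lborel. w z * (\<xi> z \<bullet> grad F z)) = \<gamma> * (LINT z|lborel. w z * F z)"
proof -
  define R where "R = max R0 0"
  have R: "supp_in R F" "0 \<le> R" using F(2) by (auto simp: R_def intro: supp_in_mono)
  \<comment> \<open>Steps of size at most 1/3 displace z by at most (1 + |z|)/3, so a point with |z|
    > 2R + 1 stays outside the ball of radius R. A sequence is used because dominated convergence is
    stated for sequences.\<close>
  define h :: "nat \<Rightarrow> real" where "h m = 1 / (real m + 3)" for m
  have h: "0 < h m" "h m \<le> 1/3" for m by (auto simp: h_def field_simps)
  have h0: "filterlim h (at 0) sequentially"
  proof -
    have "h \<longlonglongrightarrow> 0" unfolding h_def
      using LIMSEQ_ignore_initial_segment[OF lim_1_over_n, of 3] by simp
    then show ?thesis using h by (auto simp: filterlim_at intro!: eventuallyI) (metis less_irrefl)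
  qed
  define s where "s m z = w z * ((F (z + h m *\<^sub>R \<xi> z) - F z) / h m)" for m z
  have cF: "continuous_on UNIV F" using F(1) by (rule C_diff_imp_continuous)
  have cG: "continuous_on UNIV (grad F)" using F(1) by (rule continuous_on_grad)
  obtain M where M: "0 \<le> M" "\<And>z. norm (grad F z) \<le> M"
    using supp_in_bound[OF cG supp_in_grad[OF R(1)]] by blast
  have w0: "0 \<le> w z" for z using w by (simp add: loc_weight_def)
  have [measurable]: "w \<in> borel_measurable borel" "F \<in> borel_measurable borel"
    "grad F \<in> borel_measurable borel" "\<xi> \<in> borel_measurable borel"
    using w cF cG \<xi> borel_measurable_continuous_onI by (auto simp: loc_weight_def)
  \<comment> \<open>The Lipschitz bound dominates all difference quotients at once: on |z| \<le> 2R
    + 1 the vector \<xi> z has length at most 2 + 2R, which gives the constant M (2 + 2R)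
    below.\<close>
  have lip: "\<bar>F x - F y\<bar> \<le> M * norm (x - y)" for x y
    unfolding real_norm_def[symmetric]
  proof (rule differentiable_bound[OF convex_UNIV])
    show "(F has_derivative (\<lambda>v. v \<bullet> grad F z)) (at z within UNIV)" for z
      using F(1) by (intro has_derivative_grad C_diff_differentiable)
    show "onorm (\<lambda>v. v \<bullet> grad F z) \<le> M" for z
    proof (rule onorm_bound[OF M(1)])
      have "\<bar>v \<bullet> grad F z\<bar> \<le> norm v * norm (grad F z)" for v by (rule Cauchy_Schwarz_ineq2)
      also have "norm v * norm (grad F z) \<le> norm v * M" for v by (intro mult_left_mono M) auto
      finally show "norm (v \<bullet> grad F z) \<le> M * norm v" for v by (simp add: mult.commute)
    qed
  qed auto
  have supp: "F (z + h m *\<^sub>R \<xi> z) = 0 \<and> F z = 0" if "2 * R + 1 < norm z" for z m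
  proof -
    have "norm z - norm (h m *\<^sub>R \<xi> z) \<le> norm (z + h m *\<^sub>R \<xi> z)"
      by (metis norm_diff_ineq)
    moreover have "norm (h m *\<^sub>R \<xi> z) \<le> 1/3 * (1 + norm z)"
      unfolding norm_scaleR using h[of m] \<xi>(2)[of z] by (intro mult_mono) auto
    moreover have "p - q \<le> x \<Longrightarrow> q \<le> 1/3 * (1 + p) \<Longrightarrow> 2 * R + 1 < p \<Longrightarrow> R < x" for p q x :: real
      using R(2) by argo
    ultimately have "R < norm (z + h m *\<^sub>R \<xi> z)" using that by blast
    then show ?thesis using R that by (auto simp: supp_in_def)
  qed
  have L: "(\<lambda>m. LINT z|lborel. s m z) \<longlonglongrightarrow> (LINT z|lborel. w z * (\<xi> z \<bullet> grad F z))"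
  proof (rule integral_dominated_convergence)
    show "integrable lborel (\<lambda>z. w z * indicator (cball 0 (2 * R + 1)) z * (M * (2 + 2 * R)))"
      using w by (simp add: loc_weight_def)
    show "AE z in lborel. (\<lambda>m. s m z) \<longlonglongrightarrow> w z * (\<xi> z \<bullet> grad F z)"
    proof (rule AE_I2)
      fix z
      have "((\<lambda>t. F (z + t *\<^sub>R \<xi> z)) has_derivative (\<lambda>t. (t *\<^sub>R \<xi> z) \<bullet> grad F (z + 0 *\<^sub>R \<xi> z))) (at 0)"
        by (intro has_derivative_compose[OF _ has_derivative_grad])
          (auto intro!: derivative_eq_intros C_diff_differentiable[OF F(1)])
      then have "((\<lambda>t. F (z + t *\<^sub>R \<xi> z)) has_real_derivative \<xi> z \<bullet> grad F z) (at 0)"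
        unfolding has_field_derivative_def by (rule has_derivative_eq_rhs) (auto simp: mult.commute)
      then have "((\<lambda>t. (F (z + t *\<^sub>R \<xi> z) - F z) / t) \<longlongrightarrow> \<xi> z \<bullet> grad F z) (at 0)"
        by (simp add: has_field_derivative_iff)
      from filterlim_compose[OF this h0]
      show "(\<lambda>m. s m z) \<longlonglongrightarrow> w z * (\<xi> z \<bullet> grad F z)"
        unfolding s_def by (intro tendsto_intros)
    qed
    show "AE z in lborel. norm (s m z) \<le> w z * indicator (cball 0 (2 * R + 1)) z * (M * (2 + 2 * R))" for m
    proof (rule AE_I2)
      fix z
      show "norm (s m z) \<le> w z * indicator (cball 0 (2 * R + 1)) z * (M * (2 + 2 * R))"
      proof (cases "norm z \<le> 2 * R + 1")
        case True
        have "\<bar>F (z + h m *\<^sub>R \<xi> z) - F z\<bar> \<le> M * (h m * norm (\<xi> z))"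
          using lip[of "z + h m *\<^sub>R \<xi> z" z] h[of m] by simp
        also have "\<dots> \<le> M * (h m * (2 + 2 * R))"
          using M h[of m] \<xi>(2)[of z] True by (intro mult_left_mono) auto
        finally have "\<bar>F (z + h m *\<^sub>R \<xi> z) - F z\<bar> / h m \<le> M * (2 + 2 * R)"
          using h[of m] by (simp add: field_simps)
        then have "w z * (\<bar>F (z + h m *\<^sub>R \<xi> z) - F z\<bar> / h m) \<le> w z * (M * (2 + 2 * R))"
          using w0 by (rule mult_left_mono)
        then show ?thesis
          using True w0[of z] h[of m] by (simp add: s_def abs_mult)
      next
        case False
        then show ?thesis using supp[of z m] by (simp add: s_def)
      qed
    qed
  qed (auto simp: s_def)
  \<comment> \<open>The transformation rule turns the integrated difference quotient into the
    difference quotient of c at 0, whose limit is \<gamma>.\<close>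
  have E: "(LINT z|lborel. s m z) = (c (h m) - c 0) / h m * (LINT z|lborel. w z * F z)" for m
  proof -
    have i1: "integrable lborel (\<lambda>z. w z * F z)" using w cF R(1) by (rule loc_weight_integrable)
    have i2: "integrable lborel (\<lambda>z. w z * F (z + h m *\<^sub>R \<xi> z))"
    proof (rule loc_weight_integrable[OF w])
      show "supp_in (2 * R + 1) (\<lambda>z. F (z + h m *\<^sub>R \<xi> z))" using supp by (auto simp: supp_in_def)
      show "continuous_on UNIV (\<lambda>z. F (z + h m *\<^sub>R \<xi> z))"
        by (intro continuous_on_compose2[OF cF] continuous_intros \<xi>) auto
    qed
    have "(LINT z|lborel. s m z) = (LINT z|lborel. (w z * F (z + h m *\<^sub>R \<xi> z) - w z * F z) / h m)"
      by (simp add: s_def right_diff_distrib)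
    also have "\<dots> = (c (h m) * (LINT z|lborel. w z * F z) - (LINT z|lborel. w z * F z)) / h m"
      using i1 i2 eq[OF h(1)[of m]] by (simp add: Bochner_Integration.integral_diff)
    finally show ?thesis using c(2) h(1)[of m] by (simp add: field_simps)
  qed
  have "(\<lambda>m. (c (h m) - c 0) / h m * (LINT z|lborel. w z * F z)) \<longlonglongrightarrow> \<gamma> * (LINT z|lborel. w z * F z)"
  proof -
    have "((\<lambda>t. (c t - c 0) / t) \<longlongrightarrow> \<gamma>) (at 0)" using c(1) by (simp add: has_field_derivative_iff)
    from filterlim_compose[OF this h0] show ?thesis by (intro tendsto_intros)
  qed
  then show ?thesis using LIMSEQ_unique[OF L] by (simp add: E)
qed

context
  fixes F :: "'n::finite point \<Rightarrow> real" and b R :: real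
  assumes F: "C_diff (Suc 0) F" "supp_in R F" and b: "-1 < b"
begin

lemma C1_borel_measurable [measurable]: "F \<in> borel_measurable borel"
  using F C_diff_imp_continuous borel_measurable_continuous_onI by blast

lemma integral_partial_x:
  assumes e: "e \<in> Basis" "e \<noteq> e\<^sub>y"
  shows "(LINT z|lborel. weight b 0 z * partial e F z) = 0"
proof -
  have "snd e = 0" using e by (auto elim!: Basis_point_cases)
  then have wt: "weight b 0 (z + t *\<^sub>R e) = weight b 0 z" for z t by (simp add: weight_0)
  have "(LINT z|lborel. weight b 0 z * (e \<bullet> grad F z)) = 0 * (LINT z|lborel. weight b 0 z * F z)"
  proof (rule integral_flow[where c="\<lambda>_. 1" and \<xi>="\<lambda>_. e", OF F])
    show "loc_weight (weight b 0 :: 'n point \<Rightarrow> real)" using b by (intro loc_weight_weight) auto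
    show "(LINT z|lborel. weight b 0 z * F (z + t *\<^sub>R e)) = 1 * (LINT z|lborel. weight b 0 z * F z)" for t
    proof -
      have "(LINT z|lborel. weight b 0 z * F z) = (LINT z|distr lborel borel ((+) (t *\<^sub>R e)). weight b 0 z * F z)"
        by (simp only: lborel_distr_plus)
      also have "\<dots> = (LINT z|lborel. weight b 0 (t *\<^sub>R e + z) * F (t *\<^sub>R e + z))"
        by (intro integral_distr) auto
      finally show ?thesis by (simp add: wt add.commute[of "t *\<^sub>R e"])
    qed
  qed (use e in auto)
  moreover have "e \<bullet> grad F z = partial e F z" for z by (metis inner_commute grad_inner_Basis e(1))
  ultimately show ?thesis by simp
qed

text \<open>The field (0, y) generates the dilations in y. The dilation by 1 + t has Jacobian 1 + t
  and multiplies |y|^b by (1 + t)^b, whence the factor (1 + t)^(-(1 + b)) and its derivative -(1 +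
  b) at t = 0.\<close>

lemma integral_partial_y:
  shows "(LINT z|lborel. weight b 0 z * (snd z * partial e\<^sub>y F z)) = - (1 + b) * (LINT z|lborel. weight b 0 z * F z)"
proof -
  have "(LINT z|lborel. weight b 0 z * ((0, snd z) \<bullet> grad F z)) = - (1 + b) * (LINT z|lborel. weight b 0 z * F z)"
  proof (rule integral_flow[where c="\<lambda>t. (1 + t) powr (- (1 + b))", OF F])
    show "loc_weight (weight b 0 :: 'n point \<Rightarrow> real)" using b by (intro loc_weight_weight) auto
    show "((\<lambda>t. (1 + t) powr (- (1 + b))) has_real_derivative - (1 + b)) (at 0)"
      by (auto intro!: derivative_eq_intros)
    show "norm (0::real^'n, snd z) \<le> 1 + norm z" for z :: "'n point"
      using norm_snd_le[of "snd z" "fst z"] by simp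
    show "(LINT z|lborel. weight b 0 z * F (z + t *\<^sub>R (0, snd z))) = (1 + t) powr (- (1 + b)) * (LINT z|lborel. weight b 0 z * F z)"
      if "0 < t" for t
    proof -
      have *: "z + t *\<^sub>R (0, snd z) = y_scale (1 + t) z" for z :: "'n point"
        by (simp add: y_scale_def prod_eq_iff algebra_simps)
      have "(LINT z|lborel. weight b 0 z * F z) = (1 + t) * (LINT z|lborel. weight b 0 (y_scale (1 + t) z) * F (y_scale (1 + t) z))"
        using that by (intro integral_y_scale) auto
      also have "\<dots> = (1 + t) powr (1 + b) * (LINT z|lborel. weight b 0 z * F (y_scale (1 + t) z))"
        using that by (simp add: weight_y_scale powr_add mult.assoc)
      finally show ?thesis using that unfolding * by (subst powr_minus) simp
    qed
  qed (auto intro!: continuous_intros)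
  moreover have "(0, snd z) \<bullet> grad F z = snd z * partial e\<^sub>y F z" for z
    using grad_inner_Basis[OF e_y_Basis, of F z] by (simp add: inner_prod_def)
  ultimately show ?thesis by simp
qed

text \<open>Under z -> (1 + t) z the Jacobian (1 + t)^(n + 1) and the factor (1 + t)^(b - 2s) of the
  weight combine to the exponent d - 2s. Exact homogeneity takes care of the origin, with no
  regularised weight.\<close>

lemma integral_euler:
  assumes s: "2 * s < real CARD('n) + 1 + b"
  shows "(LINT z|lborel. weight b s z * (z \<bullet> grad F z)) = - (real CARD('n) + 1 + b - 2 * s) * (LINT z|lborel. weight b s z * F z)"
proof (rule integral_flow[where c="\<lambda>t. (1 + t) powr (- (real CARD('n) + 1 + b - 2 * s))", OF F])
  let ?p = "real CARD('n) + 1 + b - 2 * s"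
  show "loc_weight (weight b s :: 'n point \<Rightarrow> real)" using b s by (rule loc_weight_weight)
  show "((\<lambda>t. (1 + t) powr (- ?p)) has_real_derivative - ?p) (at 0)"
    by (auto intro!: derivative_eq_intros)
  show "(LINT z|lborel. weight b s z * F (z + t *\<^sub>R z)) = (1 + t) powr (- ?p) * (LINT z|lborel. weight b s z * F z)"
    if "0 < t" for t
  proof -
    have *: "z + t *\<^sub>R z = (1 + t) *\<^sub>R z" for z :: "'n point"
      by (simp add: algebra_simps)
    have "(LINT z|lborel. weight b s z * F z) = (1 + t) ^ (CARD('n) + 1) * (LINT z|lborel. weight b s ((1 + t) *\<^sub>R z) * F ((1 + t) *\<^sub>R z))"
      using that by (intro integral_scaleR) auto
    also have "\<dots> = (1 + t) ^ (CARD('n) + 1) * (1 + t) powr (b - 2 * s) * (LINT z|lborel. weight b s z * F ((1 + t) *\<^sub>R z))"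
      using that by (simp add: weight_scaleR mult.assoc)
    also have "(1 + t) ^ (CARD('n) + 1) * (1 + t) powr (b - 2 * s) = (1 + t) powr ?p"
    proof -
      have "(1 + t) ^ (CARD('n) + 1) = (1 + t) powr (real (CARD('n) + 1))"
        using that by (intro powr_realpow[symmetric]) auto
      then show ?thesis by (simp only: powr_add[symmetric]) (simp add: algebra_simps)
    qed
    finally show ?thesis using that unfolding * by (subst powr_minus) simp
  qed
qed auto

end

text \<open>The divergence theorem for |y|^b \<rho> U grad V, one coordinate at a time. In the
  directions in x it is translation invariance. In the direction y the component is |y|^b y F with F
  = \<rho> U g and dV/dy = y g; its derivative is |y|^b (y dF/dy + (1 + b) F), which has integral
  0.\<close>

lemma integral_div_weighted:
  fixes U V :: "'n::finite point \<Rightarrow> real"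
  assumes U: "U \<in> test_even" and V: "V \<in> test_even" and \<rho>: "C_diff (Suc 0) \<rho>" and b: "-1 < b"
  shows "(LINT z|lborel. weight b 0 z * (\<rho> z * (U z * Delta_b b V z + grad U z \<bullet> grad V z) + U z * (grad \<rho> z \<bullet> grad V z))) = 0"
proof -
  let ?g = "dy_over_y V"
  \<comment> \<open>\<open>T e\<close> is the contribution of the direction e to the divergence,
    divided by |y|^b. The singular part of \<open>Delta_b\<close> goes entirely to
    \<open>e\<^sub>y\<close>.\<close>
  define T where "T e z = \<rho> z * U z * partial e (partial e V) z + (\<rho> z * partial e U z + U z * partial e \<rho> z) * partial e V z
      + (if e = (e\<^sub>y::'n point) then b * \<rho> z * U z * ?g z else 0)" for e z
  have sU: "smooth U" and sV: "smooth V" and g: "?g \<in> test_even"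
    using test_evenD(1) U V dy_over_y_test_even by blast+
  obtain R where R: "supp_in R U" using test_evenD(5)[OF U] by blast
  have lw: "loc_weight (weight b 0 :: 'n point \<Rightarrow> real)" using b by (intro loc_weight_weight) auto
  have d\<rho>: "\<rho> differentiable (at z)" for z using \<rho> by (rule C_diff_differentiable)
  have suppR: "supp_in R (\<lambda>z. \<rho> z * (U z * f z))" for f using R by (auto simp: supp_in_def)
  have c1: "C_diff (Suc 0) (\<lambda>z. \<rho> z * (U z * f z))" if "smooth f" for f
    using \<rho> that smoothD(1)[OF sU] smoothD(1)[OF that] by (intro C_diff_mult)
  have int: "integrable lborel (\<lambda>z. weight b 0 z * T e z)" if "e \<in> Basis" for e
  proof (rule loc_weight_integrable[OF lw])
    have "continuous_on UNIV \<rho>" "continuous_on UNIV (partial e \<rho>)" "continuous_on UNIV U" "continuous_on UNIV (partial e U)"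
      "continuous_on UNIV (partial e V)" "continuous_on UNIV (partial e (partial e V))" "continuous_on UNIV ?g"
      using C_diff_imp_continuous[OF \<rho>] \<rho> that sU sV test_evenD(1)[OF g]
      by (auto intro!: smooth_continuous smoothD(3))
    then show "continuous_on UNIV (T e)" unfolding T_def by (cases "e = e\<^sub>y") (auto intro!: continuous_intros)
    show "supp_in R (T e)" using R supp_in_partial[OF R, of e] by (auto simp: supp_in_def T_def)
  qed
  have zero: "(LINT z|lborel. weight b 0 z * T e z) = 0" if e: "e \<in> Basis" for e
  proof (cases "e = e\<^sub>y")
    case False
    have dV: "partial e V differentiable (at z)" for z using sV e smoothD by blast
    have "partial e (\<lambda>z. \<rho> z * (U z * partial e V z)) z = T e z" for z
      using False d\<rho> dV test_evenD(3)[OF U] by (simp add: partial_mult T_def differentiable_mult algebra_simps)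
    then show ?thesis
      using integral_partial_x[OF c1 suppR b e False, of "partial e V"] smoothD(3)[OF sV e] by simp
  next
    case True
    let ?F = "\<lambda>z. \<rho> z * (U z * ?g z)"
    have yg: "partial e\<^sub>y V = (\<lambda>z. snd z * ?g z)" using snd_mult_dy_over_y[OF V] by auto
    have dsnd: "(snd has_derivative (\<lambda>v. snd v)) (at z)" for z :: "'n point"
      by (auto intro!: derivative_eq_intros)
    have "partial e\<^sub>y snd z = 1" for z :: "'n point" using partial_eqI[OF dsnd, of e\<^sub>y z] by simp
    then have yyV: "partial e\<^sub>y (partial e\<^sub>y V) z = snd z * partial e\<^sub>y ?g z + ?g z" for z
      unfolding yg using differentiableI[OF dsnd] test_evenD(3)[OF g] by (simp add: partial_mult)
    have pF: "partial e\<^sub>y ?F z = \<rho> z * (U z * partial e\<^sub>y ?g z + partial e\<^sub>y U z * ?g z) + partial e\<^sub>y \<rho> z * (U z * ?g z)" for z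
      using d\<rho> test_evenD(3)[OF U] test_evenD(3)[OF g] by (simp add: partial_mult differentiable_mult)
    have T: "T e z = snd z * partial e\<^sub>y ?F z + (1 + b) * ?F z" for z
      unfolding T_def True yyV pF unfolding yg by (simp add: algebra_simps)
    have cF: "C_diff (Suc 0) ?F" using c1 test_evenD(1)[OF g] by blast
    have iF: "integrable lborel (\<lambda>z. weight b 0 z * ?F z)"
      by (rule loc_weight_integrable[OF lw C_diff_imp_continuous[OF cF] suppR])
    \<comment> \<open>Integrability of the term with y dF/dy is inherited from those of
      \<open>T e\<close> and F, of which it is a combination.\<close>
    have "integrable lborel (\<lambda>z. weight b 0 z * T e z - (1 + b) * (weight b 0 z * ?F z))"
      by (intro Bochner_Integration.integrable_diff integrable_mult_right int e iF)
    then have "integrable lborel (\<lambda>z. weight b 0 z * (snd z * partial e\<^sub>y ?F z))"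
      unfolding T by (simp add: algebra_simps)
    with iF have "(LINT z|lborel. weight b 0 z * T e z) =
        (LINT z|lborel. weight b 0 z * (snd z * partial e\<^sub>y ?F z)) + (1 + b) * (LINT z|lborel. weight b 0 z * ?F z)"
      by (simp add: T distrib_left mult.left_commute[of _ "1 + b"] Bochner_Integration.integral_add)
    then show ?thesis using integral_partial_y[OF cF suppR b] by (simp add: algebra_simps)
  qed
  have sumT: "(\<Sum>e\<in>Basis. T e z) = \<rho> z * (U z * Delta_b b V z + grad U z \<bullet> grad V z) + U z * (grad \<rho> z \<bullet> grad V z)" for z
  proof -
    have ip: "grad f z \<bullet> grad h z = (\<Sum>e\<in>Basis. partial e f z * partial e h z)" for f h :: "'n point \<Rightarrow> real"
      unfolding euclidean_inner[of "grad f z" "grad h z"] by (rule sum.cong) (auto simp: grad_inner_Basis)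
    show ?thesis
      unfolding T_def ip Delta_b_def laplace_def
      by (simp add: sum.distrib e_y_Basis sum_distrib_left distrib_left distrib_right mult_ac add_ac)
  qed
  have "(LINT z|lborel. weight b 0 z * (\<rho> z * (U z * Delta_b b V z + grad U z \<bullet> grad V z) + U z * (grad \<rho> z \<bullet> grad V z)))
      = (LINT z|lborel. (\<Sum>e\<in>Basis. weight b 0 z * T e z))"
    by (simp only: sum_distrib_left[symmetric] sumT)
  also have "\<dots> = 0" using int zero by simp
  finally show ?thesis .
qed

text \<open>The majorant has two parts because s may have either sign: for s \<ge> 0 the regularised
  power lies below the limit |z|^(-2s), for s < 0 it is bounded on the support.\<close>

lemma regularized_weight_tendsto:
  fixes H :: "'n::finite point \<Rightarrow> real"
  assumes H: "continuous_on UNIV H" "supp_in R H" and b: "-1 < b" and s: "2 * s < real CARD('n) + 1 + b"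
  shows "(\<lambda>m. LINT z|lborel. weight b 0 z * ((z \<bullet> z + 1 / (real m + 1)) powr (- s) * H z))
    \<longlonglongrightarrow> (LINT z|lborel. weight b s z * H z)"
proof -
  have lw: "loc_weight (weight b 0 :: 'n point \<Rightarrow> real)" "loc_weight (weight b s :: 'n point \<Rightarrow> real)"
    using b s by (auto intro: loc_weight_weight)
  have cabs: "continuous_on UNIV (\<lambda>z. \<bar>H z\<bar>)" "supp_in R (\<lambda>z. \<bar>H z\<bar>)"
    using H by (auto intro: continuous_intros simp: supp_in_def)
  note [measurable] = borel_measurable_continuous_onI[OF H(1)]
  \<comment> \<open>For s < 0 this bounds the regularised power, since |z| \<le> R and the parameter
    1 / (m + 1) is at most 1.\<close>
  define C where "C = (R\<^sup>2 + 1) powr \<bar>s\<bar>"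
  show ?thesis
  proof (rule integral_dominated_convergence[where w="\<lambda>z. weight b s z * \<bar>H z\<bar> + C * (weight b 0 z * \<bar>H z\<bar>)"])
    show "integrable lborel (\<lambda>z::'n point. weight b s z * \<bar>H z\<bar> + C * (weight b 0 z * \<bar>H z\<bar>))"
      by (intro Bochner_Integration.integrable_add integrable_mult_right loc_weight_integrable[OF _ cabs] lw)
    show "AE z in lborel. (\<lambda>m. weight b 0 z * ((z \<bullet> z + 1 / (real m + 1)) powr (- s) * H z)) \<longlonglongrightarrow> weight b s z * H z"
    proof (rule AE_I2)
      fix z :: "'n point"
      show "(\<lambda>m. weight b 0 z * ((z \<bullet> z + 1 / (real m + 1)) powr (- s) * H z)) \<longlonglongrightarrow> weight b s z * H z"
      \<comment> \<open>At the origin both sides are 0, again by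
        \<open>0 powr b = 0\<close>.\<close>
      proof (cases "z = 0")
        case False
        have "(\<lambda>m. 1 / (real m + 1)) \<longlonglongrightarrow> 0"
          using LIMSEQ_ignore_initial_segment[OF lim_1_over_n[where 'a=real], of 1] by (simp add: add.commute)
        then have "(\<lambda>m. weight b 0 z * ((z \<bullet> z + 1 / (real m + 1)) powr (- s) * H z)) \<longlonglongrightarrow> weight b 0 z * ((z \<bullet> z + 0) powr (- s) * H z)"
          using False by (intro tendsto_intros) auto
        moreover have "(z \<bullet> z) powr (- s) = norm z powr (-2 * s)"
          unfolding power2_norm_eq_inner[symmetric] using False
          using powr_powr[of "norm z" 2 "- s"] by (simp add: powr_numeral)
        ultimately show ?thesis by (simp add: weight_eq[of b s] mult.assoc)
      qed (simp add: weight_def)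
    qed
    show "AE z in lborel. norm (weight b 0 z * ((z \<bullet> z + 1 / (real m + 1)) powr (- s) * H z))
        \<le> weight b s z * \<bar>H z\<bar> + C * (weight b 0 z * \<bar>H z\<bar>)" for m
    proof (rule AE_I2)
      fix z :: "'n point"
      define \<epsilon> where "\<epsilon> = 1 / (real m + 1)"
      have \<epsilon>: "0 < \<epsilon>" "\<epsilon> \<le> 1" by (auto simp: \<epsilon>_def)
      show "norm (weight b 0 z * ((z \<bullet> z + 1 / (real m + 1)) powr (- s) * H z))
        \<le> weight b s z * \<bar>H z\<bar> + C * (weight b 0 z * \<bar>H z\<bar>)"
      proof (cases "z = 0 \<or> R < norm z")
        case True
        then show ?thesis using H(2) by (auto simp: weight_def supp_in_def)
      next
        case False
        then have z: "z \<noteq> 0" "norm z \<le> R" by auto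
        have "(z \<bullet> z + \<epsilon>) powr (- s) \<le> norm z powr (-2 * s) + C"
        proof (cases "0 \<le> s")
          case True
          have "(z \<bullet> z + \<epsilon>) powr (- s) \<le> (z \<bullet> z) powr (- s)"
            using True \<epsilon> z by (intro powr_mono2') auto
          also have "\<dots> = norm z powr (-2 * s)"
            unfolding power2_norm_eq_inner[symmetric] using z
            using powr_powr[of "norm z" 2 "- s"] by (simp add: powr_numeral)
          finally show ?thesis by (simp add: C_def add_increasing2)
        next
          case False
          have "z \<bullet> z \<le> R\<^sup>2" using z by (simp add: power2_norm_eq_inner[symmetric] power_mono)
          then have "(z \<bullet> z + \<epsilon>) powr (- s) \<le> (R\<^sup>2 + 1) powr (- s)"
            using False \<epsilon> by (intro powr_mono2) auto
          then show ?thesis using False by (simp add: C_def add_increasing)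
        qed
        then have "weight b 0 z * \<bar>H z\<bar> * (z \<bullet> z + \<epsilon>) powr (- s) \<le> weight b 0 z * \<bar>H z\<bar> * (norm z powr (-2 * s) + C)"
          by (intro mult_left_mono mult_nonneg_nonneg weight_nonneg) auto
        then show ?thesis
          unfolding \<epsilon>_def weight_eq[of b s]
          by (simp add: abs_mult weight_nonneg algebra_simps)
      qed
    qed
  qed measurable
qed

text \<open>The right-hand side comes from the gradient of |z|^(-2s), which is -2s |z|^(-2s-2) z.
  The identity is exact for the smooth weight (|z|^2 + \<epsilon>)^(-s), and the bound on s makes
  the heavier limit weight, of exponent s + 1, locally integrable.\<close>

lemma integral_by_parts:
  fixes U V :: "'n::finite point \<Rightarrow> real"
  assumes U: "U \<in> test_even" and V: "V \<in> test_even" and b: "-1 < b"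
    and s: "2 * s + 2 < real CARD('n) + 1 + b"
  shows "(LINT z|lborel. weight b s z * (U z * Delta_b b V z + grad U z \<bullet> grad V z)) =
    2 * s * (LINT z|lborel. weight b (s + 1) z * (U z * (z \<bullet> grad V z)))"
proof -
  let ?H = "\<lambda>z. U z * Delta_b b V z + grad U z \<bullet> grad V z" and ?K = "\<lambda>z. U z * (z \<bullet> grad V z)"
  obtain R where R: "supp_in R U" using test_evenD(5)[OF U] by blast
  have c: "continuous_on UNIV U" "continuous_on UNIV (Delta_b b V)" "continuous_on UNIV (grad U)" "continuous_on UNIV (grad V)"
    using U V Delta_b_test_even[OF V] by (auto intro!: smooth_continuous continuous_on_grad test_evenD(1,2))
  have cH: "continuous_on UNIV ?H" and cK: "continuous_on UNIV ?K" by (intro continuous_intros c)+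
  have sH: "supp_in R ?H" and sK: "supp_in R ?K" using R supp_in_grad[OF R] by (auto simp: supp_in_def)
  define \<rho> where "\<rho> \<epsilon> z = (z \<bullet> z + \<epsilon>) powr (- s)" for \<epsilon> and z :: "'n point"
  define \<rho>1 where "\<rho>1 \<epsilon> z = (z \<bullet> z + \<epsilon>) powr (- (s + 1))" for \<epsilon> and z :: "'n point"
  have lw: "loc_weight (weight b 0 :: 'n point \<Rightarrow> real)" using b by (intro loc_weight_weight) auto
  have key: "(LINT z|lborel. weight b 0 z * (\<rho> \<epsilon> z * ?H z)) = 2 * s * (LINT z|lborel. weight b 0 z * (\<rho>1 \<epsilon> z * ?K z))"
    if \<epsilon>: "0 < \<epsilon>" for \<epsilon>
  proof -
    have pos: "0 < z \<bullet> z + \<epsilon>" for z :: "'n point" using \<epsilon> by (simp add: add_nonneg_pos)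
    then have ne: "z \<bullet> z + \<epsilon> \<noteq> 0" for z :: "'n point" by (metis less_irrefl)
    have D: "(\<rho> \<epsilon> has_derivative (\<lambda>v. - 2 * s * \<rho>1 \<epsilon> z * (z \<bullet> v))) (at z)" for z
    proof -
      have eq: "(z \<bullet> z + \<epsilon>) powr (- s) / (z \<bullet> z + \<epsilon>) = \<rho>1 \<epsilon> z"
        using pos[of z] powr_diff[of "z \<bullet> z + \<epsilon>" "- s" 1] by (simp add: \<rho>1_def)
      have "(\<rho> \<epsilon> has_derivative (\<lambda>v. (z \<bullet> z + \<epsilon>) powr (- s) * ((- s) * (z \<bullet> v + v \<bullet> z) / (z \<bullet> z + \<epsilon>)))) (at z)"
        unfolding \<rho>_def[abs_def] by (auto intro!: derivative_eq_intros simp: pos)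
      moreover have "(z \<bullet> z + \<epsilon>) powr (- s) * ((- s) * (z \<bullet> v + v \<bullet> z) / (z \<bullet> z + \<epsilon>)) = - 2 * s * \<rho>1 \<epsilon> z * (z \<bullet> v)" for v
        unfolding eq[symmetric] by (simp add: inner_commute field_simps)
      ultimately show ?thesis by (simp only:)
    qed
    have part: "partial v (\<rho> \<epsilon>) = (\<lambda>z. - 2 * s * \<rho>1 \<epsilon> z * (z \<bullet> v))" for v
      using partial_eqI[OF D] by blast
    have c\<rho>: "continuous_on UNIV (\<rho> \<epsilon>)" "continuous_on UNIV (\<rho>1 \<epsilon>)"
      unfolding \<rho>_def[abs_def] \<rho>1_def[abs_def] by (intro continuous_intros; use ne in blast)+
    have "\<rho> \<epsilon> differentiable at z" for z using D differentiable_def by blast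
    moreover have "continuous_on UNIV (partial v (\<rho> \<epsilon>))" for v
      unfolding part by (intro continuous_intros c\<rho>)
    ultimately have C1: "C_diff (Suc 0) (\<rho> \<epsilon>)" by simp
    have gr: "grad (\<rho> \<epsilon>) z = (- 2 * s * \<rho>1 \<epsilon> z) *\<^sub>R z" for z
    proof -
      have "(\<Sum>e\<in>Basis. (c * (z \<bullet> e)) *\<^sub>R e) = c *\<^sub>R z" for c
        by (simp only: scaleR_scaleR[symmetric] scaleR_sum_right[symmetric] euclidean_representation)
      then show ?thesis unfolding grad_def part .
    qed
    have i1: "integrable lborel (\<lambda>z. weight b 0 z * (\<rho> \<epsilon> z * ?H z))"
      using sH by (intro loc_weight_integrable[OF lw continuous_on_mult[OF c\<rho>(1) cH], where R=R]) (auto simp: supp_in_def)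
    have i2: "integrable lborel (\<lambda>z. weight b 0 z * (\<rho>1 \<epsilon> z * ?K z))"
      using sK by (intro loc_weight_integrable[OF lw continuous_on_mult[OF c\<rho>(2) cK], where R=R]) (auto simp: supp_in_def)
    have "0 = (LINT z|lborel. weight b 0 z * (\<rho> \<epsilon> z * ?H z + U z * (grad (\<rho> \<epsilon>) z \<bullet> grad V z)))"
      using integral_div_weighted[OF U V C1 b] by simp
    also have "\<dots> = (LINT z|lborel. weight b 0 z * (\<rho> \<epsilon> z * ?H z) - 2 * s * (weight b 0 z * (\<rho>1 \<epsilon> z * ?K z)))"
      by (intro Bochner_Integration.integral_cong) (simp_all add: gr algebra_simps)
    also have "\<dots> = (LINT z|lborel. weight b 0 z * (\<rho> \<epsilon> z * ?H z)) - 2 * s * (LINT z|lborel. weight b 0 z * (\<rho>1 \<epsilon> z * ?K z))"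
      using i1 i2 by (simp only: Bochner_Integration.integral_diff integrable_mult_right integral_mult_right_zero)
    finally show ?thesis by simp
  qed
  have "(\<lambda>m. LINT z|lborel. weight b 0 z * (\<rho> (1 / (real m + 1)) z * ?H z)) \<longlonglongrightarrow> (LINT z|lborel. weight b s z * ?H z)"
    unfolding \<rho>_def using s by (intro regularized_weight_tendsto[OF cH sH b]) auto
  moreover have "(\<lambda>m. 2 * s * (LINT z|lborel. weight b 0 z * (\<rho>1 (1 / (real m + 1)) z * ?K z))) \<longlonglongrightarrow>
      2 * s * (LINT z|lborel. weight b (s + 1) z * ?K z)"
    unfolding \<rho>1_def using s by (intro tendsto_intros regularized_weight_tendsto[OF cK sK b]) auto
  ultimately show ?thesis using key LIMSEQ_unique by simp
qed

section \<open>The weighted spaces of square integrable functions\<close>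

text \<open>The best choice is t = x / A. For A = 0 a large t, here (B + 1) / x, contradicts x >
  0.\<close>

lemma square_le_of_weighted_AM_GM:
  fixes x A B :: real
  assumes "0 \<le> x" "0 \<le> A" "0 \<le> B" and le: "\<And>t. 0 < t \<Longrightarrow> 2 * x \<le> t * A + B / t"
  shows "x\<^sup>2 \<le> A * B"
proof (cases "x = 0")
  case True then show ?thesis using assms by simp
next
  case False
  then have x: "0 < x" using assms(1) by simp
  have "A \<noteq> 0"
  proof
    assume "A = 0"
    then have "2 * x \<le> B / ((B + 1) / x)" using le[of "(B + 1) / x"] x assms(3) by simp
    also have "\<dots> = x * (B / (B + 1))" by simp
    also have "\<dots> \<le> x * 1" by (rule mult_left_mono) (use x assms(3) in auto)
    finally show False using x by simp
  qed
  then have A: "0 < A" using assms(2) by simp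
  have "2 * x \<le> x / A * A + B / (x / A)" using x A by (intro le) simp
  then show ?thesis using x A by (simp add: field_simps power2_eq_square)
qed

text \<open>Integrate 2|h| \<le> t f + g / t and optimise in t. The pointwise hypothesis on h^2 lets
  a weight be divided between the two factors in any way.\<close>

lemma integral_Cauchy_Schwarz:
  fixes f g h :: "'a \<Rightarrow> real"
  assumes f: "integrable M f" "\<And>x. 0 \<le> f x" and g: "integrable M g" "\<And>x. 0 \<le> g x"
    and h: "h \<in> borel_measurable M" "\<And>x. (h x)\<^sup>2 \<le> f x * g x"
  shows "integrable M h" "\<bar>integral\<^sup>L M h\<bar> \<le> sqrt (integral\<^sup>L M f) * sqrt (integral\<^sup>L M g)"
proof -
  have bound: "2 * \<bar>h x\<bar> \<le> t * f x + g x / t" if t: "0 < t" for x t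
  proof -
    have nn: "0 \<le> t * f x + g x / t" using t f g by simp
    have "(2 * \<bar>h x\<bar>)\<^sup>2 \<le> 4 * (f x * g x)" using h(2)[of x] by (simp add: power_mult_distrib)
    also have "\<dots> = 4 * ((t * f x) * (g x / t))" using t by simp
    also have "\<dots> \<le> (t * f x + g x / t)\<^sup>2"
      using sum_squares_bound[of "t * f x" "g x / t"] t by (simp add: power2_sum)
    finally show ?thesis using nn by (rule power2_le_imp_le)
  qed
  have int: "integrable M (\<lambda>x. t * f x + g x / t)" for t using f g by simp
  show ih: "integrable M h"
  proof (rule Bochner_Integration.integrable_bound[OF int[of 1] h(1)], rule AE_I2)
    show "norm (h x) \<le> norm (1 * f x + g x / 1)" for x
      using bound[of 1 x] f(2)[of x] g(2)[of x] by simp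
  qed
  have "(\<integral>x. \<bar>h x\<bar> \<partial>M)\<^sup>2 \<le> integral\<^sup>L M f * integral\<^sup>L M g"
  proof (rule square_le_of_weighted_AM_GM)
    fix t :: real assume t: "0 < t"
    have "(\<integral>x. 2 * \<bar>h x\<bar> \<partial>M) \<le> (\<integral>x. t * f x + g x / t \<partial>M)"
      using ih int by (intro integral_mono bound t) auto
    then show "2 * (\<integral>x. \<bar>h x\<bar> \<partial>M) \<le> t * integral\<^sup>L M f + integral\<^sup>L M g / t"
      using f g by simp
  qed (use f g in auto)
  then have "(\<integral>x. \<bar>h x\<bar> \<partial>M) \<le> sqrt (integral\<^sup>L M f * integral\<^sup>L M g)"
    by (rule real_le_rsqrt)
  then show "\<bar>integral\<^sup>L M h\<bar> \<le> sqrt (integral\<^sup>L M f) * sqrt (integral\<^sup>L M g)"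
    unfolding real_sqrt_mult by (rule order_trans[OF integral_abs_bound])
qed

definition wnorm :: "real \<Rightarrow> real \<Rightarrow> ('n::finite point \<Rightarrow> 'b::euclidean_space) \<Rightarrow> real" where
  "wnorm b s F = sqrt (sq_int b s F)"

definition wip :: "real \<Rightarrow> real \<Rightarrow> ('n::finite point \<Rightarrow> 'b::euclidean_space) \<Rightarrow> ('n point \<Rightarrow> 'b) \<Rightarrow> real" where
  "wip b s F G = (LINT z|lborel. weight b s z * (F z \<bullet> G z))"

lemma sq_int_eq_wip: "sq_int b s F = wip b s F F"
  by (simp add: sq_int_def wip_def power2_norm_eq_inner)

lemma sq_int_nonneg: "0 \<le> sq_int b s F"
  unfolding sq_int_def by (intro integral_nonneg_AE AE_I2) (auto simp: weight_nonneg)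

lemma wnorm_nonneg: "0 \<le> wnorm b s F"
  by (simp add: wnorm_def sq_int_nonneg)

lemma wnorm_square: "(wnorm b s F)\<^sup>2 = sq_int b s F"
  by (simp add: wnorm_def sq_int_nonneg)

lemma L2wD:
  assumes "F \<in> L2w b s"
  shows "F \<in> borel_measurable borel" "integrable lborel (\<lambda>z. weight b s z * (norm (F z))\<^sup>2)"
  using assms by (auto simp: L2w_def)

lemma weight_mult_weight: "2 * r = p + q \<Longrightarrow> (weight b r z)\<^sup>2 = weight b p z * weight b q z"
proof -
  assume r: "2 * r = p + q"
  have "norm z powr (-2 * r) * norm z powr (-2 * r) = norm z powr (-2 * p) * norm z powr (-2 * q)"
    unfolding powr_add[symmetric] using r by (simp add: algebra_simps)
  then show ?thesis by (simp add: weight_def power2_eq_square mult_ac)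
qed

lemma weight_norm_square: "weight b s z * (norm z)\<^sup>2 = weight b (s - 1) z"
proof (cases "z = 0")
  case False
  have "norm z powr (- (2 * s)) * (norm z)\<^sup>2 = norm z powr (- (2 * s) + 2)"
    using False powr_add[of "norm z" "- (2 * s)" 2] by (simp add: powr_numeral)
  then show ?thesis by (simp add: weight_def algebra_simps)
qed (simp add: weight_def)

text \<open>Since w_s^2 = w_p w_q, the pairing with weight w_s is finite although neither factor
  need be square integrable for w_s. This moves powers of |z| from one factor to the other.\<close>

lemma wip_bound:
  fixes F G :: "'n::finite point \<Rightarrow> 'b::euclidean_space"
  assumes F: "F \<in> L2w b p" and G: "G \<in> L2w b q" and s: "2 * s = p + q"
  shows "integrable lborel (\<lambda>z. weight b s z * (F z \<bullet> G z))" "\<bar>wip b s F G\<bar> \<le> wnorm b p F * wnorm b q G"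
proof -
  note [measurable] = L2wD(1)[OF F] L2wD(1)[OF G]
  have le: "(weight b s z * (F z \<bullet> G z))\<^sup>2 \<le> (weight b p z * (norm (F z))\<^sup>2) * (weight b q z * (norm (G z))\<^sup>2)" for z
  proof -
    have "(F z \<bullet> G z)\<^sup>2 \<le> (norm (F z) * norm (G z))\<^sup>2"
      using Cauchy_Schwarz_ineq[of "F z" "G z"] by (simp add: power_mult_distrib power2_norm_eq_inner)
    then have "weight b p z * weight b q z * (F z \<bullet> G z)\<^sup>2 \<le> weight b p z * weight b q z * (norm (F z) * norm (G z))\<^sup>2"
      by (intro mult_left_mono mult_nonneg_nonneg weight_nonneg)
    then show ?thesis by (simp add: power_mult_distrib weight_mult_weight[OF s] mult_ac)
  qed
  show "integrable lborel (\<lambda>z. weight b s z * (F z \<bullet> G z))" "\<bar>wip b s F G\<bar> \<le> wnorm b p F * wnorm b q G"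
    unfolding wip_def wnorm_def sq_int_def
    by (rule integral_Cauchy_Schwarz[OF L2wD(2)[OF F] _ L2wD(2)[OF G] _ _ le]; simp add: weight_nonneg)+
qed

text \<open>The extra factor z costs one unit of the exponent, because |z|^2 w_(q+1) = w_q.\<close>

lemma euler_pairing_bound:
  fixes U :: "'n::finite point \<Rightarrow> real" and G :: "'n point \<Rightarrow> 'n point"
  assumes U: "U \<in> L2w b p" and G: "G \<in> L2w b q" and s: "2 * s = p + q + 1"
  shows "\<bar>LINT z|lborel. weight b s z * (U z * (z \<bullet> G z))\<bar> \<le> wnorm b p U * wnorm b q G"
proof -
  note [measurable] = L2wD(1)[OF U] L2wD(1)[OF G]
  have le: "(weight b s z * (U z * (z \<bullet> G z)))\<^sup>2 \<le> (weight b p z * (norm (U z))\<^sup>2) * (weight b q z * (norm (G z))\<^sup>2)" for z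
  proof -
    have "(z \<bullet> G z)\<^sup>2 \<le> (norm z * norm (G z))\<^sup>2"
      using Cauchy_Schwarz_ineq[of z "G z"] by (simp add: power_mult_distrib power2_norm_eq_inner)
    then have "weight b p z * weight b (q + 1) z * (U z)\<^sup>2 * (z \<bullet> G z)\<^sup>2 \<le> weight b p z * weight b (q + 1) z * (U z)\<^sup>2 * (norm z * norm (G z))\<^sup>2"
      by (intro mult_left_mono mult_nonneg_nonneg weight_nonneg) auto
    also have "\<dots> = (weight b p z * (norm (U z))\<^sup>2) * (weight b (q + 1) z * (norm z)\<^sup>2 * (norm (G z))\<^sup>2)"
      by (simp add: power_mult_distrib mult_ac)
    also have "weight b (q + 1) z * (norm z)\<^sup>2 = weight b q z" by (simp add: weight_norm_square)
    finally show ?thesis using s by (simp add: power_mult_distrib weight_mult_weight[of s p "q + 1"] mult_ac)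
  qed
  show ?thesis
    unfolding wnorm_def sq_int_def
    by (rule integral_Cauchy_Schwarz[OF L2wD(2)[OF U] _ L2wD(2)[OF G] _ _ le]; simp add: weight_nonneg)
qed

lemma L2w_cmult: "F \<in> L2w b s \<Longrightarrow> (\<lambda>z. c *\<^sub>R F z) \<in> L2w b s"
  unfolding L2w_def by (auto simp: power_mult_distrib mult.left_commute[of _ "c\<^sup>2"])

lemma wip_add_left:
  assumes "F \<in> L2w b s" "G \<in> L2w b s" "H \<in> L2w b s"
  shows "wip b s (\<lambda>z. F z + G z) H = wip b s F H + wip b s G H"
  using wip_bound(1)[OF assms(1,3), of s] wip_bound(1)[OF assms(2,3), of s]
  by (simp add: wip_def inner_add_left distrib_left Bochner_Integration.integral_add)

lemma wip_cmult_left: "wip b s (\<lambda>z. c *\<^sub>R F z) G = c * wip b s F G"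
  by (simp add: wip_def mult.left_commute[of _ c])

lemma wip_commute: "wip b s F G = wip b s G F"
  by (simp add: wip_def inner_commute)

lemma L2w_add:
  assumes F: "F \<in> L2w b s" and G: "G \<in> L2w b s"
  shows "(\<lambda>z. F z + G z) \<in> L2w b s"
proof -
  have [measurable]: "F \<in> borel_measurable borel" "G \<in> borel_measurable borel" using F G by (auto simp: L2w_def)
  have "integrable lborel (\<lambda>z. weight b s z * (norm (F z))\<^sup>2 + 2 * (weight b s z * (F z \<bullet> G z)) + weight b s z * (norm (G z))\<^sup>2)"
    using L2wD(2)[OF F] L2wD(2)[OF G] wip_bound(1)[OF F G, of s]
    by (intro Bochner_Integration.integrable_add integrable_mult_right) auto
  moreover have "weight b s z * (norm (F z))\<^sup>2 + 2 * (weight b s z * (F z \<bullet> G z)) + weight b s z * (norm (G z))\<^sup>2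
     = weight b s z * (norm (F z + G z))\<^sup>2" for z
    by (simp add: power2_norm_eq_inner inner_add_left inner_add_right inner_commute algebra_simps)
  ultimately show ?thesis by (simp add: L2w_def)
qed

lemma L2w_diff: "F \<in> L2w b s \<Longrightarrow> G \<in> L2w b s \<Longrightarrow> (\<lambda>z. F z - G z) \<in> L2w b s"
  using L2w_add[of F b s "\<lambda>z. (-1) *\<^sub>R G z"] L2w_cmult[of G b s "-1"] by simp

lemma wnorm_cmult: "wnorm b s (\<lambda>z. c *\<^sub>R F z) = \<bar>c\<bar> * wnorm b s F"
  by (simp add: wnorm_def sq_int_def power_mult_distrib mult.left_commute[of _ "c\<^sup>2"] real_sqrt_mult)

lemma wnorm_minus_commute: "wnorm b s (\<lambda>z. F z - G z) = wnorm b s (\<lambda>z. G z - F z)"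
  by (simp add: wnorm_def sq_int_def norm_minus_commute)

lemma wnorm_triangle:
  assumes F: "F \<in> L2w b s" and G: "G \<in> L2w b s"
  shows "wnorm b s (\<lambda>z. F z + G z) \<le> wnorm b s F + wnorm b s G"
proof -
  have FG: "(\<lambda>z. F z + G z) \<in> L2w b s" using F G by (rule L2w_add)
  have "(wnorm b s (\<lambda>z. F z + G z))\<^sup>2 = wip b s F (\<lambda>z. F z + G z) + wip b s G (\<lambda>z. F z + G z)"
    by (simp add: wnorm_square sq_int_eq_wip wip_add_left[OF F G FG])
  also have "\<dots> \<le> (wnorm b s F + wnorm b s G) * wnorm b s (\<lambda>z. F z + G z)"
    using wip_bound(2)[OF F FG, of s] wip_bound(2)[OF G FG, of s] by (simp add: algebra_simps)
  finally show ?thesis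
    using wnorm_nonneg[of b s "\<lambda>z. F z + G z"] wnorm_nonneg[of b s F] wnorm_nonneg[of b s G]
    by (cases "wnorm b s (\<lambda>z. F z + G z) = 0") (auto simp: power2_eq_square)
qed

lemma wnorm_zero_imp_AE:
  assumes F: "F \<in> L2w b s" and "wnorm b s F = 0"
  shows "AE z in lborel. F z = 0"
proof -
  have "(LINT z|lborel. weight b s z * (norm (F z))\<^sup>2) = 0"
    using assms(2) by (simp add: wnorm_def sq_int_def)
  then have "AE z in lborel. weight b s z * (norm (F z))\<^sup>2 = 0"
    using L2wD(2)[OF F] by (subst (asm) integral_nonneg_eq_0_iff_AE) (auto simp: weight_nonneg)
  then show ?thesis using AE_weight_pos[of b s] by eventually_elim auto
qed

lemma wnorm_cong_AE:
  assumes "F \<in> borel_measurable borel" "G \<in> borel_measurable borel" "AE z in lborel. F z = G z"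
  shows "wnorm b s F = wnorm b s G"
proof -
  note [measurable] = assms(1,2)
  show ?thesis
    unfolding wnorm_def sq_int_def
    by (rule arg_cong[where f=sqrt], rule integral_cong_AE) (use assms(3) in auto)
qed

lemma wnorm_tendsto:
  assumes F: "\<And>m. F m \<in> L2w b s" and G: "G \<in> L2w b s"
    and lim: "(\<lambda>m. wnorm b s (\<lambda>z. F m z - G z)) \<longlonglongrightarrow> 0"
  shows "(\<lambda>m. wnorm b s (F m)) \<longlonglongrightarrow> wnorm b s G"
proof -
  have "\<bar>wnorm b s (F m) - wnorm b s G\<bar> \<le> wnorm b s (\<lambda>z. F m z - G z)" for m
    using wnorm_triangle[OF L2w_diff[OF F G] G, of m] wnorm_triangle[OF L2w_diff[OF G F[of m]] F[of m]]
      wnorm_minus_commute[of b s "F m" G] by auto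
  then have "(\<lambda>m. wnorm b s (F m) - wnorm b s G) \<longlonglongrightarrow> 0"
    by (intro Lim_null_comparison[OF _ lim]) auto
  then show ?thesis by (simp add: LIM_zero_iff)
qed

text \<open>The Riesz-Fischer argument for the weighted measure: a rapidly Cauchy subsequence
  converges almost everywhere, and Fatou's lemma shows that the whole sequence converges in norm to
  that limit.\<close>

lemma L2w_complete:
  fixes F :: "nat \<Rightarrow> 'n::finite point \<Rightarrow> 'b::euclidean_space"
  assumes F: "\<And>m. F m \<in> L2w b s"
    and cauchy: "\<And>\<epsilon>. 0 < \<epsilon> \<Longrightarrow> \<exists>M. \<forall>m\<ge>M. \<forall>l\<ge>M. wnorm b s (\<lambda>z. F m z - F l z) < \<epsilon>"
  shows "\<exists>G\<in>L2w b s. (\<lambda>m. wnorm b s (\<lambda>z. F m z - G z)) \<longlonglongrightarrow> 0"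
proof -
  have [measurable]: "F m \<in> borel_measurable borel" for m using F by (rule L2wD)
  have "\<forall>j. \<exists>M. \<forall>m\<ge>M. \<forall>l\<ge>M. wnorm b s (\<lambda>z. F m z - F l z) < (1/2) ^ j"
    using cauchy by simp
  then obtain N where N: "\<And>j m l. N j \<le> m \<Longrightarrow> N j \<le> l \<Longrightarrow> wnorm b s (\<lambda>z. F m z - F l z) < (1/2) ^ j"
    by metis
  \<comment> \<open>Partial sums dominate all earlier N i. Only k j \<ge> N i for i \<le> j is used,
    so k need not be strictly increasing.\<close>
  define k where "k j = (\<Sum>i\<le>j. N i)" for j
  have kN: "N i \<le> k j" if "i \<le> j" for i j
    unfolding k_def by (rule member_le_sum) (use that in auto)
  define D where "D j z = F (k (Suc j)) z - F (k j) z" for j z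
  \<comment> \<open>The squared norms of the differences are below 4^(-j), so a gain of 2^j still
    leaves summable integrals. Finiteness of the sum of the g j at a point then gives |D j z| \<le>
    const * 2^(-j/2), hence absolute convergence.\<close>
  define g where "g j z = 2 ^ j * (weight b s z * (norm (D j z))\<^sup>2)" for j z
  have [measurable]: "D j \<in> borel_measurable borel" "g j \<in> borel_measurable borel" for j
    unfolding D_def[abs_def] g_def[abs_def] by measurable
  have g0: "0 \<le> g j z" for j z by (simp add: g_def weight_nonneg)
  have nn: "(\<integral>\<^sup>+z. ennreal (weight b s z * (norm (F m z - F l z))\<^sup>2) \<partial>lborel) = ennreal ((wnorm b s (\<lambda>z. F m z - F l z))\<^sup>2)" for m l
    unfolding wnorm_square sq_int_def
    by (intro nn_integral_eq_integral L2wD(2) L2w_diff F) (auto simp: weight_nonneg)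
  have "(\<integral>\<^sup>+z. ennreal (g j z) \<partial>lborel) \<le> ennreal ((1/2) ^ j)" for j
  proof -
    have "(\<integral>\<^sup>+z. ennreal (g j z) \<partial>lborel) = ennreal (2 ^ j) * (\<integral>\<^sup>+z. ennreal (weight b s z * (norm (D j z))\<^sup>2) \<partial>lborel)"
      unfolding g_def by (subst nn_integral_cmult[symmetric]) (auto simp: ennreal_mult weight_nonneg)
    also have "\<dots> = ennreal (2 ^ j * (wnorm b s (D j))\<^sup>2)"
      unfolding D_def[abs_def] nn by (simp add: ennreal_mult)
    also have "\<dots> \<le> ennreal (2 ^ j * ((1/2) ^ j)\<^sup>2)"
      unfolding D_def[abs_def]
      by (intro ennreal_leI mult_left_mono power_mono less_imp_le[OF N] kN wnorm_nonneg) auto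
    also have "(2::real) ^ j * ((1/2) ^ j)\<^sup>2 = (1/2) ^ j"
      by (simp add: power2_eq_square power_divide)
    finally show ?thesis .
  qed
  then have "(\<Sum>j. \<integral>\<^sup>+z. ennreal (g j z) \<partial>lborel) \<le> (\<Sum>j. ennreal ((1/2) ^ j))"
    by (intro suminf_le) auto
  also have "\<dots> = ennreal (\<Sum>j. (1/2) ^ j)" by (intro suminf_ennreal2) auto
  finally have "(\<integral>\<^sup>+z. (\<Sum>j. ennreal (g j z)) \<partial>lborel) < \<infinity>"
    by (subst nn_integral_suminf) (auto intro: le_less_trans)
  then have "AE z in lborel. (\<Sum>j. ennreal (g j z)) \<noteq> \<infinity>"
    by (intro nn_integral_noteq_infinite) auto
  then have conv: "AE z in lborel. convergent (\<lambda>j. F (k j) z)"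
    using AE_weight_pos[of b s]
  proof eventually_elim
    case (elim z)
    then obtain B where B: "0 \<le> B" "(\<Sum>j. ennreal (g j z)) = ennreal B"
      by (cases "\<Sum>j. ennreal (g j z)") auto
    have gB: "g j z \<le> B" for j
    proof -
      have "ennreal (g j z) \<le> (\<Sum>j. ennreal (g j z))"
        using sum_le_suminf[of "\<lambda>j. ennreal (g j z)" "{j}"] by simp
      then show ?thesis using B by simp
    qed
    have "norm (D j z) \<le> sqrt (B / weight b s z) * (sqrt (1/2)) ^ j" for j
    proof -
      have "(norm (D j z))\<^sup>2 \<le> B / weight b s z * (1/2) ^ j"
        using gB[of j] elim(2) by (simp add: g_def field_simps power_divide)
      then have "norm (D j z) \<le> sqrt (B / weight b s z * (1/2) ^ j)" by (rule real_le_rsqrt)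
      then show ?thesis by (simp only: real_sqrt_mult real_sqrt_power)
    qed
    note le = this
    have "summable (\<lambda>j. sqrt (B / weight b s z) * (sqrt (1/2)) ^ j)"
      by (intro summable_mult summable_geometric) (simp add: real_sqrt_divide)
    then have "summable (\<lambda>j. D j z)"
      by (rule summable_comparison_test'[where N=0]) (rule le)
    then have "convergent (\<lambda>n. \<Sum>j<n. D j z)" by (simp add: summable_iff_convergent)
    then have "convergent (\<lambda>n. (F (k n) z - F (k 0) z) + F (k 0) z)"
      unfolding D_def sum_lessThan_telescope[of "\<lambda>j. F (k j) z"] by (intro convergent_add convergent_const)
    then show ?case by simp
  qed
  define G where "G z = lim (\<lambda>j. F (k j) z)" for z
  have [measurable]: "G \<in> borel_measurable borel"
    unfolding G_def[abs_def] by (rule borel_measurable_lim_metric) auto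
  have limG: "AE z in lborel. (\<lambda>j. F (k j) z) \<longlonglongrightarrow> G z"
    using conv by eventually_elim (simp add: G_def convergent_LIMSEQ_iff)
  have fatou: "(\<integral>\<^sup>+z. ennreal (weight b s z * (norm (F m z - G z))\<^sup>2) \<partial>lborel) \<le> ennreal (((1/2) ^ i)\<^sup>2)"
    if m: "N i \<le> m" for i m
  proof -
    have "AE z in lborel. ennreal (weight b s z * (norm (F m z - G z))\<^sup>2) =
        liminf (\<lambda>j. ennreal (weight b s z * (norm (F m z - F (k j) z))\<^sup>2))"
      using limG
    proof eventually_elim
      case (elim z)
      then have "(\<lambda>j. ennreal (weight b s z * (norm (F m z - F (k j) z))\<^sup>2)) \<longlonglongrightarrow> ennreal (weight b s z * (norm (F m z - G z))\<^sup>2)"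
        by (intro tendsto_intros)
      then show ?case by (simp add: lim_imp_Liminf)
    qed
    then have "(\<integral>\<^sup>+z. ennreal (weight b s z * (norm (F m z - G z))\<^sup>2) \<partial>lborel) =
        (\<integral>\<^sup>+z. liminf (\<lambda>j. ennreal (weight b s z * (norm (F m z - F (k j) z))\<^sup>2)) \<partial>lborel)"
      by (rule nn_integral_cong_AE)
    also have "\<dots> \<le> liminf (\<lambda>j. \<integral>\<^sup>+z. ennreal (weight b s z * (norm (F m z - F (k j) z))\<^sup>2) \<partial>lborel)"
      by (rule nn_integral_liminf) measurable
    also have "\<dots> \<le> ennreal (((1/2) ^ i)\<^sup>2)"
    proof (rule Liminf_le)
      show "\<forall>\<^sub>F j in sequentially. (\<integral>\<^sup>+z. ennreal (weight b s z * (norm (F m z - F (k j) z))\<^sup>2) \<partial>lborel) \<le> ennreal (((1/2) ^ i)\<^sup>2)"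
        unfolding nn
        by (intro eventually_sequentiallyI[of i] ennreal_leI power_mono less_imp_le[OF N] m kN wnorm_nonneg)
    qed simp
    finally show ?thesis .
  qed
  have FG: "(\<lambda>z. F m z - G z) \<in> L2w b s" if "N 0 \<le> m" for m
    unfolding L2w_def mem_Collect_eq
    by (intro conjI integrableI_nonneg le_less_trans[OF fatou[OF that]]) (auto simp: weight_nonneg)
  have "G \<in> L2w b s" using L2w_diff[OF F FG[of "N 0"], of "N 0"] by simp
  moreover have "(\<lambda>m. wnorm b s (\<lambda>z. F m z - G z)) \<longlonglongrightarrow> 0"
  proof (rule LIMSEQ_I)
    fix e :: real assume "0 < e"
    then obtain i where i: "(1/2) ^ i < e" using real_arch_pow_inv[of e "1/2"] by auto
    have "wnorm b s (\<lambda>z. F m z - G z) \<le> (1/2) ^ i" if "N i \<le> m" for m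
    proof -
      have L: "(\<lambda>z. F m z - G z) \<in> L2w b s" using L2w_diff[OF F \<open>G \<in> L2w b s\<close>] .
      have "ennreal ((wnorm b s (\<lambda>z. F m z - G z))\<^sup>2) = (\<integral>\<^sup>+z. ennreal (weight b s z * (norm (F m z - G z))\<^sup>2) \<partial>lborel)"
        unfolding wnorm_square sq_int_def
        by (intro nn_integral_eq_integral[symmetric] L2wD(2)[OF L]) (auto simp: weight_nonneg)
      also have "\<dots> \<le> ennreal (((1/2) ^ i)\<^sup>2)" by (rule fatou[OF that])
      finally have "(wnorm b s (\<lambda>z. F m z - G z))\<^sup>2 \<le> ((1/2) ^ i)\<^sup>2"
        by (subst (asm) ennreal_le_iff) auto
      then show ?thesis by (rule power2_le_imp_le) simp
    qed
    then show "\<exists>no. \<forall>n\<ge>no. norm (wnorm b s (\<lambda>z. F n z - G z) - 0) < e"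
      using i by (intro exI[of _ "N i"]) (auto simp: wnorm_nonneg intro: le_less_trans)
  qed
  ultimately show ?thesis by blast
qed

text \<open>Weak convergence to 0, tested only against the members of the sequence, becomes strong
  for a Cauchy sequence: split |X m|^2 = <X m - X l, X m> + <X l, X m>, fix l so late that the first
  term is small for all later m, then let m grow in the second.\<close>

lemma wnorm_null_of_wip_null:
  assumes X: "\<And>m. X m \<in> L2w b s"
    and cauchy: "\<And>\<epsilon>. 0 < \<epsilon> \<Longrightarrow> \<exists>M. \<forall>m\<ge>M. \<forall>l\<ge>M. wnorm b s (\<lambda>z. X m z - X l z) < \<epsilon>"
    and null: "\<And>l. (\<lambda>m. wip b s (X l) (X m)) \<longlonglongrightarrow> 0"
  shows "(\<lambda>m. wnorm b s (X m)) \<longlonglongrightarrow> 0"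
proof (rule LIMSEQ_I)
  fix e :: real assume e: "0 < e"
  obtain M0 where M0: "\<And>m l. M0 \<le> m \<Longrightarrow> M0 \<le> l \<Longrightarrow> wnorm b s (\<lambda>z. X m z - X l z) < 1"
    using cauchy[of 1] by auto
  \<comment> \<open>Cauchy sequences are bounded: the bound K on the late members absorbs the factor
    |X m| in the first term.\<close>
  define K where "K = wnorm b s (X M0) + 1"
  have K: "0 < K" using wnorm_nonneg[of b s "X M0"] by (simp add: K_def)
  have bound: "wnorm b s (X m) \<le> K" if "M0 \<le> m" for m
    using wnorm_triangle[OF L2w_diff[OF X X] X, of m M0 M0] M0[OF that order_refl] by (simp add: K_def)
  obtain M where M: "\<And>m l. M \<le> m \<Longrightarrow> M \<le> l \<Longrightarrow> wnorm b s (\<lambda>z. X m z - X l z) < e\<^sup>2 / (2 * K)"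
    using cauchy[of "e\<^sup>2 / (2 * K)"] e K by (auto simp: zero_less_divide_iff)
  define l where "l = max M M0"
  obtain M1 where M1: "\<And>m. M1 \<le> m \<Longrightarrow> \<bar>wip b s (X l) (X m)\<bar> < e\<^sup>2 / 2"
    using LIMSEQ_D[OF null[of l], of "e\<^sup>2 / 2"] e by auto
  have "wnorm b s (X m) < e" if m: "max l M1 \<le> m" for m
  proof -
    have "(wnorm b s (X m))\<^sup>2 = wip b s (\<lambda>z. (X m z - X l z) + X l z) (X m)"
      by (simp add: wnorm_square sq_int_eq_wip)
    also have "\<dots> = wip b s (\<lambda>z. X m z - X l z) (X m) + wip b s (X l) (X m)"
      by (intro wip_add_left L2w_diff X)
    also have "\<dots> < wnorm b s (\<lambda>z. X m z - X l z) * wnorm b s (X m) + e\<^sup>2 / 2"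
    proof -
      have "\<bar>wip b s (\<lambda>z. X m z - X l z) (X m)\<bar> \<le> wnorm b s (\<lambda>z. X m z - X l z) * wnorm b s (X m)"
        by (rule wip_bound(2)[OF L2w_diff[OF X X] X]) simp
      moreover have "\<bar>wip b s (X l) (X m)\<bar> < e\<^sup>2 / 2" using m by (intro M1) simp
      ultimately show ?thesis by linarith
    qed
    also have "\<dots> \<le> e\<^sup>2 / (2 * K) * K + e\<^sup>2 / 2"
      using M[of m l] bound[of m] m K
      by (intro add_right_mono mult_mono) (auto simp: l_def wnorm_nonneg)
    also have "\<dots> = e\<^sup>2" using K by simp
    finally show ?thesis by (rule power2_less_imp_less) (use e in simp)
  qed
  then show "\<exists>no. \<forall>m\<ge>no. norm (wnorm b s (X m) - 0) < e"
    by (intro exI[of _ "max l M1"]) (auto simp: wnorm_nonneg)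
qed

section \<open>Hardy and Rellich inequalities for test functions\<close>

lemma continuous_supp_in_L2w:
  fixes F :: "'n::finite point \<Rightarrow> 'b::euclidean_space"
  assumes "continuous_on UNIV F" "supp_in R F" "-1 < b" "2 * s < real CARD('n) + 1 + b"
  shows "F \<in> L2w b s"
  unfolding L2w_def mem_Collect_eq
proof (intro conjI)
  show "integrable lborel (\<lambda>z. weight b s z * (norm (F z))\<^sup>2)"
    by (rule loc_weight_integrable[OF loc_weight_weight, where R=R])
      (use assms in \<open>auto simp: supp_in_def intro!: continuous_intros\<close>)
qed (use assms borel_measurable_continuous_onI in auto)

lemma sq_int_nabla_0: "sq_int b s (nabla b 0 U) = sq_int b s U"
  and sq_int_nabla_1: "sq_int b s (nabla b (Suc 0) U) = sq_int b s (grad U)"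
  by (simp_all add: sq_int_def nabla_0 nabla_1 norm_Pair)

lemma wip_nabla_0: "wip b s (nabla b 0 U) (nabla b 0 V) = wip b s U V"
  and wip_nabla_1: "wip b s (nabla b (Suc 0) U) (nabla b (Suc 0) V) = wip b s (grad U) (grad V)"
  by (simp_all add: wip_def nabla_0 nabla_1)

context
  fixes b :: real
  assumes b: "-1 < b"
begin

lemma nabla_L2w:
  fixes U :: "'n::finite point \<Rightarrow> real"
  assumes "U \<in> test_even" "2 * s < real CARD('n) + 1 + b"
  shows "nabla b j U \<in> L2w b s"
  using nabla_supp_in[OF assms(1)] continuous_supp_in_L2w[OF nabla_continuous[OF assms(1)] _ b assms(2)] by blast

lemma test_L2w:
  fixes U :: "'n::finite point \<Rightarrow> real"
  assumes "U \<in> test_even" "2 * s < real CARD('n) + 1 + b"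
  shows "U \<in> L2w b s"
proof -
  obtain R where "supp_in R U" using test_evenD(5)[OF assms(1)] by blast
  then show ?thesis by (intro continuous_supp_in_L2w smooth_continuous test_evenD(1) assms b)
qed

lemma grad_L2w:
  fixes U :: "'n::finite point \<Rightarrow> real"
  assumes "U \<in> test_even" "2 * s < real CARD('n) + 1 + b"
  shows "grad U \<in> L2w b s"
proof -
  obtain R where "supp_in R U" using test_evenD(5)[OF assms(1)] by blast
  then show ?thesis
    by (intro continuous_supp_in_L2w continuous_on_grad test_evenD(2) assms b supp_in_grad)
qed

text \<open>\<open>integral_euler\<close> for V^2, whose gradient is 2 V grad V.\<close>

lemma euler_square:
  fixes V :: "'n::finite point \<Rightarrow> real"
  assumes V: "V \<in> test_even" and s: "2 * s < real CARD('n) + 1 + b"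
  shows "2 * (LINT z|lborel. weight b s z * (V z * (z \<bullet> grad V z))) = - (real CARD('n) + 1 + b - 2 * s) * sq_int b s V"
proof -
  let ?F = "\<lambda>z. V z * V z"
  obtain R where R: "supp_in R ?F" using test_evenD(5)[OF test_even_mult[OF V V]] by blast
  have "grad ?F z = (2 * V z) *\<^sub>R grad V z" for z
    by (simp add: grad_def partial_mult test_evenD(3)[OF V] scaleR_sum_right algebra_simps)
  then have "(LINT z|lborel. weight b s z * (z \<bullet> grad ?F z)) = 2 * (LINT z|lborel. weight b s z * (V z * (z \<bullet> grad V z)))"
    by (simp add: mult.left_commute[of _ 2] mult.assoc)
  moreover have "(LINT z|lborel. weight b s z * ?F z) = sq_int b s V"
    by (simp add: sq_int_def power2_eq_square)
  ultimately show ?thesis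
    using integral_euler[OF test_evenD(2)[OF test_even_mult[OF V V]] R b s] by simp
qed

lemma hardy_test:
  fixes V :: "'n::finite point \<Rightarrow> real"
  assumes V: "V \<in> test_even" and s: "2 * s + 2 < real CARD('n) + 1 + b"
  shows "((real CARD('n) + 1 + b - 2 - 2 * s) / 2)\<^sup>2 * sq_int b (s + 1) V \<le> sq_int b s (grad V)"
proof -
  define c where "c = (real CARD('n) + 1 + b - 2 - 2 * s) / 2"
  let ?A = "sq_int b (s + 1) V" and ?G = "sq_int b s (grad V)"
  have c: "0 < c" using s by (simp add: c_def)
  have "c * ?A = \<bar>LINT z|lborel. weight b (s + 1) z * (V z * (z \<bullet> grad V z))\<bar>"
  proof -
    have "2 * (LINT z|lborel. weight b (s + 1) z * (V z * (z \<bullet> grad V z))) = 2 * (- (c * ?A))"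
      using euler_square[OF V, of "s + 1"] s by (simp add: c_def field_simps)
    then show ?thesis using c sq_int_nonneg[of b "s + 1" V] by (simp add: abs_mult)
  qed
  also have "\<dots> \<le> wnorm b (s + 1) V * wnorm b s (grad V)"
    using s by (intro euler_pairing_bound test_L2w grad_L2w V) auto
  finally have "(c * ?A)\<^sup>2 \<le> (wnorm b (s + 1) V * wnorm b s (grad V))\<^sup>2"
    using c sq_int_nonneg[of b "s + 1" V] by (intro power_mono) auto
  \<comment> \<open>Squaring the Cauchy-Schwarz bound leaves a common factor \<open>?A\<close> to
    cancel; if it is 0, the claim is nonnegativity of \<open>?G\<close>.\<close>
  then have "?A * (c\<^sup>2 * ?A) \<le> ?A * ?G"
    by (simp add: power_mult_distrib wnorm_square power2_eq_square[of ?A] mult_ac)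
  then show ?thesis
    unfolding c_def[symmetric] using sq_int_nonneg[of b "s + 1" V] sq_int_nonneg[of b s "grad V"]
    by (cases "?A = 0") auto
qed

text \<open>Integration by parts with V against itself at exponent s + 1 gives G + (s + 1)(d - 2s -
  4) A = -<V, Delta_b V>. Bounding G below by Hardy yields C A on the left, with (d - 4 - 2s)/4 *
  ((d - 4 - 2s) + 4 (s + 1)) = C; Cauchy-Schwarz on the right gives the second claim. For the third,
  the A-term is dropped and the second claim is inserted on the right.\<close>

lemma rellich_test:
  fixes V :: "'n::finite point \<Rightarrow> real"
  assumes V: "V \<in> test_even" and s: "0 \<le> s" "2 * s + 4 < real CARD('n) + 1 + b"
  defines "C \<equiv> (real CARD('n) + 1 + b + 2 * s) * (real CARD('n) + 1 + b - 4 - 2 * s) / 4"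
  shows "0 < C" "C\<^sup>2 * sq_int b (s + 2) V \<le> sq_int b s (Delta_b b V)" "C * sq_int b (s + 1) (grad V) \<le> sq_int b s (Delta_b b V)"
proof -
  let ?d = "real CARD('n) + 1 + b"
  let ?A = "sq_int b (s + 2) V" and ?G = "sq_int b (s + 1) (grad V)" and ?L = "sq_int b s (Delta_b b V)"
  have nn: "0 \<le> ?A" "0 \<le> ?G" "0 \<le> ?L" by (rule sq_int_nonneg)+
  have d: "0 < ?d" using b by simp
  show C: "0 < C" unfolding C_def using s d by (intro divide_pos_pos mult_pos_pos) auto
  have D: "Delta_b b V \<in> test_even" using V by (rule Delta_b_test_even)
  have "wip b (s + 1) V (Delta_b b V) + ?G = (LINT z|lborel. weight b (s + 1) z * (V z * Delta_b b V z + grad V z \<bullet> grad V z))"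
    unfolding sq_int_eq_wip wip_def
    using s wip_bound(1)[OF test_L2w[OF V] test_L2w[OF D], of "s + 1" "s + 1" "s + 1"]
      wip_bound(1)[OF grad_L2w[OF V] grad_L2w[OF V], of "s + 1" "s + 1" "s + 1"]
    by (simp add: distrib_left Bochner_Integration.integral_add)
  also have "\<dots> = 2 * (s + 1) * (LINT z|lborel. weight b (s + 2) z * (V z * (z \<bullet> grad V z)))"
    using integral_by_parts[OF V V b, of "s + 1"] s by (simp add: add.assoc)
  also have "\<dots> = - ((s + 1) * (?d - 2 * s - 4) * ?A)"
    using arg_cong[OF euler_square[OF V, of "s + 2"], of "(*) (s + 1)"] s by (simp add: algebra_simps)
  finally have G: "?G + (s + 1) * (?d - 2 * s - 4) * ?A = - wip b (s + 1) V (Delta_b b V)" by simp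
  also have "\<dots> \<le> wnorm b (s + 2) V * wnorm b s (Delta_b b V)"
    using wip_bound(2)[OF test_L2w[OF V, of "s + 2"] test_L2w[OF D, of s], of "s + 1"] s by simp
  finally have main: "?G + (s + 1) * (?d - 2 * s - 4) * ?A \<le> wnorm b (s + 2) V * wnorm b s (Delta_b b V)" .
  have "C * ?A = ((?d - 2 - 2 * (s + 1)) / 2)\<^sup>2 * ?A + (s + 1) * (?d - 2 * s - 4) * ?A"
    by (simp add: C_def field_simps power2_eq_square)
  also have "\<dots> \<le> ?G + (s + 1) * (?d - 2 * s - 4) * ?A"
    using hardy_test[OF V, of "s + 1"] s by (simp add: add.assoc)
  finally have CA: "C * ?A \<le> wnorm b (s + 2) V * wnorm b s (Delta_b b V)" using main by linarith
  then have "(C * ?A)\<^sup>2 \<le> (wnorm b (s + 2) V * wnorm b s (Delta_b b V))\<^sup>2"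
    using C nn by (intro power_mono) auto
  then have "?A * (C\<^sup>2 * ?A) \<le> ?A * ?L"
    by (simp add: power_mult_distrib wnorm_square power2_eq_square[of ?A] mult_ac)
  then show R: "C\<^sup>2 * ?A \<le> ?L" using nn by (cases "?A = 0") auto
  have "0 \<le> (s + 1) * (?d - 2 * s - 4) * ?A" using s nn by (intro mult_nonneg_nonneg) auto
  then have "?G \<le> wnorm b (s + 2) V * wnorm b s (Delta_b b V)" using main by linarith
  then have "C * ?G \<le> (C * wnorm b (s + 2) V) * wnorm b s (Delta_b b V)" using C by simp
  also have "\<dots> \<le> wnorm b s (Delta_b b V) * wnorm b s (Delta_b b V)"
  proof (rule mult_right_mono[OF _ wnorm_nonneg])
    have "(C * wnorm b (s + 2) V)\<^sup>2 \<le> (wnorm b s (Delta_b b V))\<^sup>2"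
      using R by (simp add: power_mult_distrib wnorm_square)
    then show "C * wnorm b (s + 2) V \<le> wnorm b s (Delta_b b V)"
      using wnorm_nonneg by (rule power2_le_imp_le)
  qed
  finally show "C * ?G \<le> ?L" by (simp add: power2_eq_square[symmetric] wnorm_square)
qed

end

section \<open>The constant and its recursion in the order\<close>

lemma Gamma_real_plus1: "0 < x \<Longrightarrow> Gamma (x + 1) = x * Gamma (x::real)"
  by (rule Gamma_plus1) (auto elim!: nonpos_Ints_cases)

text \<open>Passing from k to k + 2 leaves k/2 - [k/2], hence the first Gamma quotient, unchanged.
  In the second one the numerator moves up by one and the denominator down by one, which brings out
  x y; with 2^2 this is 4 x y, the Rellich constant at s = a + k.\<close>

lemma H_const_Suc_Suc:
  assumes "-1 < b" "0 \<le> a" "a + real k + 2 < (real n + 1 + b) / 2"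
  shows "H_const n (Suc (Suc k)) a b =
    (real n + 1 + b + 2 * (a + real k)) * (real n + 1 + b - 4 - 2 * (a + real k)) / 4 * H_const n k a b"
proof -
  define q where "q = (real n + 1 + b) / 4"
  define r where "r = real k / 2 - real (k div 2)"
  define x where "x = q + real k / 2 + a / 2"
  \<comment> \<open>The shift by -1 makes y the argument of the denominator for k + 2, so that the
    one for k is y + 1. The upper bound on a + k + 2 is what makes y positive.\<close>
  define y where "y = q - real k / 2 - a / 2 - 1"
  have q: "0 < q" using assms(1) by (simp add: q_def)
  have x: "0 < x" using q assms(2) by (simp add: x_def add_pos_nonneg)
  have y: "0 < y" using assms(3) by (simp add: y_def q_def field_simps)
  have r: "real (Suc (Suc k)) / 2 - real (Suc (Suc k) div 2) = r" by (simp add: r_def field_simps)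
  have x': "q + real (Suc (Suc k)) / 2 + a / 2 = x + 1" by (simp add: x_def field_simps)
  have y': "q - real (Suc (Suc k)) / 2 - a / 2 = y" by (simp add: y_def field_simps)
  have y'': "q - real k / 2 - a / 2 = y + 1" by (simp add: y_def)
  have "H_const n (Suc (Suc k)) a b = 2 ^ (Suc (Suc k)) * (Gamma (q + r - a / 2) / Gamma (q + r + a / 2)) * (Gamma (x + 1) / Gamma y)"
    unfolding H_const_def Let_def q_def[symmetric] r x' y' ..
  also have "\<dots> = 4 * x * y * (2 ^ k * (Gamma (q + r - a / 2) / Gamma (q + r + a / 2)) * (Gamma x / Gamma (y + 1)))"
    using x y by (simp add: Gamma_real_plus1)
  also have "2 ^ k * (Gamma (q + r - a / 2) / Gamma (q + r + a / 2)) * (Gamma x / Gamma (y + 1)) = H_const n k a b"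
    unfolding H_const_def Let_def q_def[symmetric] r_def[symmetric] x_def[symmetric] y'' ..
  also have "4 * x * y = (real n + 1 + b + 2 * (a + real k)) * (real n + 1 + b - 4 - 2 * (a + real k)) / 4"
    by (simp add: x_def y_def q_def field_simps)
  finally show ?thesis .
qed

lemma H_const_0:
  assumes "-1 < b" "0 \<le> a" "a < (real n + 1 + b) / 2"
  shows "H_const n 0 a b = 1"
proof -
  define q where "q = (real n + 1 + b) / 4"
  have "0 < q - a / 2" "0 < q + a / 2" using assms by (auto simp: q_def field_simps)
  then have "Gamma (q - a / 2) \<noteq> 0" "Gamma (q + a / 2) \<noteq> 0"
    by (metis Gamma_real_pos less_irrefl)+
  then show ?thesis by (simp add: H_const_def Let_def q_def[symmetric])
qed

text \<open>For k = 1 the offset is 1/2, so the two Gamma values with +a/2 cancel and a single step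
  of the functional equation leaves the Hardy constant.\<close>

lemma H_const_1:
  assumes "-1 < b" "0 \<le> a" "a + 1 < (real n + 1 + b) / 2"
  shows "H_const n (Suc 0) a b = (real n + 1 + b - 2 - 2 * a) / 2"
proof -
  define q where "q = (real n + 1 + b) / 4"
  define x where "x = q - 1 / 2 - a / 2"
  have x: "0 < x" "0 < q + 1 / 2 + a / 2" using assms by (auto simp: q_def x_def field_simps)
  then have ne: "Gamma x \<noteq> 0" "Gamma (q + 1 / 2 + a / 2) \<noteq> 0"
    by (metis Gamma_real_pos less_irrefl)+
  have x1: "q + 1 / 2 - a / 2 = x + 1" by (simp add: x_def)
  have "H_const n (Suc 0) a b = 2 * (Gamma (x + 1) / Gamma (q + 1 / 2 + a / 2)) * (Gamma (q + 1 / 2 + a / 2) / Gamma x)"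
    by (simp add: H_const_def Let_def q_def[symmetric] x1 x_def[symmetric])
  also have "\<dots> = 2 * x" using ne x by (simp add: Gamma_real_plus1)
  also have "\<dots> = (real n + 1 + b - 2 - 2 * a) / 2" by (simp add: x_def q_def field_simps)
  finally show ?thesis .
qed

lemma H_const_pos:
  assumes "-1 < b" "0 \<le> a" "a + real k < (real n + 1 + b) / 2"
  shows "0 < H_const n k a b"
  using assms(3)
proof (induction k rule: induct_nat_012)
  case 0
  then show ?case using H_const_0[OF assms(1,2)] by simp
next
  case 1
  then have "H_const n (Suc 0) a b = (real n + 1 + b - 2 - 2 * a) / 2"
    by (intro H_const_1 assms(1,2)) simp
  then show ?case using 1 by simp
next
  case (ge2 k)
  have "0 < H_const n k a b" using ge2 by simp
  moreover have "0 < (real n + 1 + b + 2 * (a + real k)) * (real n + 1 + b - 4 - 2 * (a + real k)) / 4"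
    using ge2.prems assms(1,2) by (intro divide_pos_pos mult_pos_pos) auto
  moreover have "H_const n (Suc (Suc k)) a b = (real n + 1 + b + 2 * (a + real k)) * (real n + 1 + b - 4 - 2 * (a + real k)) / 4 * H_const n k a b"
    using ge2.prems by (intro H_const_Suc_Suc assms(1,2)) simp
  ultimately show ?case by (simp only: mult_pos_pos)
qed

text \<open>In the step the Rellich inequality acts at s = a + k on U and the induction hypothesis
  on \<open>Delta_b b U\<close>. The base cases are equality (k = 0) and Hardy (k = 1).\<close>

lemma hardy_rellich_test:
  fixes U :: "'n::finite point \<Rightarrow> real"
  assumes b: "-1 < b" and a: "0 \<le> a" and k: "a + real k < (real CARD('n) + 1 + b) / 2" and U: "U \<in> test_even"
  shows "(H_const CARD('n) k a b)\<^sup>2 * sq_int b (a + real k) U \<le> sq_int b a (nabla b k U)"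
  using k U
proof (induction k arbitrary: U rule: induct_nat_012)
  case 0
  then show ?case using H_const_0[OF b a] by (simp add: sq_int_nabla_0)
next
  case 1
  then have H: "H_const CARD('n) (Suc 0) a b = (real CARD('n) + 1 + b - 2 - 2 * a) / 2"
    by (intro H_const_1 b a) simp
  show ?case using hardy_test[OF b, of U a] 1 unfolding H sq_int_nabla_1 by simp
next
  case (ge2 k)
  define C where "C = (real CARD('n) + 1 + b + 2 * (a + real k)) * (real CARD('n) + 1 + b - 4 - 2 * (a + real k)) / 4"
  have H: "H_const CARD('n) (Suc (Suc k)) a b = C * H_const CARD('n) k a b"
    using H_const_Suc_Suc[OF b a, of k "CARD('n)"] ge2.prems(1) by (simp add: C_def)
  have "C\<^sup>2 * sq_int b (a + real k + 2) U \<le> sq_int b (a + real k) (Delta_b b U)"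
    unfolding C_def using a ge2.prems by (intro rellich_test b) auto
  then have "(H_const CARD('n) k a b)\<^sup>2 * (C\<^sup>2 * sq_int b (a + real k + 2) U) \<le> (H_const CARD('n) k a b)\<^sup>2 * sq_int b (a + real k) (Delta_b b U)"
    by (rule mult_left_mono) simp
  also have "\<dots> \<le> sq_int b a (nabla b k (Delta_b b U))"
    using ge2.prems by (intro ge2.IH Delta_b_test_even) auto
  finally show ?case by (simp add: H power_mult_distrib nabla_Suc_Suc mult_ac add_ac)
qed

text \<open>The reason why the top order controls the triple norm. In the step, order 0 is the
  Hardy-Rellich inequality, order 1 the gradient bound in \<open>rellich_test\<close> at s = a + k,
  and each order j \<ge> 2 is order j - 2 of \<open>Delta_b b U\<close>.\<close>

lemma nabla_test_bound:
  fixes b :: real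
  assumes b: "-1 < b" and a: "0 \<le> a" and k: "a + real k < (real CARD('n::finite) + 1 + b) / 2"
  shows "\<exists>C>0. \<forall>j\<le>k. \<forall>U :: 'n point \<Rightarrow> real. U \<in> test_even \<longrightarrow>
    sq_int b (a + real k - real j) (nabla b j U) \<le> C * sq_int b a (nabla b k U)"
  using k
proof (induction k rule: induct_nat_012)
  case 0
  then show ?case by (intro exI[of _ 1]) auto
next
  case 1
  let ?H = "H_const CARD('n) 1 a b"
  have H: "0 < ?H" using H_const_pos[OF b a, of 1] 1 by simp
  have le: "sq_int b (a + 1 - real j) (nabla b j U) \<le> (1 + 1 / ?H\<^sup>2) * sq_int b a (nabla b 1 U)"
    if "j \<le> 1" and U: "U \<in> test_even" for j and U :: "'n point \<Rightarrow> real"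
  proof (cases "j = 0")
    case True
    have "?H\<^sup>2 * sq_int b (a + 1) U \<le> sq_int b a (nabla b 1 U)"
      using hardy_rellich_test[OF b a _ U, of 1] 1 by simp
    then have "sq_int b (a + 1) U \<le> 1 / ?H\<^sup>2 * sq_int b a (nabla b 1 U)" using H by (simp add: field_simps)
    then show ?thesis using True sq_int_nonneg[of b a "nabla b 1 U"] by (simp add: sq_int_nabla_0 distrib_right)
  next
    case False
    then have "j = 1" using that by simp
    then show ?thesis using H sq_int_nonneg[of b a "nabla b 1 U"] by (simp add: distrib_right)
  qed
  show ?case
    by (intro exI[of _ "1 + 1 / ?H\<^sup>2"] conjI allI impI) (use le in \<open>auto simp: add_pos_nonneg\<close>)
next
  case (ge2 k)
  obtain C where C: "0 < C" "\<And>j U. j \<le> k \<Longrightarrow> (U :: 'n point \<Rightarrow> real) \<in> test_even \<Longrightarrow>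
      sq_int b (a + real k - real j) (nabla b j U) \<le> C * sq_int b a (nabla b k U)"
    using ge2.IH(1) ge2.prems by auto
  let ?H = "H_const CARD('n) (Suc (Suc k)) a b"
  have H: "0 < ?H" using H_const_pos[OF b a] ge2.prems by simp
  define R where "R = (real CARD('n) + 1 + b + 2 * (a + real k)) * (real CARD('n) + 1 + b - 4 - 2 * (a + real k)) / 4"
  have sk: "0 \<le> a + real k" "2 * (a + real k) + 4 < real CARD('n) + 1 + b" using a ge2.prems by auto
  have R: "0 < R"
    unfolding R_def
    using b sk by (intro divide_pos_pos mult_pos_pos) auto
  \<comment> \<open>One summand for each of the cases j = 0, j = 1 and j \<ge> 2; adding them gives
    a common constant.\<close>
  let ?C = "1 / ?H\<^sup>2 + C / R + C"
  have le: "sq_int b (a + real (Suc (Suc k)) - real j) (nabla b j U) \<le> ?C * sq_int b a (nabla b (Suc (Suc k)) U)"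
    if j: "j \<le> Suc (Suc k)" and U: "U \<in> test_even" for j and U :: "'n point \<Rightarrow> real"
  proof -
    let ?N = "sq_int b a (nabla b (Suc (Suc k)) U)"
    have D: "Delta_b b U \<in> test_even" using U by (rule Delta_b_test_even)
    have N: "0 \<le> ?N" by (rule sq_int_nonneg)
    have t: "0 \<le> 1 / ?H\<^sup>2 * ?N" "0 \<le> C / R * ?N" "0 \<le> C * ?N" using N R C(1) by auto
    have L: "sq_int b (a + real k) (Delta_b b U) \<le> C * ?N"
      using C(2)[OF _ D, of 0] by (simp add: nabla_Suc_Suc sq_int_nabla_0)
    consider "j = 0" | "j = 1" | i where "j = Suc (Suc i)" by (metis One_nat_def not0_implies_Suc)
    then have "sq_int b (a + real (Suc (Suc k)) - real j) (nabla b j U) \<le> 1 / ?H\<^sup>2 * ?N + C / R * ?N + C * ?N"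
    proof cases
      case 1
      have "?H\<^sup>2 * sq_int b (a + real (Suc (Suc k))) U \<le> ?N"
        using hardy_rellich_test[OF b a ge2.prems U] .
      then have "sq_int b (a + real (Suc (Suc k))) U \<le> 1 / ?H\<^sup>2 * ?N" using H by (simp add: field_simps)
      then show ?thesis using 1 t by (simp add: sq_int_nabla_0)
    next
      case 2
      have "R * sq_int b (a + real k + 1) (grad U) \<le> C * ?N"
        using rellich_test(3)[OF b U sk] L unfolding R_def by linarith
      then have "sq_int b (a + real k + 1) (grad U) \<le> C / R * ?N" using R by (simp add: field_simps)
      moreover have "sq_int b (a + real (Suc (Suc k)) - real j) (nabla b j U) = sq_int b (a + real k + 1) (grad U)"
        using 2 by (simp add: sq_int_nabla_1 add_ac)
      ultimately show ?thesis using t by linarith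
    next
      case 3
      then have "sq_int b (a + real k - real i) (nabla b i (Delta_b b U)) \<le> C * ?N"
        using C(2)[OF _ D, of i] j by (simp add: nabla_Suc_Suc)
      moreover have "a + real (Suc (Suc k)) - real j = a + real k - real i" "nabla b j U = nabla b i (Delta_b b U)"
        using 3 by (simp_all add: nabla_Suc_Suc)
      ultimately have "sq_int b (a + real (Suc (Suc k)) - real j) (nabla b j U) \<le> C * ?N" by (simp only:)
      then show ?thesis using t by linarith
    qed
    then show ?thesis by (simp add: distrib_right)
  qed
  show ?case
    by (intro exI[of _ ?C] conjI allI impI le) (use H R C in \<open>auto intro!: add_nonneg_pos\<close>)
qed

section \<open>Closability of the operators\<close>

lemma abs_le_of_sum_eq:
  fixes p q c x :: real
  assumes "p + q = 2 * c * x" shows "\<bar>q\<bar> \<le> \<bar>p\<bar> + 2 * \<bar>c\<bar> * \<bar>x\<bar>"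
proof -
  have "\<bar>q\<bar> = \<bar>2 * c * x - p\<bar>" using assms by simp
  also have "\<dots> \<le> \<bar>p\<bar> + \<bar>2 * c * x\<bar>" by simp
  finally show ?thesis by (simp add: abs_mult)
qed

text \<open>Integration by parts moves the derivative from \<psi> m onto the fixed \<psi> l. What
  remains is bounded by |\<psi> m| times a constant K depending on l alone, which tends to
  0.\<close>

lemma closable_grad:
  fixes \<psi> :: "nat \<Rightarrow> 'n::finite point \<Rightarrow> real"
  assumes b: "-1 < b" and s: "2 * s < real CARD('n) + 1 + b" and \<psi>: "\<And>m. \<psi> m \<in> test_even"
    and null: "(\<lambda>m. wnorm b s (\<psi> m)) \<longlonglongrightarrow> 0"
  shows "(\<lambda>m. wip b (s - 1) (grad (\<psi> l)) (grad (\<psi> m))) \<longlonglongrightarrow> 0"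
proof (rule Lim_null_comparison)
  define K where "K = wnorm b (s - 2) (Delta_b b (\<psi> l)) + 2 * \<bar>s - 1\<bar> * wnorm b (s - 1) (grad (\<psi> l))"
  have D: "Delta_b b (\<psi> l) \<in> test_even" using \<psi> by (rule Delta_b_test_even)
  have *: "\<bar>wip b (s - 1) (grad (\<psi> m)) (grad (\<psi> l))\<bar> \<le> wnorm b s (\<psi> m) * K" for m
  proof -
    have "wip b (s - 1) (\<psi> m) (Delta_b b (\<psi> l)) + wip b (s - 1) (grad (\<psi> m)) (grad (\<psi> l)) =
        (LINT z|lborel. weight b (s - 1) z * (\<psi> m z * Delta_b b (\<psi> l) z + grad (\<psi> m) z \<bullet> grad (\<psi> l) z))"
      unfolding wip_def
      using s wip_bound(1)[OF test_L2w[OF b \<psi>] test_L2w[OF b D], of "s - 1" "s - 1" "s - 1"]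
        wip_bound(1)[OF grad_L2w[OF b \<psi>] grad_L2w[OF b \<psi>], of "s - 1" "s - 1" "s - 1"]
      by (simp add: distrib_left Bochner_Integration.integral_add)
    also have "\<dots> = 2 * (s - 1) * (LINT z|lborel. weight b s z * (\<psi> m z * (z \<bullet> grad (\<psi> l) z)))"
      using integral_by_parts[OF \<psi>[of m] \<psi>[of l] b, of "s - 1"] s by simp
    finally have "\<bar>wip b (s - 1) (grad (\<psi> m)) (grad (\<psi> l))\<bar> \<le> \<bar>wip b (s - 1) (\<psi> m) (Delta_b b (\<psi> l))\<bar>
       + 2 * \<bar>s - 1\<bar> * \<bar>LINT z|lborel. weight b s z * (\<psi> m z * (z \<bullet> grad (\<psi> l) z))\<bar>"
      by (rule abs_le_of_sum_eq)
    also have "\<dots> \<le> wnorm b s (\<psi> m) * wnorm b (s - 2) (Delta_b b (\<psi> l)) + 2 * \<bar>s - 1\<bar> * (wnorm b s (\<psi> m) * wnorm b (s - 1) (grad (\<psi> l)))"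
      using s by (intro add_mono mult_left_mono wip_bound(2) euler_pairing_bound test_L2w grad_L2w b \<psi> D) auto
    finally show ?thesis by (simp add: K_def algebra_simps)
  qed
  show "\<forall>\<^sub>F m in sequentially. norm (wip b (s - 1) (grad (\<psi> l)) (grad (\<psi> m))) \<le> wnorm b s (\<psi> m) * K"
    using * by (simp add: wip_commute[of b _ "grad (\<psi> l)"])
  show "(\<lambda>m. wnorm b s (\<psi> m) * K) \<longlonglongrightarrow> 0"
    using tendsto_mult_right[OF null, of K] by simp
qed

text \<open>The same identity read the other way, with U = Delta_b (\<psi> l) and V = \<psi> m: it
  expresses the pairing of the two Laplacians through the gradient of \<psi> m, which is the
  quantity known to tend to 0.\<close>

lemma closable_Delta_b:
  fixes \<psi> :: "nat \<Rightarrow> 'n::finite point \<Rightarrow> real"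
  assumes b: "-1 < b" and s: "2 * s < real CARD('n) + 1 + b" and \<psi>: "\<And>m. \<psi> m \<in> test_even"
    and null: "(\<lambda>m. wnorm b s (grad (\<psi> m))) \<longlonglongrightarrow> 0"
  shows "(\<lambda>m. wip b (s - 1) (Delta_b b (\<psi> l)) (Delta_b b (\<psi> m))) \<longlonglongrightarrow> 0"
proof (rule Lim_null_comparison)
  let ?\<Delta> = "\<lambda>m. Delta_b b (\<psi> m)"
  define K where "K = wnorm b (s - 2) (grad (?\<Delta> l)) + 2 * \<bar>s - 1\<bar> * wnorm b (s - 1) (?\<Delta> l)"
  have D: "?\<Delta> m \<in> test_even" for m using \<psi> by (rule Delta_b_test_even)
  have *: "\<bar>wip b (s - 1) (?\<Delta> l) (?\<Delta> m)\<bar> \<le> wnorm b s (grad (\<psi> m)) * K" for m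
  proof -
    have "wip b (s - 1) (?\<Delta> l) (?\<Delta> m) + wip b (s - 1) (grad (?\<Delta> l)) (grad (\<psi> m)) =
        (LINT z|lborel. weight b (s - 1) z * (?\<Delta> l z * ?\<Delta> m z + grad (?\<Delta> l) z \<bullet> grad (\<psi> m) z))"
      unfolding wip_def
      using s wip_bound(1)[OF test_L2w[OF b D] test_L2w[OF b D], of "s - 1" "s - 1" "s - 1"]
        wip_bound(1)[OF grad_L2w[OF b D] grad_L2w[OF b \<psi>], of "s - 1" "s - 1" "s - 1"]
      by (simp add: distrib_left Bochner_Integration.integral_add)
    also have "\<dots> = 2 * (s - 1) * (LINT z|lborel. weight b s z * (?\<Delta> l z * (z \<bullet> grad (\<psi> m) z)))"
      using integral_by_parts[OF D[of l] \<psi>[of m] b, of "s - 1"] s by simp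
    finally have "\<bar>wip b (s - 1) (?\<Delta> l) (?\<Delta> m)\<bar> \<le> \<bar>wip b (s - 1) (grad (?\<Delta> l)) (grad (\<psi> m))\<bar>
       + 2 * \<bar>s - 1\<bar> * \<bar>LINT z|lborel. weight b s z * (?\<Delta> l z * (z \<bullet> grad (\<psi> m) z))\<bar>"
      by (subst (asm) add.commute) (rule abs_le_of_sum_eq)
    also have "\<dots> \<le> wnorm b (s - 2) (grad (?\<Delta> l)) * wnorm b s (grad (\<psi> m)) + 2 * \<bar>s - 1\<bar> * (wnorm b (s - 1) (?\<Delta> l) * wnorm b s (grad (\<psi> m)))"
      using s by (intro add_mono mult_left_mono wip_bound(2) euler_pairing_bound test_L2w grad_L2w b \<psi> D) auto
    finally show ?thesis by (simp add: K_def algebra_simps)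
  qed
  show "\<forall>\<^sub>F m in sequentially. norm (wip b (s - 1) (?\<Delta> l) (?\<Delta> m)) \<le> wnorm b s (grad (\<psi> m)) * K"
    using * by simp
  show "(\<lambda>m. wnorm b s (grad (\<psi> m)) * K) \<longlonglongrightarrow> 0"
    using tendsto_mult_right[OF null, of K] by simp
qed

lemma nabla_wip_null:
  fixes \<psi> :: "nat \<Rightarrow> 'n::finite point \<Rightarrow> real"
  assumes b: "-1 < b" and "2 * s < real CARD('n) + 1 + b" and "\<And>m. \<psi> m \<in> test_even"
    and "(\<lambda>m. wnorm b s (nabla b j (\<psi> m))) \<longlonglongrightarrow> 0"
  shows "(\<lambda>m. wip b (s - 1) (nabla b (Suc j) (\<psi> l)) (nabla b (Suc j) (\<psi> m))) \<longlonglongrightarrow> 0"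
  using assms(2-)
proof (induction j arbitrary: \<psi> rule: induct_nat_012)
  case 0
  then show ?case
    using closable_grad[OF b, of s \<psi> l] by (simp add: wip_nabla_1 wnorm_def sq_int_nabla_0)
next
  case 1
  then show ?case
    using closable_Delta_b[OF b, of s \<psi> l] by (simp add: nabla_Suc_Suc wip_nabla_0 wnorm_def sq_int_nabla_1)
next
  case (ge2 j)
  show ?case
    unfolding nabla_Suc_Suc
    by (rule ge2.IH(1)) (use ge2.prems in \<open>auto simp: nabla_Suc_Suc intro: Delta_b_test_even\<close>)
qed

text \<open>One order at a time: norm convergence to 0 at order j gives weak convergence at order j
  + 1 along the sequence, and the Cauchy property upgrades it to norm convergence.\<close>

lemma nabla_closable:
  fixes \<psi> :: "nat \<Rightarrow> 'n::finite point \<Rightarrow> real"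
  assumes b: "-1 < b" and s: "2 * s < real CARD('n) + 1 + b" and \<psi>: "\<And>m. \<psi> m \<in> test_even"
    and null: "(\<lambda>m. wnorm b s (\<psi> m)) \<longlonglongrightarrow> 0"
    and cauchy: "\<And>j \<epsilon>. j \<le> k \<Longrightarrow> 0 < \<epsilon> \<Longrightarrow>
      \<exists>M. \<forall>m\<ge>M. \<forall>l\<ge>M. wnorm b (s - real j) (\<lambda>z. nabla b j (\<psi> m) z - nabla b j (\<psi> l) z) < \<epsilon>"
    and "j \<le> k"
  shows "(\<lambda>m. wnorm b (s - real j) (nabla b j (\<psi> m))) \<longlonglongrightarrow> 0"
  using \<open>j \<le> k\<close>
proof (induction j)
  case 0
  then show ?case using null by (simp add: wnorm_def sq_int_nabla_0)
next
  case (Suc j)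
  have e: "s - real (Suc j) = s - real j - 1" by simp
  show ?case
  proof (rule wnorm_null_of_wip_null)
    show "nabla b (Suc j) (\<psi> m) \<in> L2w b (s - real (Suc j))" for m
      using s by (intro nabla_L2w b \<psi>) auto
    show "\<exists>M. \<forall>m\<ge>M. \<forall>l\<ge>M. wnorm b (s - real (Suc j)) (\<lambda>z. nabla b (Suc j) (\<psi> m) z - nabla b (Suc j) (\<psi> l) z) < \<epsilon>"
      if "0 < \<epsilon>" for \<epsilon> using cauchy that Suc.prems by blast
    show "(\<lambda>m. wip b (s - real (Suc j)) (nabla b (Suc j) (\<psi> l)) (nabla b (Suc j) (\<psi> m))) \<longlonglongrightarrow> 0" for l
      unfolding e using s Suc by (intro nabla_wip_null b \<psi>) auto
  qed
qed

section \<open>The completion\<close>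

lemma L2w_tendsto_iff:
  "L2w_tendsto b s F G \<longleftrightarrow> (\<forall>m. F m \<in> L2w b s) \<and> G \<in> L2w b s \<and> (\<lambda>m. wnorm b s (\<lambda>z. F m z - G z)) \<longlonglongrightarrow> 0"
  by (simp add: L2w_tendsto_def wnorm_def)

lemma L2w_tendsto_add:
  assumes "L2w_tendsto b s F G" "L2w_tendsto b s F' G'"
  shows "L2w_tendsto b s (\<lambda>m z. F m z + F' m z) (\<lambda>z. G z + G' z)"
proof -
  have L: "\<And>m. F m \<in> L2w b s" "G \<in> L2w b s" "\<And>m. F' m \<in> L2w b s" "G' \<in> L2w b s"
    and lim: "(\<lambda>m. wnorm b s (\<lambda>z. F m z - G z)) \<longlonglongrightarrow> 0" "(\<lambda>m. wnorm b s (\<lambda>z. F' m z - G' z)) \<longlonglongrightarrow> 0"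
    using assms by (auto simp: L2w_tendsto_iff)
  have "wnorm b s (\<lambda>z. F m z + F' m z - (G z + G' z)) \<le> wnorm b s (\<lambda>z. F m z - G z) + wnorm b s (\<lambda>z. F' m z - G' z)" for m
    unfolding add_diff_add by (rule wnorm_triangle[OF L2w_diff[OF L(1,2)] L2w_diff[OF L(3,4)]])
  then have "\<forall>m. norm (wnorm b s (\<lambda>z. F m z + F' m z - (G z + G' z))) \<le> wnorm b s (\<lambda>z. F m z - G z) + wnorm b s (\<lambda>z. F' m z - G' z)"
    by (simp add: wnorm_nonneg)
  from Lim_null_comparison[OF always_eventually[OF this] tendsto_add_zero[OF lim]]
  have "(\<lambda>m. wnorm b s (\<lambda>z. F m z + F' m z - (G z + G' z))) \<longlonglongrightarrow> 0" .
  then show ?thesis using L by (auto simp: L2w_tendsto_iff intro: L2w_add)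
qed

lemma L2w_tendsto_cmult:
  assumes "L2w_tendsto b s F G"
  shows "L2w_tendsto b s (\<lambda>m z. c *\<^sub>R F m z) (\<lambda>z. c *\<^sub>R G z)"
  using assms tendsto_mult_right[of "\<lambda>m. wnorm b s (\<lambda>z. F m z - G z)" 0 sequentially "\<bar>c\<bar>"]
  by (auto simp: L2w_tendsto_iff L2w_cmult scaleR_diff_right[symmetric] wnorm_cmult mult.commute)

lemma L2w_tendsto_unique:
  assumes "L2w_tendsto b s F G" "L2w_tendsto b s F G'"
  shows "AE z in lborel. G z = G' z"
proof -
  have L: "G \<in> L2w b s" "G' \<in> L2w b s" using assms by (auto simp: L2w_tendsto_iff)
  \<comment> \<open>The difference of the sequence with itself is the zero sequence, so the norm of
    the difference of the limits is a constant sequence that tends to 0.\<close>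
  have "L2w_tendsto b s (\<lambda>m z. F m z + (-1) *\<^sub>R F m z) (\<lambda>z. G z + (-1) *\<^sub>R G' z)"
    by (intro L2w_tendsto_add L2w_tendsto_cmult assms)
  then have "(\<lambda>m::nat. wnorm b s (\<lambda>z. 0 - (G z - G' z))) \<longlonglongrightarrow> 0" by (simp add: L2w_tendsto_iff)
  then have "wnorm b s (\<lambda>z. G z - G' z) = 0"
    using wnorm_minus_commute[of b s "\<lambda>z. 0" "\<lambda>z. G z - G' z"] by (simp add: LIMSEQ_const_iff)
  from wnorm_zero_imp_AE[OF L2w_diff[OF L] this] show ?thesis by eventually_elim simp
qed

lemma L2w_tendsto_wnorm:
  assumes "L2w_tendsto b s F G" shows "(\<lambda>m. wnorm b s (F m)) \<longlonglongrightarrow> wnorm b s G"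
  using assms by (intro wnorm_tendsto) (auto simp: L2w_tendsto_iff)

section \<open>Approximating sequences, treated order by order\<close>

definition wCauchy :: "real \<Rightarrow> real \<Rightarrow> (nat \<Rightarrow> 'n::finite point \<Rightarrow> 'b::euclidean_space) \<Rightarrow> bool" where
  "wCauchy b s X \<longleftrightarrow> (\<forall>\<epsilon>>0. \<exists>M. \<forall>m\<ge>M. \<forall>l\<ge>M. wnorm b s (\<lambda>z. X m z - X l z) < \<epsilon>)"

lemma wCauchy_add:
  assumes X: "\<And>m. X m \<in> L2w b s" "wCauchy b s X" and Y: "\<And>m. Y m \<in> L2w b s" "wCauchy b s Y"
  shows "wCauchy b s (\<lambda>m z. X m z + Y m z)"
  unfolding wCauchy_def
proof (intro allI impI)
  fix \<epsilon> :: real assume "0 < \<epsilon>"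
  then obtain M N where M: "\<And>m l. M \<le> m \<Longrightarrow> M \<le> l \<Longrightarrow> wnorm b s (\<lambda>z. X m z - X l z) < \<epsilon> / 2"
    and N: "\<And>m l. N \<le> m \<Longrightarrow> N \<le> l \<Longrightarrow> wnorm b s (\<lambda>z. Y m z - Y l z) < \<epsilon> / 2"
    using X(2) Y(2) unfolding wCauchy_def by (meson half_gt_zero)
  have "wnorm b s (\<lambda>z. X m z + Y m z - (X l z + Y l z)) < \<epsilon>" if "max M N \<le> m" "max M N \<le> l" for m l
    using wnorm_triangle[OF L2w_diff[OF X(1) X(1)] L2w_diff[OF Y(1) Y(1)], of m l m l] M[of m l] N[of m l] that
    unfolding add_diff_add by auto
  then show "\<exists>M. \<forall>m\<ge>M. \<forall>l\<ge>M. wnorm b s (\<lambda>z. X m z + Y m z - (X l z + Y l z)) < \<epsilon>" by blast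
qed

lemma wCauchy_cmult:
  assumes "wCauchy b s X" shows "wCauchy b s (\<lambda>m z. c *\<^sub>R X m z)"
  unfolding wCauchy_def
proof (intro allI impI)
  fix \<epsilon> :: real assume "0 < \<epsilon>"
  then have "0 < \<epsilon> / (\<bar>c\<bar> + 1)" by (intro divide_pos_pos) auto
  then obtain M where M: "\<And>m l. M \<le> m \<Longrightarrow> M \<le> l \<Longrightarrow> wnorm b s (\<lambda>z. X m z - X l z) < \<epsilon> / (\<bar>c\<bar> + 1)"
    using assms unfolding wCauchy_def by blast
  have "wnorm b s (\<lambda>z. c *\<^sub>R X m z - c *\<^sub>R X l z) < \<epsilon>" if "M \<le> m" "M \<le> l" for m l
  proof -
    have "\<bar>c\<bar> * wnorm b s (\<lambda>z. X m z - X l z) \<le> (\<bar>c\<bar> + 1) * wnorm b s (\<lambda>z. X m z - X l z)"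
      by (intro mult_right_mono wnorm_nonneg) simp
    also have "\<dots> < \<epsilon>" using M[OF that] by (simp add: field_simps)
    finally show ?thesis by (simp add: scaleR_diff_right[symmetric] wnorm_cmult)
  qed
  then show "\<exists>M. \<forall>m\<ge>M. \<forall>l\<ge>M. wnorm b s (\<lambda>z. c *\<^sub>R X m z - c *\<^sub>R X l z) < \<epsilon>" by blast
qed

lemma triple_eq_L2_set: "triple k a b G = L2_set (\<lambda>j. wnorm b (a + real k - real j) (G j)) {..k}"
  by (simp add: triple_def L2_set_def wnorm_square)

lemma nabla_diff:
  assumes "U \<in> test_even" "V \<in> test_even"
  shows "nabla b j (\<lambda>z. U z - V z) z = nabla b j U z - nabla b j V z"
  using nabla_add[OF assms(1) test_even_cmult[OF assms(2), of "-1"], of b j z] nabla_cmult[OF assms(2), of b j "-1" z]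
  by simp

text \<open>The triple norm is a Euclidean combination of k + 1 weighted norms, so it lies between
  each of them and their sum; being Cauchy for it therefore means being Cauchy at every
  order.\<close>

lemma approximates_iff:
  "approximates k a b \<phi> U \<longleftrightarrow> (\<forall>m. \<phi> m \<in> test_even) \<and>
     (\<forall>j\<le>k. wCauchy b (a + real k - real j) (\<lambda>m. nabla b j (\<phi> m))) \<and> L2w_tendsto b (a + real k) \<phi> U"
proof (cases "\<forall>m. \<phi> m \<in> test_even")
  case True
  let ?w = "\<lambda>j m l. wnorm b (a + real k - real j) (\<lambda>z. nabla b j (\<phi> m) z - nabla b j (\<phi> l) z)"
  have eq: "triple_norm_test k a b (\<lambda>z. \<phi> m z - \<phi> l z) = L2_set (\<lambda>j. ?w j m l) {..k}" for m l
    using True by (simp add: triple_norm_test_def triple_eq_L2_set wnorm_def sq_int_def nabla_diff)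
  have "(\<forall>\<epsilon>>0. \<exists>M. \<forall>m\<ge>M. \<forall>l\<ge>M. L2_set (\<lambda>j. ?w j m l) {..k} < \<epsilon>) \<longleftrightarrow>
      (\<forall>j\<le>k. wCauchy b (a + real k - real j) (\<lambda>m. nabla b j (\<phi> m)))"
  proof (intro iffI allI impI)
    fix j assume *: "\<forall>\<epsilon>>0. \<exists>M. \<forall>m\<ge>M. \<forall>l\<ge>M. L2_set (\<lambda>j. ?w j m l) {..k} < \<epsilon>" and "j \<le> k"
    then have "?w j m l \<le> L2_set (\<lambda>j. ?w j m l) {..k}" for m l
      by (intro member_le_L2_set) auto
    then show "wCauchy b (a + real k - real j) (\<lambda>m. nabla b j (\<phi> m))"
      unfolding wCauchy_def using * by (meson le_less_trans)
  next
    fix \<epsilon> :: real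
    assume *: "\<forall>j\<le>k. wCauchy b (a + real k - real j) (\<lambda>m. nabla b j (\<phi> m))" and "0 < \<epsilon>"
    then have \<delta>: "0 < \<epsilon> / (real k + 1)" by simp
    have "\<forall>j\<in>{..k}. \<exists>M. \<forall>m\<ge>M. \<forall>l\<ge>M. ?w j m l < \<epsilon> / (real k + 1)"
      using * \<delta> unfolding wCauchy_def by simp
    from bchoice[OF this] obtain M
      where M: "\<forall>j\<in>{..k}. \<forall>m\<ge>M j. \<forall>l\<ge>M j. ?w j m l < \<epsilon> / (real k + 1)" by (elim exE)
    \<comment> \<open>The sum of the finitely many thresholds M j serves as a common one.\<close>
    have "L2_set (\<lambda>j. ?w j m l) {..k} < \<epsilon>" if ml: "sum M {..k} \<le> m" "sum M {..k} \<le> l" for m l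
    proof -
      have "L2_set (\<lambda>j. ?w j m l) {..k} \<le> (\<Sum>j\<le>k. ?w j m l)"
        by (intro L2_set_le_sum wnorm_nonneg)
      also have "\<dots> < (\<Sum>j\<le>k. \<epsilon> / (real k + 1))"
      proof (rule sum_strict_mono)
        fix j assume j: "j \<in> {..k}"
        then have "M j \<le> sum M {..k}" by (intro member_le_sum) auto
        then show "?w j m l < \<epsilon> / (real k + 1)" using M j ml by (meson order_trans)
      qed auto
      also have "\<dots> = \<epsilon>" by (simp add: field_simps)
      finally show ?thesis .
    qed
    then show "\<exists>M. \<forall>m\<ge>M. \<forall>l\<ge>M. L2_set (\<lambda>j. ?w j m l) {..k} < \<epsilon>" by blast
  qed
  then show ?thesis unfolding approximates_def eq by blast
qed (auto simp: approximates_def)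

text \<open>The choice in \<open>nabla_D\<close> guarantees convergence along some sequence \<psi>
  only. For any other \<phi> approximating the same U, the difference \<theta> = \<phi> - \<psi>
  tends to 0 and is Cauchy at every order, so closability sends its derivatives to 0 and \<phi> has
  the same limit.\<close>

lemma nabla_D_tendsto:
  fixes U :: "'n::finite point \<Rightarrow> real"
  assumes b: "-1 < b" and k: "2 * (a + real k) < real CARD('n) + 1 + b"
    and \<phi>: "approximates k a b \<phi> U" and j: "j \<le> k"
  shows "L2w_tendsto b (a + real k - real j) (\<lambda>m. nabla b j (\<phi> m)) (nabla_D k a b j U)"
proof -
  let ?s = "a + real k - real j"
  have L: "nabla b j V \<in> L2w b (a + real k - real j)" if "V \<in> test_even" for V :: "'n point \<Rightarrow> real" and j
    by (rule nabla_L2w[OF b that]) (use k in auto)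
  \<comment> \<open>Completeness supplies a witness, without which the choice operator would say
    nothing.\<close>
  have "\<exists>V \<psi>. approximates k a b \<psi> U \<and> L2w_tendsto b ?s (\<lambda>m. nabla b j (\<psi> m)) V"
  proof -
    have "\<exists>V\<in>L2w b ?s. (\<lambda>m. wnorm b ?s (\<lambda>z. nabla b j (\<phi> m) z - V z)) \<longlonglongrightarrow> 0"
      using \<phi> j by (intro L2w_complete L) (auto simp: approximates_iff wCauchy_def)
    then obtain V where "V \<in> L2w b ?s" "(\<lambda>m. wnorm b ?s (\<lambda>z. nabla b j (\<phi> m) z - V z)) \<longlonglongrightarrow> 0" by blast
    moreover have "\<phi> m \<in> test_even" for m using \<phi> by (simp add: approximates_iff)
    ultimately have "L2w_tendsto b ?s (\<lambda>m. nabla b j (\<phi> m)) V" using L by (simp add: L2w_tendsto_iff)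
    with \<phi> show ?thesis by blast
  qed
  then have "\<exists>\<psi>. approximates k a b \<psi> U \<and> L2w_tendsto b ?s (\<lambda>m. nabla b j (\<psi> m)) (nabla_D k a b j U)"
    unfolding nabla_D_def by (rule someI_ex)
  then obtain \<psi> where \<psi>: "approximates k a b \<psi> U" and lim: "L2w_tendsto b ?s (\<lambda>m. nabla b j (\<psi> m)) (nabla_D k a b j U)"
    by blast
  have t: "\<phi> m \<in> test_even" "\<psi> m \<in> test_even" for m using \<phi> \<psi> by (auto simp: approximates_iff)
  define \<theta> where "\<theta> m z = \<phi> m z + (-1) * \<psi> m z" for m z
  have \<theta>: "\<theta> m \<in> test_even" for m
    unfolding \<theta>_def[abs_def] by (intro test_even_add test_even_cmult t)
  have n\<theta>: "nabla b i (\<theta> m) = (\<lambda>z. nabla b i (\<phi> m) z + (-1) *\<^sub>R nabla b i (\<psi> m) z)" for i m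
    unfolding \<theta>_def[abs_def] by (intro ext) (simp only: t nabla_add test_even_cmult nabla_cmult)
  have "L2w_tendsto b (a + real k) \<theta> (\<lambda>z. U z + (-1) *\<^sub>R U z)"
    unfolding \<theta>_def[abs_def] using L2w_tendsto_add[OF _ L2w_tendsto_cmult, of b "a + real k" \<phi> U \<psi> U "-1"] \<phi> \<psi>
    by (simp add: approximates_iff)
  then have "(\<lambda>m. wnorm b (a + real k) (\<theta> m)) \<longlonglongrightarrow> 0" by (simp add: L2w_tendsto_iff)
  moreover have "wCauchy b (a + real k - real i) (\<lambda>m. nabla b i (\<theta> m))" if "i \<le> k" for i
    unfolding n\<theta> using \<phi> \<psi> that t
    by (intro wCauchy_add wCauchy_cmult L2w_cmult L) (auto simp: approximates_iff)
  ultimately have "(\<lambda>m. wnorm b ?s (nabla b j (\<theta> m))) \<longlonglongrightarrow> 0"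
    using k j by (intro nabla_closable[OF b _ \<theta>]) (auto simp: wCauchy_def)
  then have "L2w_tendsto b ?s (\<lambda>m. nabla b j (\<theta> m)) (\<lambda>z. 0)"
    using L2w_cmult[OF L[OF t(1)], of 0] by (simp add: L2w_tendsto_iff L \<theta>)
  from L2w_tendsto_add[OF this lim] show ?thesis by (simp add: n\<theta>)
qed

lemma approximates_add:
  assumes b: "-1 < b" and k: "2 * (a + real k) < real CARD('n::finite) + 1 + b"
    and "approximates k a b \<phi> (U :: 'n point \<Rightarrow> real)" "approximates k a b \<psi> V"
  shows "approximates k a b (\<lambda>m z. \<phi> m z + \<psi> m z) (\<lambda>z. U z + V z)"
proof -
  have t: "\<phi> m \<in> test_even" "\<psi> m \<in> test_even" for m using assms by (auto simp: approximates_iff)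
  have L: "nabla b j W \<in> L2w b (a + real k - real j)" if "W \<in> test_even" for W :: "'n point \<Rightarrow> real" and j
    by (rule nabla_L2w[OF b that]) (use k in auto)
  have "nabla b j (\<lambda>z. \<phi> m z + \<psi> m z) = (\<lambda>z. nabla b j (\<phi> m) z + nabla b j (\<psi> m) z)" for j m
    by (intro ext nabla_add t)
  then show ?thesis
    using assms(3,4) by (auto simp: approximates_iff intro!: test_even_add wCauchy_add L2w_tendsto_add L)
qed

lemma approximates_cmult:
  assumes "approximates k a b \<phi> U"
  shows "approximates k a b (\<lambda>m z. c * \<phi> m z) (\<lambda>z. c * U z)"
proof -
  have t: "\<phi> m \<in> test_even" for m using assms by (auto simp: approximates_iff)
  have "nabla b j (\<lambda>z. c * \<phi> m z) = (\<lambda>z. c *\<^sub>R nabla b j (\<phi> m) z)" for j m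
    by (intro ext nabla_cmult t)
  then show ?thesis
    using assms L2w_tendsto_cmult[of b "a + real k" \<phi> U c]
    by (auto simp: approximates_iff intro!: test_even_cmult wCauchy_cmult)
qed

context
  fixes k :: nat and a b :: real
  assumes b: "-1 < b" and a: "0 \<le> a" and k: "2 * (a + real k) < real CARD('n::finite) + 1 + b"
begin

text \<open>Representatives of the derivatives are chosen separately for each function, so linearity
  can hold only almost everywhere; it follows from uniqueness of limits along the combined
  sequences.\<close>

lemma nabla_D_AE_linear:
  fixes U V :: "'n point \<Rightarrow> real"
  assumes U: "U \<in> D_e k a b" and V: "V \<in> D_e k a b" and j: "j \<le> k"
  shows "AE z in lborel. nabla_D k a b j (\<lambda>z. U z + V z) z = nabla_D k a b j U z + nabla_D k a b j V z"
    and "AE z in lborel. nabla_D k a b j (\<lambda>z. c * U z) z = c *\<^sub>R nabla_D k a b j U z"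
proof -
  obtain \<phi> \<psi> where \<phi>: "approximates k a b \<phi> U" and \<psi>: "approximates k a b \<psi> V"
    using U V by (auto simp: D_e_def)
  have t: "\<phi> m \<in> test_even" "\<psi> m \<in> test_even" for m using \<phi> \<psi> by (auto simp: approximates_iff)
  let ?s = "a + real k - real j"
  note lim = nabla_D_tendsto[OF b k _ j]
  have n: "nabla b j (\<lambda>z. \<phi> m z + \<psi> m z) = (\<lambda>z. nabla b j (\<phi> m) z + nabla b j (\<psi> m) z)"
    "nabla b j (\<lambda>z. c * \<phi> m z) = (\<lambda>z. c *\<^sub>R nabla b j (\<phi> m) z)" for m
    by (intro ext nabla_add nabla_cmult t)+
  show "AE z in lborel. nabla_D k a b j (\<lambda>z. U z + V z) z = nabla_D k a b j U z + nabla_D k a b j V z"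
  proof (rule L2w_tendsto_unique)
    show "L2w_tendsto b ?s (\<lambda>m. nabla b j (\<lambda>z. \<phi> m z + \<psi> m z)) (nabla_D k a b j (\<lambda>z. U z + V z))"
      by (intro lim approximates_add b k \<phi> \<psi>)
    show "L2w_tendsto b ?s (\<lambda>m. nabla b j (\<lambda>z. \<phi> m z + \<psi> m z)) (\<lambda>z. nabla_D k a b j U z + nabla_D k a b j V z)"
      unfolding n by (rule L2w_tendsto_add[OF lim[OF \<phi>] lim[OF \<psi>]])
  qed
  show "AE z in lborel. nabla_D k a b j (\<lambda>z. c * U z) z = c *\<^sub>R nabla_D k a b j U z"
  proof (rule L2w_tendsto_unique)
    show "L2w_tendsto b ?s (\<lambda>m. nabla b j (\<lambda>z. c * \<phi> m z)) (nabla_D k a b j (\<lambda>z. c * U z))"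
      by (intro lim approximates_cmult \<phi>)
    show "L2w_tendsto b ?s (\<lambda>m. nabla b j (\<lambda>z. c * \<phi> m z)) (\<lambda>z. c *\<^sub>R nabla_D k a b j U z)"
      unfolding n by (rule L2w_tendsto_cmult[OF lim[OF \<phi>]])
  qed
qed

lemma nabla_D_L2w:
  fixes U :: "'n point \<Rightarrow> real"
  assumes "U \<in> D_e k a b" "j \<le> k" shows "nabla_D k a b j U \<in> L2w b (a + real k - real j)"
  using assms nabla_D_tendsto[OF b k _ assms(2)] by (auto simp: D_e_def L2w_tendsto_iff)

lemma D_e_L2w:
  fixes U :: "'n point \<Rightarrow> real"
  assumes "U \<in> D_e k a b" shows "U \<in> L2w b (a + real k)"
  using assms by (auto simp: D_e_def approximates_iff L2w_tendsto_iff)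

text \<open>A null function is also approximated by the zero sequence, whose derivatives vanish.
  This makes the top norm well defined on classes.\<close>

lemma nabla_D_AE_zero:
  fixes U :: "'n point \<Rightarrow> real"
  assumes U: "U \<in> D_e k a b" and ae: "AE z in lborel. U z = 0" and j: "j \<le> k"
  shows "AE z in lborel. nabla_D k a b j U z = 0"
proof -
  obtain \<phi> where \<phi>: "approximates k a b \<phi> U" using U by (auto simp: D_e_def)
  have L: "U \<in> L2w b (a + real k)" using U by (rule D_e_L2w)
  have "approximates k a b (\<lambda>m z. 0 * \<phi> m z) (\<lambda>z. 0 * U z)" using \<phi> by (rule approximates_cmult)
  moreover have "wnorm b (a + real k) (\<lambda>z. 0 - U z) = wnorm b (a + real k) (\<lambda>z. 0 - 0 * U z)"
    using L2wD(1)[OF L] ae by (intro wnorm_cong_AE) auto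
  ultimately have 0: "approximates k a b (\<lambda>m z. 0) U"
    using L by (auto simp: approximates_iff L2w_tendsto_iff)
  \<comment> \<open>The zero function is written as 0 times a test function, so that homogeneity of
    \<open>nabla\<close> evaluates it.\<close>
  have "L2w_tendsto b (a + real k - real j) (\<lambda>m. nabla b j (\<lambda>z. 0 * \<phi> 0 z)) (nabla_D k a b j U)"
    using nabla_D_tendsto[OF b k 0 j] by simp
  moreover have "L2w_tendsto b (a + real k - real j) (\<lambda>m. nabla b j (\<lambda>z. 0 * \<phi> 0 z)) (\<lambda>z. 0)"
  proof -
    have "\<phi> 0 \<in> test_even" using \<phi> by (auto simp: approximates_iff)
    then have "nabla b j (\<lambda>z. 0 * \<phi> 0 z) = (\<lambda>z. 0)"
      by (intro ext) (simp only: nabla_cmult scaleR_zero_left)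
    then show ?thesis by (simp add: L2w_tendsto_iff L2w_def wnorm_def sq_int_def)
  qed
  ultimately show ?thesis by (rule L2w_tendsto_unique)
qed

text \<open>Transfers an estimate between two orders from test functions to the completion: the same
  approximating sequence serves both orders, so the inequality passes to the limit.\<close>

lemma sq_int_nabla_D_mono:
  fixes U :: "'n point \<Rightarrow> real"
  assumes U: "U \<in> D_e k a b"
    and le: "\<And>\<phi> :: 'n point \<Rightarrow> real. \<phi> \<in> test_even \<Longrightarrow> c * sq_int b (a + real k - real j) (nabla b j \<phi>) \<le> sq_int b a (nabla b k \<phi>)"
    and j: "j \<le> k"
  shows "c * sq_int b (a + real k - real j) (nabla_D k a b j U) \<le> sq_int b a (nabla_D k a b k U)"
proof -
  obtain \<phi> where \<phi>: "approximates k a b \<phi> U" using U by (auto simp: D_e_def)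
  have lim: "(\<lambda>m. sq_int b (a + real k - real i) (nabla b i (\<phi> m))) \<longlonglongrightarrow> sq_int b (a + real k - real i) (nabla_D k a b i U)"
    if "i \<le> k" for i
    using tendsto_power[OF L2w_tendsto_wnorm[OF nabla_D_tendsto[OF b k \<phi> that]], of 2] by (simp add: wnorm_square)
  show ?thesis
  proof (rule LIMSEQ_le)
    show "(\<lambda>m. c * sq_int b (a + real k - real j) (nabla b j (\<phi> m))) \<longlonglongrightarrow> c * sq_int b (a + real k - real j) (nabla_D k a b j U)"
      by (intro tendsto_intros lim j)
    show "(\<lambda>m. sq_int b a (nabla b k (\<phi> m))) \<longlonglongrightarrow> sq_int b a (nabla_D k a b k U)"
      using lim[of k] by simp
    show "\<exists>N. \<forall>m\<ge>N. c * sq_int b (a + real k - real j) (nabla b j (\<phi> m)) \<le> sq_int b a (nabla b k (\<phi> m))"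
      using \<phi> le by (auto simp: approximates_iff)
  qed
qed

lemma hardy_rellich_D:
  fixes U :: "'n point \<Rightarrow> real"
  assumes U: "U \<in> D_e k a b"
  shows "(H_const CARD('n) k a b)\<^sup>2 * sq_int b (a + real k) U \<le> sq_int b a (nabla_D k a b k U)"
proof -
  obtain \<phi> where \<phi>: "approximates k a b \<phi> U" using U by (auto simp: D_e_def)
  have "(\<lambda>m. sq_int b (a + real k) (\<phi> m)) \<longlonglongrightarrow> sq_int b (a + real k) U"
    using \<phi> tendsto_power[OF L2w_tendsto_wnorm, of b "a + real k" \<phi> U 2]
    by (simp add: wnorm_square approximates_iff)
  moreover have "(\<lambda>m. sq_int b (a + real k) (\<phi> m)) \<longlonglongrightarrow> sq_int b (a + real k) (nabla_D k a b 0 U)"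
    using tendsto_power[OF L2w_tendsto_wnorm[OF nabla_D_tendsto[OF b k \<phi>]], of 0 2]
    by (simp add: wnorm_square sq_int_nabla_0)
  \<comment> \<open>The derivative of order 0 is a chosen pair-valued representative and not U
    itself, so the two norms are identified as limits of one sequence.\<close>
  ultimately have eq: "sq_int b (a + real k) U = sq_int b (a + real k) (nabla_D k a b 0 U)"
    by (rule LIMSEQ_unique)
  have "(H_const CARD('n) k a b)\<^sup>2 * sq_int b (a + real k - real 0) (nabla_D k a b 0 U) \<le> sq_int b a (nabla_D k a b k U)"
    using k by (intro sq_int_nabla_D_mono U) (auto simp: sq_int_nabla_0 intro!: hardy_rellich_test b a)
  then show ?thesis by (simp add: eq)
qed

text \<open>The bilinear form is the weighted pairing of the derivatives of order k. Definiteness is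
  the Hardy-Rellich inequality with its positive constant; bilinearity rests on almost-everywhere
  linearity, which the integral does not distinguish from linearity.\<close>

lemma hilbertian_top_norm: "hilbertian_norm_on (D_e k a b :: ('n point \<Rightarrow> real) set) (top_norm k a b)"
  unfolding hilbertian_norm_on_def
proof (intro conjI ballI allI exI[of _ "\<lambda>U V. wip b a (nabla_D k a b k U) (nabla_D k a b k V)"])
  show add: "(\<lambda>z. U z + V z) \<in> D_e k a b" if UV: "U \<in> D_e k a b" "V \<in> D_e k a b" for U V :: "'n point \<Rightarrow> real"
  proof -
    obtain \<phi> \<psi> where "approximates k a b \<phi> U" "approximates k a b \<psi> V"
      using UV by (auto simp: D_e_def)
    from approximates_add[OF b k this] show ?thesis unfolding D_e_def by blast
  qed
  show cm: "(\<lambda>z. c * U z) \<in> D_e k a b" if U: "U \<in> D_e k a b" for c and U :: "'n point \<Rightarrow> real"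
  proof -
    obtain \<phi> where "approximates k a b \<phi> U" using U by (auto simp: D_e_def)
    from approximates_cmult[OF this] show ?thesis unfolding D_e_def by blast
  qed
  have "nabla b j (\<lambda>z::'n point. 0) = (\<lambda>z. 0)" for j
    using nabla_cmult[of "\<lambda>z::'n point. 0" b j 0] by (auto simp: test_even_iff smooth_const supp_in_def)
  then have "approximates k a b (\<lambda>m z. 0) (\<lambda>z::'n point. 0)"
    by (auto simp: approximates_iff wCauchy_def L2w_tendsto_iff test_even_iff smooth_const supp_in_def L2w_def wnorm_def sq_int_def)
  then show "(\<lambda>z::'n point. 0) \<in> D_e k a b" by (auto simp: D_e_def)
  have L: "nabla_D k a b k U \<in> L2w b a" if "U \<in> D_e k a b" for U :: "'n point \<Rightarrow> real"
    using nabla_D_L2w[OF that, of k] by simp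
  have cong: "wip b a F H = wip b a G H"
    if "F \<in> L2w b a" "G \<in> L2w b a" "H \<in> L2w b a" "AE z in lborel. F z = G z" for F G H :: "'n point \<Rightarrow> real \<times> 'n point"
  proof -
    note [measurable] = L2wD(1)[OF that(1)] L2wD(1)[OF that(2)] L2wD(1)[OF that(3)]
    show ?thesis unfolding wip_def by (rule integral_cong_AE) (use that(4) in auto)
  qed
  show "wip b a (nabla_D k a b k U) (nabla_D k a b k V) = wip b a (nabla_D k a b k V) (nabla_D k a b k U)"
    for U V :: "'n point \<Rightarrow> real" by (rule wip_commute)
  show "wip b a (nabla_D k a b k (\<lambda>z. U z + V z)) (nabla_D k a b k W) =
      wip b a (nabla_D k a b k U) (nabla_D k a b k W) + wip b a (nabla_D k a b k V) (nabla_D k a b k W)"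
    if U: "U \<in> D_e k a b" and V: "V \<in> D_e k a b" and W: "W \<in> D_e k a b" for U V W :: "'n point \<Rightarrow> real"
    unfolding wip_add_left[OF L[OF U] L[OF V] L[OF W], symmetric]
    by (intro cong nabla_D_AE_linear L2w_add L add U V W order_refl)
  show "wip b a (nabla_D k a b k (\<lambda>z. c * U z)) (nabla_D k a b k V) = c * wip b a (nabla_D k a b k U) (nabla_D k a b k V)"
    if U: "U \<in> D_e k a b" and V: "V \<in> D_e k a b" for c and U V :: "'n point \<Rightarrow> real"
    unfolding wip_cmult_left[symmetric]
    by (intro cong nabla_D_AE_linear(2)[OF U U] L2w_cmult L cm U V order_refl)
  show "0 \<le> wip b a (nabla_D k a b k U) (nabla_D k a b k U)" for U :: "'n point \<Rightarrow> real"
    by (simp add: sq_int_eq_wip[symmetric] sq_int_nonneg)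
  show "top_norm k a b U = sqrt (wip b a (nabla_D k a b k U) (nabla_D k a b k U))" for U :: "'n point \<Rightarrow> real"
    by (simp add: top_norm_def sq_int_eq_wip)
  show "wip b a (nabla_D k a b k U) (nabla_D k a b k U) = 0 \<longleftrightarrow> (AE z in lborel. U z = 0)"
    if U: "U \<in> D_e k a b" for U :: "'n point \<Rightarrow> real"
  proof
    assume "wip b a (nabla_D k a b k U) (nabla_D k a b k U) = 0"
    then have "(H_const CARD('n) k a b)\<^sup>2 * sq_int b (a + real k) U \<le> 0"
      using hardy_rellich_D[OF U] by (simp add: sq_int_eq_wip)
    moreover have "0 < H_const CARD('n) k a b" using k by (intro H_const_pos b a) simp
    ultimately have "sq_int b (a + real k) U = 0"
      using sq_int_nonneg[of b "a + real k" U] by (simp add: mult_le_0_iff)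
    then show "AE z in lborel. U z = 0"
      using D_e_L2w[OF U] by (intro wnorm_zero_imp_AE) (auto simp: wnorm_def)
  next
    assume "AE z in lborel. U z = 0"
    from nabla_D_AE_zero[OF U this order_refl] have "AE z in lborel. nabla_D k a b k U z = 0" .
    then have "wip b a (nabla_D k a b k U) (nabla_D k a b k U) = wip b a (\<lambda>z. 0) (nabla_D k a b k U)"
      by (intro cong L[OF U]) (auto simp: L2w_def)
    then show "wip b a (nabla_D k a b k U) (nabla_D k a b k U) = 0" by (simp add: wip_def)
  qed
qed

lemma equivalent_top_norm:
  "equivalent_norms_on (D_e k a b :: ('n point \<Rightarrow> real) set) (top_norm k a b) (triple_norm k a b)"
proof -
  obtain C where C: "0 < C" "\<And>j U. j \<le> k \<Longrightarrow> (U :: 'n point \<Rightarrow> real) \<in> test_even \<Longrightarrow>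
      sq_int b (a + real k - real j) (nabla b j U) \<le> C * sq_int b a (nabla b k U)"
    using nabla_test_bound[OF b a, of k, where 'n='n] k by auto
  \<comment> \<open>Each of the k + 1 squared terms of the triple norm is at most C times the top
    one. In the other direction the constant is 1, the top term being one of the summands.\<close>
  define c where "c = 1 / sqrt ((real k + 1) * C)"
  have c: "0 < c" using C(1) by (simp add: c_def)
  have lower: "c * triple_norm k a b U \<le> top_norm k a b U" if U: "U \<in> D_e k a b" for U :: "'n point \<Rightarrow> real"
  proof -
    let ?T = "sq_int b a (nabla_D k a b k U)"
    have "sq_int b (a + real k - real j) (nabla_D k a b j U) \<le> C * ?T" if "j \<le> k" for j
      using sq_int_nabla_D_mono[OF U, of "1 / C" j] C that by (simp add: field_simps)
    then have "(\<Sum>j\<le>k. sq_int b (a + real k - real j) (nabla_D k a b j U)) \<le> (\<Sum>j\<le>k. C * ?T)"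
      by (intro sum_mono) auto
    then have "triple_norm k a b U \<le> sqrt ((real k + 1) * C * ?T)"
      unfolding triple_norm_def triple_def by (intro real_sqrt_le_mono) (simp add: algebra_simps)
    also have "\<dots> = sqrt ((real k + 1) * C) * top_norm k a b U"
      by (simp add: real_sqrt_mult top_norm_def)
    finally have "c * triple_norm k a b U \<le> c * (sqrt ((real k + 1) * C) * top_norm k a b U)"
      using c by (intro mult_left_mono) auto
    also have "\<dots> = top_norm k a b U" using C(1) by (simp add: c_def)
    finally show ?thesis .
  qed
  have upper: "top_norm k a b U \<le> 1 * triple_norm k a b U" for U :: "'n point \<Rightarrow> real"
  proof -
    have "sq_int b (a + real k - real k) (nabla_D k a b k U) \<le> (\<Sum>j\<le>k. sq_int b (a + real k - real j) (nabla_D k a b j U))"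
      by (intro member_le_sum) (auto simp: sq_int_nonneg)
    then show ?thesis by (simp add: top_norm_def triple_norm_def triple_def)
  qed
  show ?thesis unfolding equivalent_norms_on_def using c lower upper by (meson zero_less_one)
qed

end

theorem theorem3p5:
  fixes k :: nat and a b :: real
  assumes "- 1 < b" and "b < 1"
    and "0 \<le> a" and "a < (real CARD('n::finite) + 1 + b) / 2 - real k"
  shows "hilbertian_norm_on (D_e k a b :: ('n point \<Rightarrow> real) set) (top_norm k a b)
    \<and> equivalent_norms_on (D_e k a b :: ('n point \<Rightarrow> real) set) (top_norm k a b) (triple_norm k a b)
    \<and> (\<forall>U \<in> (D_e k a b :: ('n point \<Rightarrow> real) set).
        (LINT z|lborel. \<bar>snd z\<bar> powr b * norm z powr (- 2 * a) * (norm (nabla_D k a b k U z))\<^sup>2)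
        \<ge> (H_const CARD('n) k a b)\<^sup>2
            * (LINT z|lborel. \<bar>snd z\<bar> powr b * norm z powr (- 2 * (a + real k)) * (U z)\<^sup>2))"
proof -
  have k: "2 * (a + real k) < real CARD('n) + 1 + b" using assms(4) by (simp add: field_simps)
  show ?thesis
    using hilbertian_top_norm[OF assms(1,3) k] equivalent_top_norm[OF assms(1,3) k]
      hardy_rellich_D[OF assms(1,3) k]
    by (auto simp: sq_int_def weight_def)
qed

end
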